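(* Let $k\geq 1$, $\tau\in\{-1,0,1\}$ and let $a,b$ be integers with $0\leq a,b\leq k$. Put $K:=3k+\tau+3$. Then, as formal power series in $q$, \[ \sum_{\substack{\lambda_1\geq\cdots\geq\lambda_k\geq 0\\ \mu_1\geq\cdots\geq\mu_k\geq 0}} \frac{1-q^{\lambda_a+\mu_b+1}}{1-q}\, \frac{q^{\sum_{i=1}^k(\lambda_i^2-\lambda_i\mu_i+\mu_i^2)+\sum_{i=a+1}^k\lambda_i+\sum_{i=b+1}^k\mu_i}} {\prod_{i=1}^{k-1}(q;q)_{\lambda_i-\lambda_{i+1}}(q;q)_{\mu_i-\mu_{i+1}}}\, g_{\lambda_k,\mu_k;\tau}(q) =\frac{(q^K;q^K)_\infty^2}{(q;q)_\infty^3}\,\theta\big(q^{a+1},q^{b+1},q^{a+b+2};q^K\big), \] where the sum is over integers $\lambda_i,\mu_i$ and the convention $q^{\lambda_0}=q^{\mu_0}:=0$ is used (so the factor $1-q^{\lambda_a+\mu_b+1}$ equals $1$ when $a=0$ or $b=0$).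
   Context: $(a;q)_\infty=\prod_{j\ge0}(1-aq^j)$, $(a;q)_n=(a;q)_\infty/(aq^n;q)_\infty$ for $n\in\mathbb{Z}$ (so $1/(q;q)_n=0$ for $n<0$), $(a_1,\dots,a_k;q)_n=\prod_i(a_i;q)_n$. The $q$-binomial coefficient is $\binom{n}{m}_q=\frac{(q;q)_n}{(q;q)_m(q;q)_{n-m}}$ for $0\le m\le n$ and $0$ otherwise. $\theta(z;q)=(z;q)_\infty(q/z;q)_\infty$ and $\theta(z_1,\dots,z_n;q)=\prod_i\theta(z_i;q)$. For $n,m\in\mathbb{N}_0$ and $\tau\in\{-1,0,1\}$, \[g_{n,m;\tau}(q):=\frac{q^{\tau(\tau-1)nm}}{(q;q)_{n+m}(q^2;q)_{n+m}}\binom{n+m}{n}_p,\] with $p=q$ if $\tau^2=1$ and $p=q^3$ if $\tau=0$. *)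

theory Defs
  imports "HOL-Computational_Algebra.Formal_Power_Series" "HOL-Analysis.Analysis"
begin

text \<open>All series are formal power series in q = fps_X with real coefficients.
  The topology on fps is the library's (X-adic) metric topology.\<close>

definition qpoch :: "nat \<Rightarrow> nat \<Rightarrow> nat \<Rightarrow> real fps" where
  "qpoch c d n = (\<Prod>j<n. 1 - fps_X ^ (c + d * j))"

definition qpoch_inf :: "nat \<Rightarrow> nat \<Rightarrow> real fps" where
  "qpoch_inf c d = lim (\<lambda>N. qpoch c d N)"

text \<open>theta(q^c; q^d) = (q^c;q^d)_inf (q^(d-c);q^d)_inf, used for 0 < c < d.\<close>
definition qtheta :: "nat \<Rightarrow> nat \<Rightarrow> real fps" where
  "qtheta c d = qpoch_inf c d * qpoch_inf (d - c) d"

definition qbinom :: "nat \<Rightarrow> nat \<Rightarrow> nat \<Rightarrow> real fps" where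
  "qbinom s n m = (if m \<le> n then qpoch s s n / (qpoch s s m * qpoch s s (n - m)) else 0)"

definition gfun :: "nat \<Rightarrow> nat \<Rightarrow> int \<Rightarrow> real fps" where
  "gfun n m \<tau> = fps_X ^ (nat (\<tau> * (\<tau> - 1)) * n * m)
      / (qpoch 1 1 (n + m) * qpoch 2 1 (n + m))
      * qbinom (if \<tau>\<^sup>2 = 1 then 1 else 3) (n + m) n"

definition parts :: "nat \<Rightarrow> (nat \<Rightarrow> nat) set" where
  "parts k = {l. (\<forall>i. i \<notin> {1..k} \<longrightarrow> l i = 0) \<and> (\<forall>i\<in>{1..<k}. l (i + 1) \<le> l i)}"

definition summand :: "nat \<Rightarrow> int \<Rightarrow> nat \<Rightarrow> nat \<Rightarrow> (nat \<Rightarrow> nat) \<Rightarrow> (nat \<Rightarrow> nat) \<Rightarrow> real fps" where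
  "summand k \<tau> a b l m =
     (if a = 0 \<or> b = 0 then 1 else 1 - fps_X ^ (l a + m b + 1)) / (1 - fps_X)
     * fps_X ^ (nat (\<Sum>i=1..k. int (l i)^2 - int (l i) * int (m i) + int (m i)^2)
                 + (\<Sum>i=a+1..k. l i) + (\<Sum>i=b+1..k. m i))
     / (\<Prod>i=1..k-1. qpoch 1 1 (l i - l (i + 1)) * qpoch 1 1 (m i - m (i + 1)))
     * gfun (l k) (m k) \<tau>"

end

theory Submission
  imports Defs "HOL-Computational_Algebra.Formal_Laurent_Series"
begin

text \<open>
  Let K(n,m;c) be the product of (q;q)_(n+m) with the reciprocals of (q;q)_(n+c_i) and (q;q)_(m-c_i)
  for i = 1, 2, 3. Summing K(r,s;c) against q^(r^2-rs+s^2) / ((q;q)_(n-r) (q;q)_(m-s)) reproduces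
  K(n,m;c) up to a power of q: the summation operator commutes with the two Hamiltonians of a q-Toda
  chain of which K is a joint eigenfunction, and these determine K up to a scalar. Extra weights q^r
  and q^(r+s) amount to replacing (n,m) by (n+1,m) and (n+1,m+1).

  The function g is an alternating sum of kernels K(n+1,m+1;c) over integer triples c of sum zero with
  pairwise distinct residues modulo 3. Applying the operator k times gives a finite form of
  the identity. The shift (1,1) becomes (1,0) at index b by antisymmetry in c, and (1,0) becomes
  (0,0) at index a; the second change is what the factor 1 - q^(lambda_a+mu_b+1) achieves. As
  n and m tend to infinity every kernel tends to (q;q)^(-5), and what remains is the lattice sum of the
  A2 Macdonald identity. The latter is the product of three Jacobi triple products: one of the three
  summations can be carried out, being a pentagonal number series or zero.
\<close>

section \<open>The A2 Bailey lemma\<close>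

text \<open>The identities at finite n and m contain signed powers such as q^(u - v), so they are
  proved over a field with generic q. The locale is used for formal Laurent series at base
  \<open>fls_X\<close>, its cube and its K-th power, and the results are pulled back to power
  series. Origin of K: put N = x^2 + x y + y^2 and t = (N - 1)/3. In the seed, q^(\<tau> t) comes
  from a theta coefficient and q^(N + 1) from a product of three q-binomials, which gives the weight
  q^((3 + \<tau>) t). Each of the k steps adds q^(3 t), hence K = 3 k + \<tau> + 3. Origin of g: up
  to a power of q and the factor (q;q)_R (q;q)_(R+1), R = n + m, its alternating sum is the
  coefficient at the exponents n + 1, n, n - 1 of an A2 theta function of nome q^\<tau> times a
  finite product. Antisymmetry and quasi-periodicity reduce the recursion in R to that of a
  q-binomial. For \<tau> = 0 the theta function is periodic, the two middle terms of the recursion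
  vanish, and the base q^3 appears. Different alternating sums are compared by antisymmetrizing
  their summands: these share a symmetric factor, and a polynomial identity in the q^(c_i)
  remains.\<close>

locale generic_q =
  fixes q :: "'a::field_char_0"
  assumes q_nonzero [simp]: "q \<noteq> 0"
    and q_not_root_of_unity: "n > 0 \<Longrightarrow> q ^ n \<noteq> 1"
begin

lemma powi_eq_1_iff: "q powi n = 1 \<longleftrightarrow> n = 0"
proof
  assume h: "q powi n = 1"
  show "n = 0"
  proof (rule ccontr)
    assume "n \<noteq> 0"
    then have "q ^ nat \<bar>n\<bar> = 1"
      using h by (cases "n \<ge> 0") (auto simp: power_int_def power_inverse)
    then show False
      using q_not_root_of_unity[of "nat \<bar>n\<bar>"] \<open>n \<noteq> 0\<close> by simp
  qed
qed simp

lemma powi_add: "q powi (m + n) = q powi m * q powi n"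
  by (simp add: power_int_add)

lemma powi_diff: "q powi (m - n) = q powi m / q powi n"
  by (simp add: power_int_diff)

section \<open>Reciprocal q-factorials and the kernel\<close>

definition poch :: "nat \<Rightarrow> 'a" where
  "poch n = (\<Prod>j<n. 1 - q ^ Suc j)"

lemma poch_0 [simp]: "poch 0 = 1"
  by (simp add: poch_def)

lemma poch_Suc: "poch (Suc n) = (1 - q ^ Suc n) * poch n"
  by (simp add: poch_def)

lemma poch_nonzero [simp]: "poch n \<noteq> 0"
  using q_not_root_of_unity by (induction n) (auto simp: poch_Suc simp del: power_Suc)

definition ipoch :: "int \<Rightarrow> 'a" where
  "ipoch n = (if n < 0 then 0 else inverse (poch (nat n)))"

lemma ipoch_neg: "n < 0 \<Longrightarrow> ipoch n = 0"
  by (simp add: ipoch_def)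

lemma ipoch_0 [simp]: "ipoch 0 = 1"
  by (simp add: ipoch_def)

lemma ipoch_of_nat: "ipoch (int n) = inverse (poch n)"
  by (simp add: ipoch_def)

text \<open>Valid at every integer: at \<open>n = 0\<close> the factor \<open>1 - q powi n\<close>
  vanishes together with \<open>ipoch (- 1)\<close>. The recurrences built on it therefore need no
  positivity conditions.\<close>

lemma ipoch_minus_1: "ipoch (n - 1) = (1 - q powi n) * ipoch n"
proof (cases "n \<le> 0")
  case True
  then show ?thesis by (cases "n = 0") (auto simp: ipoch_def)
next
  case False
  then obtain k where k: "n = int (Suc k)"
    by (metis not_le zero_less_imp_eq_int gr0_implies_Suc)
  then have "n - 1 = int k" by simp
  then have "ipoch (n - 1) = inverse (poch k)"
    using ipoch_of_nat by metis
  moreover have "ipoch n = inverse (poch (Suc k))"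
    using k ipoch_of_nat by metis
  moreover have "q powi n = q ^ Suc k"
    using k by (metis power_int_of_nat)
  moreover have "1 - q ^ Suc k \<noteq> 0"
    using q_not_root_of_unity[of "Suc k"] by auto
  ultimately show ?thesis
    by (simp add: poch_Suc del: power_Suc)
qed

text \<open>If \<open>A + B < 0\<close>, then \<open>A + c1\<close> or \<open>B - c1\<close> is
  negative and the product vanishes, so the truncation by \<open>nat\<close> is harmless.\<close>

definition ker :: "int \<Rightarrow> int \<Rightarrow> int \<Rightarrow> int \<Rightarrow> int \<Rightarrow> 'a" where
  "ker A B c1 c2 c3 = poch (nat (A + B))
     * (ipoch (A + c1) * ipoch (A + c2) * ipoch (A + c3) * (ipoch (B - c1) * ipoch (B - c2) * ipoch (B - c3)))"

text \<open>The diagram symmetry of A2. It turns each statement about the first variable into one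
  about the second.\<close>

lemma ker_flip: "ker B A (- c1) (- c2) (- c3) = ker A B c1 c2 c3"
  by (simp add: ker_def add.commute mult.commute)

lemma ker_eq_0:
  assumes "A + c1 < 0 \<or> A + c2 < 0 \<or> A + c3 < 0 \<or> B < c1 \<or> B < c2 \<or> B < c3"
  shows "ker A B c1 c2 c3 = 0"
  using assms by (auto simp: ker_def ipoch_neg)

lemma ker_rec1:
  "(1 - q powi (A + B)) * ker (A - 1) B c1 c2 c3
    = (1 - q powi (A + c1)) * (1 - q powi (A + c2)) * (1 - q powi (A + c3)) * ker A B c1 c2 c3"
proof (cases "A + B \<ge> 1")
  case True
  then obtain k where k: "A + B = int (Suc k)"
    by (metis zero_less_imp_eq_int gr0_implies_Suc int_one_le_iff_zero_less)
  then have "nat (A - 1 + B) = k" "nat (A + B) = Suc k" by auto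
  moreover have "q powi (A + B) = q ^ Suc k"
    using k by (metis power_int_of_nat)
  moreover have "ipoch (A - 1 + c) = (1 - q powi (A + c)) * ipoch (A + c)" for c
    using ipoch_minus_1[of "A + c"] by (simp add: algebra_simps)
  ultimately show ?thesis
    by (simp add: ker_def poch_Suc del: power_Suc)
next
  case False
  have "ker (A - 1) B c1 c2 c3 = 0"
    using False by (intro ker_eq_0) auto
  \<comment> \<open>When \<open>A + B \<le> 0\<close>, the numbers \<open>A + c1\<close> and
    \<open>B - c1\<close> can both be nonnegative only if both are 0, and then the first factor
    vanishes.\<close>
  moreover have "(1 - q powi (A + c1)) * ker A B c1 c2 c3 = 0"
  proof (cases "A + c1 = 0")
    case False
    then have "ker A B c1 c2 c3 = 0"
      using \<open>\<not> A + B \<ge> 1\<close> by (intro ker_eq_0) auto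
    then show ?thesis by simp
  qed auto
  ultimately show ?thesis by auto
qed

lemma ker_rec2:
  "(1 - q powi (A + B)) * ker A (B - 1) c1 c2 c3
    = (1 - q powi (B - c1)) * (1 - q powi (B - c2)) * (1 - q powi (B - c3)) * ker A B c1 c2 c3"
  using ker_rec1[of B A "- c1" "- c2" "- c3"] by (simp add: ker_flip[of _ A] ker_flip[of _ "A"] add.commute)

text \<open>The Hamiltonian on the right-hand side belongs to the relativistic (q-)Toda chain.\<close>

lemma ker_toda:
  "(q powi c1 + q powi c2 + q powi c3) * ker A B c1 c2 c3
    = q powi (- A) * (ker A B c1 c2 c3 - ker (A - 1) B c1 c2 c3) + q powi B * ker A B c1 c2 c3
      + q powi (c1 + c2 + c3 + A - B) * (ker A B c1 c2 c3 - ker A (B - 1) c1 c2 c3)"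
\<comment> \<open>The generic case divides by \<open>1 - q powi (A + B)\<close>. For
  \<open>A + B = 0\<close> the kernel is supported at \<open>c1 = c2 = c3 = B\<close>, where the
  claim is checked directly.\<close>
proof (cases "A + B = 0")
  case True
  have z: "ker (A - 1) B c1 c2 c3 = 0" "ker A (B - 1) c1 c2 c3 = 0"
    using True by (auto intro!: ker_eq_0)
  show ?thesis
  proof (cases "c1 = B \<and> c2 = B \<and> c3 = B")
    case c: True
    have e: "- A = B" "B + B + B + A - B = B" using True by auto
    have "c1 = B" "c2 = B" "c3 = B" using c by auto
    with z e show ?thesis by (simp only: distrib_right diff_zero)
  next
    case False
    then have "ker A B c1 c2 c3 = 0"
      using True by (intro ker_eq_0) auto
    then show ?thesis using z by simp
  qed
next
  case False
  define a b x y z where "a = q powi A" and "b = q powi B" and "x = q powi c1"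
    and "y = q powi c2" and "z = q powi c3"
  have nz: "a \<noteq> 0" "b \<noteq> 0" "x \<noteq> 0" "y \<noteq> 0" "z \<noteq> 0"
    by (simp_all add: a_def b_def x_def y_def z_def)
  have ab: "1 - a * b \<noteq> 0"
    using False powi_eq_1_iff[of "A + B"] by (simp add: a_def b_def powi_add)
  define K K1 K2 where "K = ker A B c1 c2 c3" and "K1 = ker (A - 1) B c1 c2 c3"
    and "K2 = ker A (B - 1) c1 c2 c3"
  have r1: "K1 = (1 - a * x) * (1 - a * y) * (1 - a * z) * K / (1 - a * b)"
    using ker_rec1[of A B c1 c2 c3] ab
    by (simp add: K_def K1_def a_def b_def x_def y_def z_def powi_add field_simps)
  have r2: "K2 = (1 - b / x) * (1 - b / y) * (1 - b / z) * K / (1 - a * b)"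
    using ker_rec2[of A B c1 c2 c3] ab
    by (simp add: K_def K2_def a_def b_def x_def y_def z_def powi_add powi_diff eq_divide_eq mult_ac)
  have k1: "(1 - a * b) * (K - K1) = ((1 - a * b) - (1 - a * x) * (1 - a * y) * (1 - a * z)) * K"
    using ab by (simp add: r1 field_simps)
  have k2: "x * y * z * ((1 - a * b) * (K - K2))
      = (x * y * z * (1 - a * b) - (x - b) * (y - b) * (z - b)) * K"
    using ab nz by (simp add: r2 field_simps)
  have "a * b * (1 - a * b) * ((x + y + z) * K)
     = b * ((1 - a * b) * (K - K1)) + a * b * b * (1 - a * b) * K
       + a * a * (x * y * z * ((1 - a * b) * (K - K2)))"
    unfolding k1 k2 by algebra
  also have "\<dots> = a * b * (1 - a * b) * ((K - K1) / a + b * K + x * y * z * a / b * (K - K2))"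
    using nz by (simp add: field_simps)
  finally have "(x + y + z) * K = (K - K1) / a + b * K + x * y * z * a / b * (K - K2)"
    using nz ab by simp
  then show ?thesis
    by (simp add: K_def K1_def K2_def a_def b_def x_def y_def z_def powi_add powi_diff power_int_minus
        divide_inverse mult_ac)
qed

end

section \<open>The summation operator commutes with the Toda Hamiltonians\<close>

lemma sum_int_shift:
  fixes f :: "int \<Rightarrow> 'b::ab_group_add"
  assumes "f (l - 1) = 0" "f h = 0" "l \<le> h"
  shows "(\<Sum>A\<in>{l..h}. f (A - 1)) = (\<Sum>A\<in>{l..h}. f A)"
proof -
  have "(\<Sum>A\<in>{l..h}. f (A - 1)) = (\<Sum>A\<in>{l-1..h-1}. f A)"
    by (rule sum.reindex_bij_witness[of _ "\<lambda>A. A + 1" "\<lambda>A. A - 1"]) auto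
  also have "{l-1..h-1} = insert (l-1) {l..h-1}" using assms(3) by auto
  also have "sum f \<dots> = sum f {l..h-1}" using assms(1) by simp
  also have "sum f {l..h-1} = sum f {l..h}"
    by (rule sum.mono_neutral_left)  (use assms(2) in \<open>auto simp: not_le intro: ssubst[of _ h]\<close>)
  finally show ?thesis .
qed

context generic_q begin

text \<open>The linear term accounts for triples whose sum \<open>t\<close> is not 0. Replacing A,
  B, c_i by A - s, B + s, c_i + s fixes the kernel and raises \<open>t\<close> by 3 s; the exponent
  then changes only by a constant.\<close>

definition fweight :: "int \<Rightarrow> int \<Rightarrow> int \<Rightarrow> 'a" where
  "fweight t A B = q powi (A\<^sup>2 - A * B + B\<^sup>2 + t * (A - B))"

lemma fweight_shift1: "fweight t (A + 1) B = fweight t A B * q powi (2 * A + 1 - B + t)"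
  by (simp add: fweight_def power2_eq_square algebra_simps flip: powi_add)

lemma fweight_shift2: "fweight t A (B + 1) = fweight t A B * q powi (2 * B + 1 - A - t)"
  by (simp add: fweight_def power2_eq_square algebra_simps flip: powi_add)

lemma fweight_flip: "fweight (- t) B A = fweight t A B"
  by (simp add: fweight_def algebra_simps)

text \<open>For \<open>l\<close> below the support of the kernel and \<open>h\<close> at least
  \<open>n\<close> and \<open>m\<close> this is the sum over all integers A and B.\<close>

definition kernel_sum :: "int \<Rightarrow> int \<Rightarrow> int \<Rightarrow> int \<Rightarrow> int \<Rightarrow> int \<Rightarrow> int \<Rightarrow> 'a" where
  "kernel_sum l h c1 c2 c3 n m = (\<Sum>A\<in>{l..h}. \<Sum>B\<in>{l..h}.
     fweight (c1 + c2 + c3) A B * ipoch (n - A) * ipoch (m - B) * ker A B c1 c2 c3)"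

lemma kernel_sum_flip: "kernel_sum l h (- c1) (- c2) (- c3) m n = kernel_sum l h c1 c2 c3 n m"
proof -
  have "fweight (- c1 - c2 - c3) B A = fweight (c1 + c2 + c3) A B" for A B
    using fweight_flip[of "c1 + c2 + c3" B A] by (simp add: algebra_simps)
  then show ?thesis
    unfolding kernel_sum_def by (subst sum.swap) (simp add: ker_flip mult_ac)
qed

text \<open>Since \<open>ipoch (n - 1 - A)\<close> is \<open>ipoch (n - A)\<close> times
  \<open>1 - q powi (n - A)\<close>, multiplication by \<open>q powi (- A)\<close> under the sum is
  a difference in the outer variable. This carries the Hamiltonian from inside to outside.\<close>

lemma kernel_sum_diff1:
  "kernel_sum l h c1 c2 c3 n m - kernel_sum l h c1 c2 c3 (n - 1) m = q powi n * (\<Sum>A\<in>{l..h}. \<Sum>B\<in>{l..h}.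
     q powi (- A) * (fweight (c1 + c2 + c3) A B * ipoch (n - A) * ipoch (m - B) * ker A B c1 c2 c3))"
proof -
  have ipoch: "ipoch (n - 1 - A) = (1 - q powi n * q powi (- A)) * ipoch (n - A)" for A
    using ipoch_minus_1[of "n - A"] powi_add[of n "- A"] by (simp add: algebra_simps)
  show ?thesis
    unfolding kernel_sum_def sum_subtractf[symmetric] sum_distrib_left ipoch
    by (intro sum.cong refl) algebra
qed

lemma kernel_sum_diff2:
  "kernel_sum l h c1 c2 c3 n m - kernel_sum l h c1 c2 c3 n (m - 1) = q powi m * (\<Sum>A\<in>{l..h}. \<Sum>B\<in>{l..h}.
     q powi (- B) * (fweight (c1 + c2 + c3) A B * ipoch (n - A) * ipoch (m - B) * ker A B c1 c2 c3))"
proof -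
  have ipoch: "ipoch (m - 1 - B) = (1 - q powi m * q powi (- B)) * ipoch (m - B)" for B
    using ipoch_minus_1[of "m - B"] powi_add[of m "- B"] by (simp add: algebra_simps)
  show ?thesis
    unfolding kernel_sum_def sum_subtractf[symmetric] sum_distrib_left ipoch
    by (intro sum.cong refl) algebra
qed

text \<open>Apply \<open>ker_toda\<close> under the sum and move the shifts of A and B from the
  kernel onto the weights. The terms in q^(t + A - B) and q^B cancel, and what is left is the same
  Hamiltonian in n and m. The bound \<open>l < - \<bar>c1\<bar>\<close> kills the lower boundary
  terms of both shifts and survives the change of sign of the triple.\<close>

lemma kernel_sum_toda:
  fixes c1 c2 c3 :: int
  assumes l: "l < - \<bar>c1\<bar>" and nm: "n \<le> h" "m \<le> h" and lh: "l \<le> h"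
  defines "G \<equiv> kernel_sum l h c1 c2 c3"
  shows "(q powi c1 + q powi c2 + q powi c3) * G n m
    = q powi (- n) * (G n m - G (n - 1) m) + q powi m * G n m
      + q powi (c1 + c2 + c3 + n - m) * (G n m - G n (m - 1))"
proof -
  define t where "t = c1 + c2 + c3"
  define X where "X = (\<lambda>A B. ker A B c1 c2 c3)"
  define T where "T = (\<lambda>A B. fweight t A B * ipoch (n - A) * ipoch (m - B))"
  \<comment> \<open>The quadratic form is chosen so that a shift of A in the weight produces exactly
    the coefficient q^(t + A - B) of the other Toda term.\<close>
  have T1: "q powi (- A - 1) * T (A + 1) B = q powi (t + A - B) * (1 - q powi (n - A)) * T A B" for A B
  proof -
    have "ipoch (n - (A + 1)) = (1 - q powi (n - A)) * ipoch (n - A)"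
      using ipoch_minus_1[of "n - A"] by (simp add: algebra_simps)
    moreover have "q powi (- A - 1) * q powi (2 * A + 1 - B + t) = q powi (t + A - B)"
      by (simp flip: powi_add add: algebra_simps)
    ultimately show ?thesis
      unfolding T_def fweight_shift1 by algebra
  qed
  have T2: "q powi (t + A - B - 1) * T A (B + 1) = q powi B * (1 - q powi (m - B)) * T A B" for A B
  proof -
    have "ipoch (m - (B + 1)) = (1 - q powi (m - B)) * ipoch (m - B)"
      using ipoch_minus_1[of "m - B"] by (simp add: algebra_simps)
    moreover have "q powi (t + A - B - 1) * q powi (2 * B + 1 - A - t) = q powi B"
      by (simp flip: powi_add add: algebra_simps)
    ultimately show ?thesis
      unfolding T_def fweight_shift2 by algebra
  qed
  have S1: "(\<Sum>A\<in>{l..h}. \<Sum>B\<in>{l..h}. q powi (- A) * T A B * X (A - 1) B)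
      = (\<Sum>A\<in>{l..h}. \<Sum>B\<in>{l..h}. q powi (t + A - B) * (1 - q powi (n - A)) * T A B * X A B)"
  proof -
    have "(\<Sum>A\<in>{l..h}. \<Sum>B\<in>{l..h}. q powi (- A) * T A B * X (A - 1) B)
        = (\<Sum>A\<in>{l..h}. (\<lambda>A'. \<Sum>B\<in>{l..h}. q powi (- A' - 1) * T (A' + 1) B * X A' B) (A - 1))"
      by simp
    also have "\<dots> = (\<Sum>A\<in>{l..h}. \<Sum>B\<in>{l..h}. q powi (- A - 1) * T (A + 1) B * X A B)"
      using l nm lh by (intro sum_int_shift sum.neutral) (auto simp: X_def T_def ipoch_neg intro!: ker_eq_0)
    finally show ?thesis by (simp add: T1)
  qed
  have S2: "(\<Sum>A\<in>{l..h}. \<Sum>B\<in>{l..h}. q powi (t + A - B) * T A B * X A (B - 1))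
      = (\<Sum>A\<in>{l..h}. \<Sum>B\<in>{l..h}. q powi B * (1 - q powi (m - B)) * T A B * X A B)"
  proof (rule sum.cong[OF refl])
    fix A
    have "(\<Sum>B\<in>{l..h}. q powi (t + A - B) * T A B * X A (B - 1))
        = (\<Sum>B\<in>{l..h}. (\<lambda>B'. q powi (t + A - B' - 1) * T A (B' + 1) * X A B') (B - 1))"
      by (simp add: add_diff_eq)
    also have "\<dots> = (\<Sum>B\<in>{l..h}. q powi (t + A - B - 1) * T A (B + 1) * X A B)"
      using l nm lh by (intro sum_int_shift) (auto simp: X_def T_def ipoch_neg intro!: ker_eq_0)
    finally show "(\<Sum>B\<in>{l..h}. q powi (t + A - B) * T A B * X A (B - 1))
      = (\<Sum>B\<in>{l..h}. q powi B * (1 - q powi (m - B)) * T A B * X A B)"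
      by (simp add: T2)
  qed
  have G: "G n m = (\<Sum>A\<in>{l..h}. \<Sum>B\<in>{l..h}. T A B * X A B)"
    by (simp add: G_def kernel_sum_def T_def X_def t_def)
  have "(q powi c1 + q powi c2 + q powi c3) * G n m
      = (\<Sum>A\<in>{l..h}. \<Sum>B\<in>{l..h}. T A B * ((q powi c1 + q powi c2 + q powi c3) * X A B))"
    unfolding G sum_distrib_left by (intro sum.cong refl) (simp add: mult_ac)
  also have "\<dots> = (\<Sum>A\<in>{l..h}. \<Sum>B\<in>{l..h}.
       (q powi (- A) + q powi B + q powi (t + A - B)) * T A B * X A B
       - q powi (- A) * T A B * X (A - 1) B - q powi (t + A - B) * T A B * X A (B - 1))"
    unfolding X_def ker_toda t_def by (intro sum.cong refl) (simp add: algebra_simps)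
  also have "\<dots> = (\<Sum>A\<in>{l..h}. \<Sum>B\<in>{l..h}.
       (q powi (- A) + q powi B + q powi (t + A - B)) * T A B * X A B
       - q powi (t + A - B) * (1 - q powi (n - A)) * T A B * X A B
       - q powi B * (1 - q powi (m - B)) * T A B * X A B)"
    unfolding sum_subtractf S1 S2 ..
  also have "\<dots> = (\<Sum>A\<in>{l..h}. \<Sum>B\<in>{l..h}.
       q powi (- A) * (T A B * X A B) + q powi m * (T A B * X A B)
         + q powi (t + n) * (q powi (- B) * (T A B * X A B)))"
  proof (intro sum.cong refl)
    fix A B
    have "q powi (t + A - B) * q powi (n - A) = q powi (t + n) * q powi (- B)"
      "q powi B * q powi (m - B) = q powi m"
      by (simp_all flip: powi_add add: add_diff_eq)
    then show "(q powi (- A) + q powi B + q powi (t + A - B)) * T A B * X A B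
       - q powi (t + A - B) * (1 - q powi (n - A)) * T A B * X A B
       - q powi B * (1 - q powi (m - B)) * T A B * X A B
       = q powi (- A) * (T A B * X A B) + q powi m * (T A B * X A B)
         + q powi (t + n) * (q powi (- B) * (T A B * X A B))"
      by algebra
  qed
  also have "\<dots> = (\<Sum>A\<in>{l..h}. \<Sum>B\<in>{l..h}. q powi (- A) * (T A B * X A B)) + q powi m * G n m
      + q powi (t + n) * (\<Sum>A\<in>{l..h}. \<Sum>B\<in>{l..h}. q powi (- B) * (T A B * X A B))"
    by (simp add: sum.distrib sum_distrib_left G)
  also have "(\<Sum>A\<in>{l..h}. \<Sum>B\<in>{l..h}. q powi (- A) * (T A B * X A B))
      = q powi (- n) * (G n m - G (n - 1) m)"
    using kernel_sum_diff1[of l h c1 c2 c3 n m]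
    by (simp add: G_def T_def X_def t_def mult_ac power_int_minus)
  also have "(\<Sum>A\<in>{l..h}. \<Sum>B\<in>{l..h}. q powi (- B) * (T A B * X A B))
      = q powi (- m) * (G n m - G n (m - 1))"
    using kernel_sum_diff2[of l h c1 c2 c3 n m]
    by (simp add: G_def T_def X_def t_def mult_ac power_int_minus)
  finally show ?thesis
    by (simp add: t_def powi_add powi_diff power_int_minus divide_inverse mult_ac)
qed

text \<open>The Toda relation and its mirror image under \<open>kernel_sum_flip\<close> are two
  linear equations between the values at (n, m), (n - 1, m) and (n, m - 1). Eliminating the last one
  leaves the first-order recurrence of the kernel itself.\<close>

lemma kernel_sum_rec1:
  assumes l: "l < - \<bar>c1\<bar>" and nm: "n \<le> h" "m \<le> h" and lh: "l \<le> h"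
  shows "(1 - q powi (n + m)) * kernel_sum l h c1 c2 c3 (n - 1) m
    = (1 - q powi (n + c1)) * (1 - q powi (n + c2)) * (1 - q powi (n + c3)) * kernel_sum l h c1 c2 c3 n m"
proof -
  define a b x y z where "a = q powi n" and "b = q powi m" and "x = q powi c1"
    and "y = q powi c2" and "z = q powi c3"
  have nz: "a \<noteq> 0" "b \<noteq> 0" "x \<noteq> 0" "y \<noteq> 0" "z \<noteq> 0"
    by (simp_all add: a_def b_def x_def y_def z_def)
  define G G1 G2 where "G = kernel_sum l h c1 c2 c3 n m" and "G1 = kernel_sum l h c1 c2 c3 (n - 1) m"
    and "G2 = kernel_sum l h c1 c2 c3 n (m - 1)"
  have I: "(x + y + z) * G = (G - G1) / a + b * G + x * y * z * a / b * (G - G2)"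
    using kernel_sum_toda[OF assms]
    by (simp add: G_def G1_def G2_def a_def b_def x_def y_def z_def powi_add powi_diff power_int_minus
        divide_inverse mult_ac)
  have II: "(1 / x + 1 / y + 1 / z) * G = (G - G2) / b + a * G + b / (x * y * z * a) * (G - G1)"
    using kernel_sum_toda[of l "- c1" m h n "- c2" "- c3"] l nm lh
    by (simp add: kernel_sum_flip G_def G1_def G2_def a_def b_def x_def y_def z_def powi_add powi_diff
        power_int_minus divide_inverse mult_ac)
  have I': "a * b * (x + y + z) * G = b * (G - G1) + a * b * b * G + x * y * z * a * a * (G - G2)"
  proof -
    have "a * b * (x + y + z) * G = a * b * ((x + y + z) * G)" by simp
    also have "\<dots> = a * b * ((G - G1) / a) + a * b * b * G + a * b * (x * y * z * a / b * (G - G2))"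
      unfolding I by (simp only: distrib_left mult.assoc)
    also have "a * b * ((G - G1) / a) = b * (G - G1)" using nz by simp
    also have "a * b * (x * y * z * a / b * (G - G2)) = x * y * z * a * a * (G - G2)" using nz by simp
    finally show ?thesis .
  qed
  have II': "a * b * (y * z + x * z + x * y) * G
      = x * y * z * a * (G - G2) + x * y * z * a * a * b * G + b * b * (G - G1)"
  proof -
    have "a * b * (y * z + x * z + x * y) * G = a * b * x * y * z * ((1 / x + 1 / y + 1 / z) * G)"
      using nz by (simp add: field_simps)
    also have "\<dots> = a * b * x * y * z * ((G - G2) / b) + a * b * x * y * z * (a * G)
        + a * b * x * y * z * (b / (x * y * z * a) * (G - G1))"
      unfolding II by (simp only: distrib_left)
    also have "a * b * x * y * z * ((G - G2) / b) = x * y * z * a * (G - G2)" using nz by simp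
    also have "a * b * x * y * z * (b / (x * y * z * a) * (G - G1)) = b * b * (G - G1)" using nz by simp
    also have "a * b * x * y * z * (a * G) = x * y * z * a * a * b * G" by simp
    finally show ?thesis .
  qed
  \<comment> \<open>\<open>a\<close> times \<open>II'\<close> minus \<open>I'\<close> removes
    \<open>G2\<close>.\<close>
  have "b * ((1 - a * b) * G1) = b * ((1 - a * x) * (1 - a * y) * (1 - a * z) * G)"
    using I' II' by algebra
  then show ?thesis
    using nz by (simp add: G_def G1_def a_def b_def x_def y_def z_def powi_add)
qed

lemma kernel_sum_rec2:
  assumes "l < - \<bar>c1\<bar>" "n \<le> h" "m \<le> h" "l \<le> h"
  shows "(1 - q powi (n + m)) * kernel_sum l h c1 c2 c3 n (m - 1)
    = (1 - q powi (m - c1)) * (1 - q powi (m - c2)) * (1 - q powi (m - c3)) * kernel_sum l h c1 c2 c3 n m"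
  using kernel_sum_rec1[of l "- c1" m h n "- c2" "- c3"] assms by (simp add: kernel_sum_flip add.commute)

lemma kernel_sum_eq_0:
  assumes "n + c1 < 0 \<or> n + c2 < 0 \<or> n + c3 < 0 \<or> m < c1 \<or> m < c2 \<or> m < c3"
  shows "kernel_sum l h c1 c2 c3 n m = 0"
  unfolding kernel_sum_def
proof (intro sum.neutral ballI)
  fix A B
  show "fweight (c1 + c2 + c3) A B * ipoch (n - A) * ipoch (m - B) * ker A B c1 c2 c3 = 0"
  proof (cases "A > n \<or> B > m")
    case False
    then have "ker A B c1 c2 c3 = 0" using assms by (intro ker_eq_0) auto
    then show ?thesis by simp
  qed (auto simp: ipoch_neg)
qed

text \<open>Both sides obey the same two recurrences, whose coefficients do not vanish above the
  corner of the support; so they can differ only by a scalar, read off at that corner.\<close>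

lemma kernel_sum_eq:
  assumes "l < - \<bar>c1\<bar>" "l < - \<bar>c2\<bar>" "l < - \<bar>c3\<bar>" "n \<le> h" "m \<le> h"
  shows "kernel_sum l h c1 c2 c3 n m = q powi (- (c1 * c2 + c1 * c3 + c2 * c3)) * ker n m c1 c2 c3"
proof -
  \<comment> \<open>The least n and m at which no factor of the kernel vanishes.\<close>
  define n0 m0 where "n0 = - min c1 (min c2 c3)" and "m0 = max c1 (max c2 c3)"
  have *: "kernel_sum l h c1 c2 c3 n m = q powi (- (c1 * c2 + c1 * c3 + c2 * c3)) * ker n m c1 c2 c3"
    if "n \<le> h" "m \<le> h" "n \<ge> n0" "m \<ge> m0" for n m
    using that
  proof (induction "nat (n - n0 + (m - m0))" arbitrary: n m rule: less_induct)
    case less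
    have lh: "l \<le> h"
      using less.prems assms(1) by (auto simp: n0_def)
    consider "n > n0" | "n = n0" "m > m0" | "n = n0" "m = m0" using less.prems by linarith
    then show ?case
    proof cases
      case 1
      have "1 - q powi (n + c1) \<noteq> 0" "1 - q powi (n + c2) \<noteq> 0" "1 - q powi (n + c3) \<noteq> 0"
        using 1 powi_eq_1_iff[of "n + c1"] powi_eq_1_iff[of "n + c2"] powi_eq_1_iff[of "n + c3"]
        by (auto simp: n0_def)
      then have nz: "(1 - q powi (n + c1)) * (1 - q powi (n + c2)) * (1 - q powi (n + c3)) \<noteq> 0"
        by simp
      have IH: "kernel_sum l h c1 c2 c3 (n - 1) m = q powi (- (c1 * c2 + c1 * c3 + c2 * c3)) * ker (n - 1) m c1 c2 c3"
        using less.prems 1 by (intro less.hyps) auto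
      have "(1 - q powi (n + c1)) * (1 - q powi (n + c2)) * (1 - q powi (n + c3)) * kernel_sum l h c1 c2 c3 n m
          = q powi (- (c1 * c2 + c1 * c3 + c2 * c3)) * ((1 - q powi (n + m)) * ker (n - 1) m c1 c2 c3)"
        using kernel_sum_rec1[of l c1 n h m c2 c3] assms(1) less.prems lh unfolding IH by (simp add: mult_ac)
      also have "\<dots> = (1 - q powi (n + c1)) * (1 - q powi (n + c2)) * (1 - q powi (n + c3))
          * (q powi (- (c1 * c2 + c1 * c3 + c2 * c3)) * ker n m c1 c2 c3)"
        unfolding ker_rec1 by (simp only: mult_ac)
      finally show ?thesis using nz by (simp only: mult_cancel_left) simp
    next
      case 2
      have "1 - q powi (m - c1) \<noteq> 0" "1 - q powi (m - c2) \<noteq> 0" "1 - q powi (m - c3) \<noteq> 0"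
        using 2 powi_eq_1_iff[of "m - c1"] powi_eq_1_iff[of "m - c2"] powi_eq_1_iff[of "m - c3"]
        by (auto simp: m0_def)
      then have nz: "(1 - q powi (m - c1)) * (1 - q powi (m - c2)) * (1 - q powi (m - c3)) \<noteq> 0"
        by simp
      have IH: "kernel_sum l h c1 c2 c3 n (m - 1) = q powi (- (c1 * c2 + c1 * c3 + c2 * c3)) * ker n (m - 1) c1 c2 c3"
        using less.prems 2 by (intro less.hyps) auto
      have "(1 - q powi (m - c1)) * (1 - q powi (m - c2)) * (1 - q powi (m - c3)) * kernel_sum l h c1 c2 c3 n m
          = q powi (- (c1 * c2 + c1 * c3 + c2 * c3)) * ((1 - q powi (n + m)) * ker n (m - 1) c1 c2 c3)"
        using kernel_sum_rec2[of l c1 n h m c2 c3] assms(1) less.prems lh unfolding IH by (simp add: mult_ac)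
      also have "\<dots> = (1 - q powi (m - c1)) * (1 - q powi (m - c2)) * (1 - q powi (m - c3))
          * (q powi (- (c1 * c2 + c1 * c3 + c2 * c3)) * ker n m c1 c2 c3)"
        unfolding ker_rec2 by (simp only: mult_ac)
      finally show ?thesis using nz by (simp only: mult_cancel_left) simp
    next
      case 3
      \<comment> \<open>At the corner a single term survives: the kernel vanishes below it and a
        factor \<open>ipoch\<close> above it.\<close>
      have z: "fweight (c1 + c2 + c3) A B * ipoch (n0 - A) * ipoch (m0 - B) * ker A B c1 c2 c3 = 0"
        if "A \<noteq> n0 \<or> B \<noteq> m0" for A B
      proof (cases "A > n0 \<or> B > m0")
        case False
        then have "A < n0 \<or> B < m0" using that by auto
        then have "ker A B c1 c2 c3 = 0"
          by (intro ker_eq_0) (auto simp: n0_def m0_def min_def max_def split: if_splits)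
        then show ?thesis by simp
      qed (auto simp: ipoch_neg)
      have mem: "n0 \<in> {l..h}" "m0 \<in> {l..h}"
        using assms less.prems 3 by (auto simp: n0_def m0_def min_def max_def)
      have "kernel_sum l h c1 c2 c3 n0 m0 = (\<Sum>A\<in>{l..h}. \<Sum>B\<in>{l..h}.
          if A = n0 then (if B = m0 then fweight (c1 + c2 + c3) n0 m0 * ker n0 m0 c1 c2 c3 else 0) else 0)"
        unfolding kernel_sum_def
      proof (intro sum.cong refl)
        fix A B
        show "fweight (c1 + c2 + c3) A B * ipoch (n0 - A) * ipoch (m0 - B) * ker A B c1 c2 c3
          = (if A = n0 then (if B = m0 then fweight (c1 + c2 + c3) n0 m0 * ker n0 m0 c1 c2 c3 else 0) else 0)"
          using z[of A B] by (cases "A = n0 \<and> B = m0") auto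
      qed
      also have "\<dots> = (\<Sum>A\<in>{l..h}. if A = n0 then (\<Sum>B\<in>{l..h}. if B = m0 then fweight (c1 + c2 + c3) n0 m0 * ker n0 m0 c1 c2 c3 else 0) else 0)"
        by (intro sum.cong refl) auto
      also have "\<dots> = fweight (c1 + c2 + c3) n0 m0 * ker n0 m0 c1 c2 c3"
        using mem by simp
      also have "n0\<^sup>2 - n0 * m0 + m0\<^sup>2 + (c1 + c2 + c3) * (n0 - m0) = - (c1 * c2 + c1 * c3 + c2 * c3)"
        by (auto simp: n0_def m0_def min_def max_def power2_eq_square algebra_simps)
      then have "fweight (c1 + c2 + c3) n0 m0 = q powi (- (c1 * c2 + c1 * c3 + c2 * c3))"
        by (simp add: fweight_def)
      finally show ?thesis using 3 by simp
    qed
  qed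
  show ?thesis
  proof (cases "n \<ge> n0 \<and> m \<ge> m0")
    case True
    then show ?thesis using * assms by simp
  next
    case False
    then have "n + c1 < 0 \<or> n + c2 < 0 \<or> n + c3 < 0 \<or> m < c1 \<or> m < c2 \<or> m < c3"
      by (auto simp: n0_def m0_def)
    then show ?thesis using kernel_sum_eq_0 ker_eq_0 by simp
  qed
qed

end

lemma choose2_int: "s * (s - 1) div 2 = (s - 1) * (s - 1 - 1) div 2 + (s - 1)" for s :: int
proof -
  have "s * (s - 1) = (s - 1) * (s - 1 - 1) + (s - 1) * 2" by (simp add: algebra_simps)
  then show ?thesis by (simp only: div_mult_self1 zero_neq_numeral not_False_eq_True)
qed

lemma sum_int_eq_sum_nat:
  fixes f :: "int \<Rightarrow> 'b::comm_monoid_add"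
  assumes "l \<le> i" "i + int n \<le> h" "\<And>A. A \<in> {l..h} \<Longrightarrow> A < i \<or> A > i + int n \<Longrightarrow> f A = 0"
  shows "(\<Sum>A\<in>{l..h}. f A) = (\<Sum>r\<le>n. f (int r + i))"
proof -
  have "(\<Sum>A\<in>{l..h}. f A) = (\<Sum>A\<in>{i..i + int n}. f A)"
    by (rule sum.mono_neutral_right) (use assms in \<open>auto simp: not_le\<close>)
  also have "\<dots> = (\<Sum>r\<le>n. f (int r + i))"
    by (rule sum.reindex_bij_witness[of _ "\<lambda>r. int r + i" "\<lambda>A. nat (A - i)"]) auto
  finally show ?thesis .
qed

context generic_q begin

text \<open>The offsets \<open>i\<close> and \<open>j\<close> mark where the kernel starts to be
  nonzero, so that sums over integers become sums over natural numbers r and s.\<close>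

lemma ker_sum_nat:
  assumes "\<And>A B. A < i \<or> B < j \<Longrightarrow> ker A B c1 c2 c3 = 0"
  shows "(\<Sum>r\<le>n. \<Sum>s\<le>m. fweight (c1 + c2 + c3) (int r + i) (int s + j) * ipoch (int n - int r)
      * ipoch (int m - int s) * ker (int r + i) (int s + j) c1 c2 c3)
    = q powi (- (c1 * c2 + c1 * c3 + c2 * c3)) * ker (int n + i) (int m + j) c1 c2 c3"
proof -
  define h where "h = max (int n + i) (int m + j)"
  define l where "l = min (min i j) (- \<bar>c1\<bar> - \<bar>c2\<bar> - \<bar>c3\<bar> - 1)"
  have "kernel_sum l h c1 c2 c3 (int n + i) (int m + j)
    = (\<Sum>r\<le>n. \<Sum>s\<le>m. fweight (c1 + c2 + c3) (int r + i) (int s + j) * ipoch (int n - int r)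
      * ipoch (int m - int s) * ker (int r + i) (int s + j) c1 c2 c3)"
  proof -
    have "(\<Sum>B\<in>{l..h}. fweight (c1 + c2 + c3) A B * ipoch (int n + i - A) * ipoch (int m + j - B) * ker A B c1 c2 c3)
        = (\<Sum>s\<le>m. fweight (c1 + c2 + c3) A (int s + j) * ipoch (int n + i - A) * ipoch (int m + j - (int s + j)) * ker A (int s + j) c1 c2 c3)" for A
      by (rule sum_int_eq_sum_nat) (use assms in \<open>auto simp: l_def h_def ipoch_neg\<close>)
    then have "kernel_sum l h c1 c2 c3 (int n + i) (int m + j) = (\<Sum>A\<in>{l..h}. \<Sum>s\<le>m. fweight (c1 + c2 + c3) A (int s + j)
        * ipoch (int n + i - A) * ipoch (int m + j - (int s + j)) * ker A (int s + j) c1 c2 c3)"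
      by (simp add: kernel_sum_def)
    also have "\<dots> = (\<Sum>r\<le>n. \<Sum>s\<le>m. fweight (c1 + c2 + c3) (int r + i) (int s + j)
        * ipoch (int n + i - (int r + i)) * ipoch (int m + j - (int s + j)) * ker (int r + i) (int s + j) c1 c2 c3)"
      by (rule sum_int_eq_sum_nat) (use assms in \<open>auto simp: l_def h_def ipoch_neg intro!: sum.neutral\<close>)
    finally show ?thesis by simp
  qed
  moreover have "kernel_sum l h c1 c2 c3 (int n + i) (int m + j)
      = q powi (- (c1 * c2 + c1 * c3 + c2 * c3)) * ker (int n + i) (int m + j) c1 c2 c3"
    by (rule kernel_sum_eq) (auto simp: l_def h_def)
  ultimately show ?thesis by simp
qed

section \<open>One step of the A2 Bailey chain\<close>

definition bailey :: "int \<Rightarrow> int \<Rightarrow> (nat \<Rightarrow> nat \<Rightarrow> 'a) \<Rightarrow> nat \<Rightarrow> nat \<Rightarrow> 'a" where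
  "bailey x y f n m = (\<Sum>r\<le>n. \<Sum>s\<le>m.
     q powi ((int r)\<^sup>2 - int r * int s + (int s)\<^sup>2 + x * int r + y * int s)
       * ipoch (int n - int r) * ipoch (int m - int s) * f r s)"

lemma bailey_cong: "(\<And>r s. r \<le> n \<Longrightarrow> s \<le> m \<Longrightarrow> f r s = g r s) \<Longrightarrow> bailey x y f n m = bailey x y g n m"
  by (simp add: bailey_def)

lemma bailey_cmult: "bailey x y (\<lambda>r s. c * f r s) n m = c * bailey x y f n m"
  by (simp add: bailey_def sum_distrib_left mult_ac)

lemma bailey_diff: "bailey x y (\<lambda>r s. f r s - g r s) n m = bailey x y f n m - bailey x y g n m"
  by (simp add: bailey_def sum_subtractf algebra_simps)

lemma bailey_sum:
  "bailey x y (\<lambda>r s. \<Sum>k\<in>S. f k r s) n m = (\<Sum>k\<in>S. bailey x y (f k) n m)"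
proof -
  have "bailey x y (\<lambda>r s. \<Sum>k\<in>S. f k r s) n m = (\<Sum>r\<le>n. \<Sum>s\<le>m. \<Sum>k\<in>S.
     q powi ((int r)\<^sup>2 - int r * int s + (int s)\<^sup>2 + x * int r + y * int s)
       * ipoch (int n - int r) * ipoch (int m - int s) * f k r s)"
    by (simp add: bailey_def sum_distrib_left)
  also have "\<dots> = (\<Sum>r\<le>n. \<Sum>k\<in>S. \<Sum>s\<le>m.
     q powi ((int r)\<^sup>2 - int r * int s + (int s)\<^sup>2 + x * int r + y * int s)
       * ipoch (int n - int r) * ipoch (int m - int s) * f k r s)"
    by (rule sum.cong[OF refl], rule sum.swap)
  also have "\<dots> = (\<Sum>k\<in>S. bailey x y (f k) n m)"
    unfolding bailey_def by (rule sum.swap)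
  finally show ?thesis .
qed

lemma bailey_ker00:
  assumes "c1 + c2 + c3 = 0"
  shows "bailey 0 0 (\<lambda>r s. ker (int r) (int s) c1 c2 c3) n m
    = q powi (- (c1 * c2 + c1 * c3 + c2 * c3)) * ker (int n) (int m) c1 c2 c3"
proof -
  have "ker A B c1 c2 c3 = 0" if "A < 0 \<or> B < 0" for A B
    using assms that by (intro ker_eq_0) linarith
  then show ?thesis
    using ker_sum_nat[of 0 0 c1 c2 c3 n m] assms by (simp add: bailey_def fweight_def)
qed

text \<open>The triple has sum -1, and the linear term of \<open>fweight (- 1)\<close> at A = r + 1
  leaves exactly the extra weight q^r.\<close>

lemma bailey_ker10:
  assumes "c1 + c2 + c3 = - 1"
  shows "bailey 1 0 (\<lambda>r s. ker (int r + 1) (int s) c1 c2 c3) n m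
    = q powi (- (c1 * c2 + c1 * c3 + c2 * c3)) * ker (int n + 1) (int m) c1 c2 c3"
proof -
  have "ker A B c1 c2 c3 = 0" if "A < 1 \<or> B < 0" for A B
    using assms that by (intro ker_eq_0) linarith
  moreover have "fweight (- 1) (int r + 1) (int s)
      = q powi ((int r)\<^sup>2 - int r * int s + (int s)\<^sup>2 + int r)" for r s
    by (simp add: fweight_def power2_eq_square algebra_simps)
  ultimately show ?thesis
    using ker_sum_nat[of 1 0 c1 c2 c3 n m] assms by (simp add: bailey_def)
qed

text \<open>The condition \<open>c1 \<noteq> c2\<close> excludes the triple (0, 0, 0), the only one
  of sum zero whose kernel does not vanish on the lines A = 0 and B = 0. The \<open>- 1\<close> in
  the exponent is the constant term of the quadratic form at (r + 1, s + 1).\<close>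

lemma bailey_ker11:
  assumes "c1 + c2 + c3 = 0" "c1 \<noteq> c2"
  shows "bailey 1 1 (\<lambda>r s. ker (int r + 1) (int s + 1) c1 c2 c3) n m
    = q powi (- (c1 * c2 + c1 * c3 + c2 * c3) - 1) * ker (int n + 1) (int m + 1) c1 c2 c3"
proof -
  have "ker A B c1 c2 c3 = 0" if "A < 1 \<or> B < 1" for A B
    using assms that by (intro ker_eq_0) linarith
  moreover have "fweight 0 (int r + 1) (int s + 1)
      = q * q powi ((int r)\<^sup>2 - int r * int s + (int s)\<^sup>2 + int r + int s)" for r s
  proof -
    have "(int r + 1)\<^sup>2 - (int r + 1) * (int s + 1) + (int s + 1)\<^sup>2
        = 1 + ((int r)\<^sup>2 - int r * int s + (int s)\<^sup>2 + int r + int s)"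
      by (simp add: power2_eq_square algebra_simps)
    then show ?thesis
      unfolding fweight_def by (simp add: powi_add del: add_diff_cancel_left')
  qed
  ultimately have "q * bailey 1 1 (\<lambda>r s. ker (int r + 1) (int s + 1) c1 c2 c3) n m
     = q powi (- (c1 * c2 + c1 * c3 + c2 * c3)) * ker (int n + 1) (int m + 1) c1 c2 c3"
    using ker_sum_nat[of 1 1 c1 c2 c3 n m] assms(1)
    by (simp add: bailey_def sum_distrib_left mult_ac)
  then show ?thesis
    by (simp only: powi_diff power_int_1_right) (simp add: nonzero_eq_divide_eq mult.commute)
qed

end

section \<open>Alternating sums of kernels\<close>

text \<open>On triples with sum zero, \<open>chi3 (x - y)\<close> is antisymmetric under permutations: it is the sign,
  up to a constant, of the permutation that the triple induces on the residues modulo 3.\<close>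

definition chi3 :: "int \<Rightarrow> int" where
  "chi3 d = (if d mod 3 = 1 then - 1 else if d mod 3 = 2 then 1 else 0)"

lemma chi3_minus: "chi3 (- d) = - chi3 d"
proof -
  have "(- d) mod 3 = 1 \<longleftrightarrow> d mod 3 = 2" "(- d) mod 3 = 2 \<longleftrightarrow> d mod 3 = 1" by presburger+
  then show ?thesis by (auto simp: chi3_def)
qed

lemma chi3_cong: "(3::int) dvd d - e \<Longrightarrow> chi3 d = chi3 e"
  unfolding chi3_def by (simp add: mod_eq_dvd_iff[symmetric])

text \<open>Half the squared length of the triple (x, y, - x - y), hence invariant under its
  permutations. By \<open>A2_norm_e2\<close> it is also the exponent of the eigenvalue of a Bailey
  step.\<close>

definition A2_norm :: "int \<Rightarrow> int \<Rightarrow> int" where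
  "A2_norm x y = x\<^sup>2 + x * y + y\<^sup>2"

lemma A2_norm_commute: "A2_norm x y = A2_norm y x"
  by (simp add: A2_norm_def algebra_simps)

lemma A2_norm_third: "x + y + z = 0 \<Longrightarrow> A2_norm x z = A2_norm x y"
proof -
  assume "x + y + z = 0"
  then have z: "z = - x - y" by simp
  show ?thesis unfolding z by (simp add: A2_norm_def power2_eq_square algebra_simps)
qed

lemma A2_norm_e2: "x + y + z = 0 \<Longrightarrow> - (x * y + x * z + y * z) = A2_norm x y"
proof -
  assume "x + y + z = 0"
  then have z: "z = - x - y" by simp
  show ?thesis unfolding z by (simp add: A2_norm_def power2_eq_square algebra_simps)
qed

text \<open>All three entries are bounded, so that truncation respects permutations and the
  antisymmetry arguments remain exact for finite sums.\<close>

definition tri_box :: "int \<Rightarrow> (int \<times> int \<times> int) set" where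
  "tri_box M = {(x, y, z). x + y + z = 0 \<and> \<bar>x\<bar> \<le> M \<and> \<bar>y\<bar> \<le> M \<and> \<bar>z\<bar> \<le> M}"

lemma finite_tri_box: "finite (tri_box M)"
proof (rule finite_subset)
  show "tri_box M \<subseteq> {-M..M} \<times> {-M..M} \<times> {-M..M}" by (auto simp: tri_box_def)
qed auto

definition char_sum :: "int \<Rightarrow> (int \<Rightarrow> int \<Rightarrow> int \<Rightarrow> 'a) \<Rightarrow> 'a::field_char_0" where
  "char_sum M f = (\<Sum>(x, y, z)\<in>tri_box M. of_int (chi3 (x - y)) * f x y z)"

lemma char_sum_cong:
  assumes "\<And>x y z. x + y + z = 0 \<Longrightarrow> chi3 (x - y) \<noteq> 0 \<Longrightarrow> f x y z = g x y z"
  shows "char_sum M f = char_sum M g"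
  unfolding char_sum_def
proof (intro sum.cong refl)
  fix p assume "p \<in> tri_box M"
  then obtain x y z where p: "p = (x, y, z)" "x + y + z = 0" by (auto simp: tri_box_def)
  then show "(case p of (x, y, z) \<Rightarrow> of_int (chi3 (x - y)) * f x y z)
      = (case p of (x, y, z) \<Rightarrow> of_int (chi3 (x - y)) * g x y z)"
    using assms[of x y z] by (cases "chi3 (x - y) = 0") auto
qed

lemma char_sum_cmult: "char_sum M (\<lambda>x y z. c * f x y z) = c * char_sum M f"
  by (simp add: char_sum_def sum_distrib_left case_prod_beta mult_ac)

lemma char_sum_diff: "char_sum M (\<lambda>x y z. f x y z - g x y z) = char_sum M f - char_sum M g"
  by (simp add: char_sum_def sum_subtractf case_prod_beta algebra_simps)

lemma char_sum_swap12: "char_sum M (\<lambda>x y z. f y x z) = - char_sum M f"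
proof -
  have "char_sum M (\<lambda>x y z. f y x z) = (\<Sum>(x, y, z)\<in>tri_box M. of_int (chi3 (y - x)) * f x y z)"
    unfolding char_sum_def
    by (rule sum.reindex_bij_witness[of _ "\<lambda>(x, y, z). (y, x, z)" "\<lambda>(x, y, z). (y, x, z)"])
      (auto simp: tri_box_def)
  also have "\<dots> = - char_sum M f"
    unfolding char_sum_def sum_negf[symmetric]
  proof (intro sum.cong refl)
    fix p :: "int \<times> int \<times> int"
    obtain x y z where p: "p = (x, y, z)" by (cases p)
    show "(case p of (x, y, z) \<Rightarrow> of_int (chi3 (y - x)) * f x y z)
      = - (case p of (x, y, z) \<Rightarrow> of_int (chi3 (x - y)) * f x y z)"
      using chi3_minus[of "x - y"] by (simp add: p)
  qed
  finally show ?thesis .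
qed

lemma char_sum_swap23: "char_sum M (\<lambda>x y z. f x z y) = - char_sum M f"
proof -
  have "char_sum M (\<lambda>x y z. f x z y) = (\<Sum>(x, y, z)\<in>tri_box M. of_int (chi3 (x - z)) * f x y z)"
    unfolding char_sum_def
    by (rule sum.reindex_bij_witness[of _ "\<lambda>(x, y, z). (x, z, y)" "\<lambda>(x, y, z). (x, z, y)"])
      (auto simp: tri_box_def)
  also have "\<dots> = - char_sum M f"
    unfolding char_sum_def sum_negf[symmetric]
  proof (intro sum.cong refl)
    fix p assume "p \<in> tri_box M"
    then obtain x y z where p: "p = (x, y, z)" and "x + y + z = 0" by (auto simp: tri_box_def)
    then have z: "z = - x - y" by simp
    have "chi3 (x - z) = chi3 (- (x - y))" using z by (intro chi3_cong) presburger
    then show "(case p of (x, y, z) \<Rightarrow> of_int (chi3 (x - z)) * f x y z)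
      = - (case p of (x, y, z) \<Rightarrow> of_int (chi3 (x - y)) * f x y z)"
      using p chi3_minus[of "x - y"] by simp
  qed
  finally show ?thesis .
qed

lemma char_sum_eq_0_swap23:
  assumes "\<And>x y z. x + y + z = 0 \<Longrightarrow> chi3 (x - y) \<noteq> 0 \<Longrightarrow> f x z y = f x y z"
  shows "char_sum M f = 0"
proof -
  have "char_sum M f = - char_sum M f"
    using char_sum_swap23[of M f] char_sum_cong[of "\<lambda>x y z. f x z y" f M] assms by auto
  then show ?thesis
    by (simp add: eq_neg_iff_add_eq_0)
qed

text \<open>Since \<open>chi3\<close> is antisymmetric, six times the sum is the sum of the
  antisymmetrized summand; it suffices that the latter vanishes on each triple.\<close>

lemma char_sum_eq_0_alt:
  assumes "\<And>x y z. x + y + z = 0 \<Longrightarrow> chi3 (x - y) \<noteq> 0 \<Longrightarrow>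
    f x y z + f y z x + f z x y - f y x z - f x z y - f z y x = 0"
  shows "char_sum M f = 0"
proof -
  have a: "char_sum M (\<lambda>x y z. f y x z) = - char_sum M f" "char_sum M (\<lambda>x y z. f x z y) = - char_sum M f"
    by (rule char_sum_swap12, rule char_sum_swap23)
  have b: "char_sum M (\<lambda>x y z. f y z x) = char_sum M f"
    using char_sum_swap12[of M "\<lambda>x y z. f x z y"] a by simp
  have c: "char_sum M (\<lambda>x y z. f z x y) = char_sum M f"
    using char_sum_swap23[of M "\<lambda>x y z. f y x z"] a by simp
  have d: "char_sum M (\<lambda>x y z. f z y x) = - char_sum M f"
    using char_sum_swap12[of M "\<lambda>x y z. f z x y"] c by simp
  have "(6::'a) * char_sum M f = char_sum M f - (- char_sum M f) - (- char_sum M f) - (- char_sum M f) - (- char_sum M f) - (- char_sum M f)"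
    by simp
  \<comment> \<open>Additions are written as double subtractions, which \<open>char_sum_diff\<close>
    splits.\<close>
  also have "\<dots> = char_sum M (\<lambda>x y z. f x y z - (0 - f y z x) - (0 - f z x y) - f y x z - f x z y - f z y x)"
    unfolding char_sum_diff a b c d by (simp add: char_sum_def)
  also have "\<dots> = char_sum M (\<lambda>x y z. 0)"
    by (rule char_sum_cong) (use assms in \<open>simp add: algebra_simps\<close>)
  also have "\<dots> = 0" by (simp add: char_sum_def)
  finally show ?thesis by simp
qed

context generic_q begin

lemma bailey_char_sum:
  "bailey x y (\<lambda>r s. char_sum M (\<lambda>v u w. f v u w r s)) n m = char_sum M (\<lambda>v u w. bailey x y (f v u w) n m)"
  unfolding char_sum_def bailey_sum
  by (intro sum.cong refl) (auto simp: bailey_cmult)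

text \<open>Eigenvalue of \<open>L\<close> Bailey steps times the weight of the seed \<open>g\<close>; the division by 3 is exact
  wherever \<open>chi3\<close> does not vanish.\<close>

definition nweight :: "int \<Rightarrow> nat \<Rightarrow> int \<Rightarrow> int \<Rightarrow> 'a" where
  "nweight \<tau> L x y = q powi (int L * (A2_norm x y - 1) + (3 + \<tau>) * ((A2_norm x y - 1) div 3))"

lemma nweight_Suc: "nweight \<tau> (Suc L) x y = q powi (A2_norm x y - 1) * nweight \<tau> L x y"
  by (simp add: nweight_def algebra_simps flip: powi_add)

lemma nweight_commute: "nweight \<tau> L x y = nweight \<tau> L y x"
  by (simp add: nweight_def A2_norm_commute)

lemma nweight_third: "x + y + z = 0 \<Longrightarrow> nweight \<tau> L x z = nweight \<tau> L x y"
  by (simp add: nweight_def A2_norm_third)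

text \<open>The digits in \<open>exp11\<close>, \<open>exp10\<close>, \<open>exp00\<close> are the
  shift of (n, m) in the kernel. Removing a shift changes v to v - 1 or u to u + 1. The parameters
  \<open>b\<close> and \<open>a\<close> count the steps taken since then, that is, the steps without
  the weight q^s or q^r.\<close>

definition exp11 :: "int \<Rightarrow> int \<Rightarrow> nat \<Rightarrow> nat \<Rightarrow> nat \<Rightarrow> 'a" where
  "exp11 \<tau> M L n m = char_sum M (\<lambda>v u w. nweight \<tau> L v u * q powi ((1 - v) + (1 + u))
     * ker (int n + 1) (int m + 1) v u w)"

definition exp10 :: "int \<Rightarrow> int \<Rightarrow> nat \<Rightarrow> nat \<Rightarrow> nat \<Rightarrow> nat \<Rightarrow> 'a" where
  "exp10 \<tau> M L b n m = char_sum M (\<lambda>v u w. nweight \<tau> L v u * q powi (int (b + 1) * (1 - v) + (1 + u))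
     * ker (int n + 1) (int m) (v - 1) u w)"

definition exp00 :: "int \<Rightarrow> int \<Rightarrow> nat \<Rightarrow> nat \<Rightarrow> nat \<Rightarrow> nat \<Rightarrow> nat \<Rightarrow> 'a" where
  "exp00 \<tau> M L a b n m = char_sum M (\<lambda>v u w. nweight \<tau> L v u
     * q powi (int (b + 1) * (1 - v) + int (a + 1) * (1 + u)) * ker (int n) (int m) (v - 1) (u + 1) w)"

lemma bailey_exp11: "bailey 1 1 (exp11 \<tau> M L) n m = exp11 \<tau> M (Suc L) n m"
proof -
  have "bailey 1 1 (exp11 \<tau> M L) n m = char_sum M (\<lambda>v u w. nweight \<tau> L v u * q powi ((1 - v) + (1 + u))
     * bailey 1 1 (\<lambda>n m. ker (int n + 1) (int m + 1) v u w) n m)"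
    by (simp add: exp11_def[abs_def] bailey_char_sum bailey_cmult)
  also have "\<dots> = exp11 \<tau> M (Suc L) n m"
    unfolding exp11_def
  proof (rule char_sum_cong)
    fix v u w :: int assume h: "v + u + w = 0" "chi3 (v - u) \<noteq> 0"
    then have "v \<noteq> u" by (auto simp: chi3_def)
    then have "bailey 1 1 (\<lambda>n m. ker (int n + 1) (int m + 1) v u w) n m
        = q powi (A2_norm v u - 1) * ker (int n + 1) (int m + 1) v u w"
      using bailey_ker11[OF h(1)] A2_norm_e2[OF h(1)] by simp
    then show "nweight \<tau> L v u * q powi ((1 - v) + (1 + u)) * bailey 1 1 (\<lambda>n m. ker (int n + 1) (int m + 1) v u w) n m
      = nweight \<tau> (Suc L) v u * q powi ((1 - v) + (1 + u)) * ker (int n + 1) (int m + 1) v u w"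
      by (simp only: nweight_Suc mult_ac)
  qed
  finally show ?thesis .
qed

lemma bailey_ker10':
  assumes "v + u + w = 0"
  shows "bailey 1 0 (\<lambda>n m. ker (int n + 1) (int m) (v - 1) u w) n m
    = q powi (A2_norm v u - v) * ker (int n + 1) (int m) (v - 1) u w"
proof -
  have "- ((v - 1) * u + (v - 1) * w + u * w) = A2_norm v u - v"
    using A2_norm_e2[OF assms] assms by (simp add: algebra_simps)
  then show ?thesis
    using bailey_ker10[of "v - 1" u w n m] assms by simp
qed

text \<open>The eigenvalue is q^(N - v) with N = \<open>A2_norm v u\<close>. The part q^(N - 1) goes
  into \<open>nweight\<close>, and the surplus q^(1 - v) raises \<open>b\<close> by one.\<close>

lemma bailey_exp10: "bailey 1 0 (exp10 \<tau> M L b) n m = exp10 \<tau> M (Suc L) (Suc b) n m"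
proof -
  have "bailey 1 0 (exp10 \<tau> M L b) n m = char_sum M (\<lambda>v u w. nweight \<tau> L v u * q powi (int (b + 1) * (1 - v) + (1 + u))
     * bailey 1 0 (\<lambda>n m. ker (int n + 1) (int m) (v - 1) u w) n m)"
    by (simp add: exp10_def[abs_def] bailey_char_sum bailey_cmult)
  also have "\<dots> = exp10 \<tau> M (Suc L) (Suc b) n m"
    unfolding exp10_def
  proof (rule char_sum_cong)
    fix v u w :: int assume h: "v + u + w = 0"
    have "q powi (int (b + 1) * (1 - v) + (1 + u)) * q powi (A2_norm v u - v)
      = q powi (A2_norm v u - 1) * q powi (int (Suc b + 1) * (1 - v) + (1 + u))"
      by (simp flip: powi_add add: algebra_simps)
    then show "nweight \<tau> L v u * q powi (int (b + 1) * (1 - v) + (1 + u))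
        * bailey 1 0 (\<lambda>n m. ker (int n + 1) (int m) (v - 1) u w) n m
      = nweight \<tau> (Suc L) v u * q powi (int (Suc b + 1) * (1 - v) + (1 + u)) * ker (int n + 1) (int m) (v - 1) u w"
      unfolding nweight_Suc bailey_ker10'[OF h] by algebra
  qed
  finally show ?thesis .
qed

text \<open>Here the surplus of the eigenvalue over q^(N - 1) is q^((1 - v) + (1 + u)), which raises
  both parameters.\<close>

lemma bailey_exp00: "bailey 0 0 (exp00 \<tau> M L a b) n m = exp00 \<tau> M (Suc L) (Suc a) (Suc b) n m"
proof -
  have "bailey 0 0 (exp00 \<tau> M L a b) n m = char_sum M (\<lambda>v u w. nweight \<tau> L v u
     * q powi (int (b + 1) * (1 - v) + int (a + 1) * (1 + u))
     * bailey 0 0 (\<lambda>n m. ker (int n) (int m) (v - 1) (u + 1) w) n m)"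
    by (simp add: exp00_def[abs_def] bailey_char_sum bailey_cmult)
  also have "\<dots> = exp00 \<tau> M (Suc L) (Suc a) (Suc b) n m"
    unfolding exp00_def
  proof (rule char_sum_cong)
    fix v u w :: int assume h: "v + u + w = 0"
    have e: "- ((v - 1) * (u + 1) + (v - 1) * w + (u + 1) * w) = A2_norm v u - v + u + 1"
      using A2_norm_e2[OF h] h by (simp add: algebra_simps)
    have k: "bailey 0 0 (\<lambda>n m. ker (int n) (int m) (v - 1) (u + 1) w) n m
      = q powi (A2_norm v u - v + u + 1) * ker (int n) (int m) (v - 1) (u + 1) w"
      using bailey_ker00[of "v - 1" "u + 1" w n m] h e by simp
    have "q powi (int (b + 1) * (1 - v) + int (a + 1) * (1 + u)) * q powi (A2_norm v u - v + u + 1)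
      = q powi (A2_norm v u - 1) * q powi (int (Suc b + 1) * (1 - v) + int (Suc a + 1) * (1 + u))"
      by (simp flip: powi_add add: algebra_simps)
    then show "nweight \<tau> L v u * q powi (int (b + 1) * (1 - v) + int (a + 1) * (1 + u))
        * bailey 0 0 (\<lambda>n m. ker (int n) (int m) (v - 1) (u + 1) w) n m
      = nweight \<tau> (Suc L) v u * q powi (int (Suc b + 1) * (1 - v) + int (Suc a + 1) * (1 + u))
        * ker (int n) (int m) (v - 1) (u + 1) w"
      unfolding nweight_Suc k by algebra
  qed
  finally show ?thesis .
qed

text \<open>For fixed \<open>v\<close> the difference of the two summands is symmetric in the other two entries.\<close>

lemma exp10_eq_exp00:
  "char_sum M (\<lambda>v u w. nweight \<tau> L v u * q powi (int (b + 1) * (1 - v) + (1 + u))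
     * ((1 - q powi (int r + v)) * ker (int r + 1) (int s) (v - 1) u w)) = exp00 \<tau> M L 0 b r s"
proof -
  let ?h = "\<lambda>v u w. nweight \<tau> L v u * q powi (int (b + 1) * (1 - v) + (1 + u))
     * ((1 - q powi (int r + v)) * ker (int r + 1) (int s) (v - 1) u w)
     - nweight \<tau> L v u * q powi (int (b + 1) * (1 - v) + int (0 + 1) * (1 + u)) * ker (int r) (int s) (v - 1) (u + 1) w"
  have "char_sum M ?h = 0"
  proof (rule char_sum_eq_0_swap23)
    fix v u w :: int assume h: "v + u + w = 0"
    define P where "P u w = poch (r + s) * (ipoch (int r + v) * ipoch (int r + 1 + u) * ipoch (int r + 1 + w)
      * (ipoch (int s - v + 1) * ipoch (int s - u) * ipoch (int s - w)))" for u w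
    have P_sym: "P w u = P u w" by (simp add: P_def mult_ac)
    define \<alpha> \<beta> where "\<alpha> = q powi (int r + 1)" and "\<beta> = q powi (int s)"
    have k1: "ker (int r + 1) (int s) (v - 1) u w = (1 - \<alpha> * \<beta>) * P u w" for u w
    proof -
      have "nat (int r + 1 + int s) = Suc (r + s)" by simp
      moreover have "\<alpha> * \<beta> = q ^ Suc (r + s)"
        unfolding \<alpha>_def \<beta>_def powi_add[symmetric] power_int_of_nat[symmetric]
        by (rule arg_cong[of _ _ "power_int q"]) simp
      ultimately show ?thesis
        by (simp add: ker_def P_def poch_Suc algebra_simps del: power_Suc)
    qed
    have k2: "ker (int r) (int s) (v - 1) (u + 1) w
        = (1 - q powi (int r + v)) * (1 - \<alpha> * q powi w) * (1 - \<beta> / q powi u) * P u w" for u w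
    proof -
      have "ipoch (int r + (v - 1)) = (1 - q powi (int r + v)) * ipoch (int r + v)"
        using ipoch_minus_1[of "int r + v"] by (simp add: algebra_simps)
      moreover have "ipoch (int r + w) = (1 - \<alpha> * q powi w) * ipoch (int r + 1 + w)"
        using ipoch_minus_1[of "int r + 1 + w"] powi_add[of "int r + 1" w] by (simp add: \<alpha>_def)
      moreover have "ipoch (int s - (u + 1)) = (1 - \<beta> / q powi u) * ipoch (int s - u)"
        using ipoch_minus_1[of "int s - u"] powi_diff[of "int s" u] by (simp add: \<beta>_def algebra_simps)
      moreover have "ipoch (int s - (v - 1)) = ipoch (int s - v + 1)" "ipoch (int r + (u + 1)) = ipoch (int r + 1 + u)"
        by (simp_all add: algebra_simps)
      moreover have "nat (int r + int s) = r + s" by simp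
      ultimately show ?thesis
        unfolding ker_def P_def by (simp only: mult_ac)
    qed
    have nweight: "nweight \<tau> L v w = nweight \<tau> L v u" using nweight_third[OF h] .
    \<comment> \<open>Expanded, both sides are \<alpha> q^(u + w) + \<beta> - \<alpha> \<beta> (q^u
      + q^w).\<close>
    have key: "q powi u * ((1 - \<alpha> * \<beta>) - (1 - \<alpha> * q powi w) * (1 - \<beta> / q powi u))
      = q powi w * ((1 - \<alpha> * \<beta>) - (1 - \<alpha> * q powi u) * (1 - \<beta> / q powi w))"
      by (simp add: field_simps)
    have e: "q powi (int (b + 1) * (1 - v) + (1 + u)) = q powi (int (b + 1) * (1 - v) + 1) * q powi u"
       "q powi (int (b + 1) * (1 - v) + int (0 + 1) * (1 + u)) = q powi (int (b + 1) * (1 - v) + 1) * q powi u" for u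
      by (simp_all flip: powi_add add: algebra_simps)
    have "?h v u w = nweight \<tau> L v u * q powi (int (b + 1) * (1 - v) + 1) * (1 - q powi (int r + v)) * P u w
        * (q powi u * ((1 - \<alpha> * \<beta>) - (1 - \<alpha> * q powi w) * (1 - \<beta> / q powi u)))"
      unfolding k1 k2 e by algebra
    moreover have "?h v w u = nweight \<tau> L v u * q powi (int (b + 1) * (1 - v) + 1) * (1 - q powi (int r + v)) * P u w
        * (q powi w * ((1 - \<alpha> * \<beta>) - (1 - \<alpha> * q powi u) * (1 - \<beta> / q powi w)))"
      unfolding k1 k2 e nweight P_sym by algebra
    ultimately show "?h v w u = ?h v u w" using key by simp
  qed
  then show ?thesis
    unfolding char_sum_diff exp00_def by simp
qed

text \<open>The subtracted expansion is the unweighted step applied to the kernels times q^(r + v).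
  The difference therefore carries the factor 1 - q^(r + v) under the step, which is what
  \<open>exp10_eq_exp00\<close> converts.\<close>

lemma bailey_exp10_minus:
  "bailey 0 0 (exp10 \<tau> M L b) n m - q * exp10 \<tau> M (Suc L) b n m = exp00 \<tau> M (Suc L) 1 (Suc b) n m"
proof -
  let ?c = "\<lambda>v u. nweight \<tau> L v u * q powi (int (b + 1) * (1 - v) + (1 + u))"
  let ?K = "\<lambda>v u w (n::nat) (m::nat). ker (int n + 1) (int m) (v - 1) u w"
  have 1: "bailey 0 0 (exp10 \<tau> M L b) n m = char_sum M (\<lambda>v u w. ?c v u * bailey 0 0 (?K v u w) n m)"
    by (simp add: exp10_def[abs_def] bailey_char_sum bailey_cmult)
  have "q * exp10 \<tau> M (Suc L) b n m = char_sum M (\<lambda>v u w. q * (nweight \<tau> (Suc L) v u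
      * q powi (int (b + 1) * (1 - v) + (1 + u)) * ?K v u w n m))"
    unfolding exp10_def char_sum_cmult ..
  also have "\<dots> = char_sum M (\<lambda>v u w. ?c v u * bailey 0 0 (\<lambda>r s. q powi (int r + v) * ?K v u w r s) n m)"
  proof (rule char_sum_cong)
    fix v u w :: int assume h: "v + u + w = 0"
    have "bailey 0 0 (\<lambda>r s. q powi (int r + v) * ?K v u w r s) n m = q powi v * bailey 1 0 (?K v u w) n m"
      unfolding bailey_def sum_distrib_left by (intro sum.cong refl) (simp add: powi_add)
    also have "\<dots> = q powi v * q powi (A2_norm v u - v) * ?K v u w n m"
      unfolding bailey_ker10'[OF h] by simp
    \<comment> \<open>The lone q here is the one in the exponent \<lambda>_a + \<mu>_b + 1 of the
      numerator.\<close>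
    also have "q powi v * q powi (A2_norm v u - v) = q * q powi (A2_norm v u - 1)"
      using powi_add[of v "A2_norm v u - v"] powi_add[of 1 "A2_norm v u - 1"] by simp
    finally show "q * (nweight \<tau> (Suc L) v u * q powi (int (b + 1) * (1 - v) + (1 + u)) * ?K v u w n m)
       = ?c v u * bailey 0 0 (\<lambda>r s. q powi (int r + v) * ?K v u w r s) n m"
      unfolding nweight_Suc by (simp only: mult_ac)
  qed
  finally have 2: "q * exp10 \<tau> M (Suc L) b n m
    = char_sum M (\<lambda>v u w. ?c v u * bailey 0 0 (\<lambda>r s. q powi (int r + v) * ?K v u w r s) n m)" .
  have "bailey 0 0 (exp10 \<tau> M L b) n m - q * exp10 \<tau> M (Suc L) b n m
    = char_sum M (\<lambda>v u w. bailey 0 0 (\<lambda>r s. ?c v u * ((1 - q powi (int r + v)) * ?K v u w r s)) n m)"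
    unfolding 1 2 char_sum_diff[symmetric] bailey_cmult right_diff_distrib[symmetric] bailey_diff[symmetric]
    by (simp add: left_diff_distrib)
  also have "\<dots> = bailey 0 0 (exp00 \<tau> M L 0 b) n m"
    unfolding bailey_char_sum[symmetric] exp10_eq_exp00 ..
  finally show ?thesis by (simp add: bailey_exp00)
qed

text \<open>Both kernels are polynomial multiples of one product \<open>P\<close> symmetric in the
  triple. Antisymmetrizing over all six permutations leaves a polynomial identity in x, y, z = q^v,
  q^u, q^w. No single transposition suffices, as the shift of m affects all three entries.\<close>

lemma exp11_eq_exp10: "exp11 \<tau> M L n m = exp10 \<tau> M L 0 n m"
proof -
  let ?h = "\<lambda>v u w. nweight \<tau> L v u * q powi ((1 - v) + (1 + u)) * ker (int n + 1) (int m + 1) v u w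
     - nweight \<tau> L v u * q powi (int (0 + 1) * (1 - v) + (1 + u)) * ker (int n + 1) (int m) (v - 1) u w"
  have "char_sum M ?h = 0"
  proof (rule char_sum_eq_0_alt)
    fix v u w :: int assume h: "v + u + w = 0"
    define P where "P = (\<lambda>v u w. poch (n + m + 1) * (ipoch (int n + 1 + v) * ipoch (int n + 1 + u) * ipoch (int n + 1 + w)
      * (ipoch (int m + 1 - v) * ipoch (int m + 1 - u) * ipoch (int m + 1 - w))))"
    define a b where "a = q powi (int n + 1)" and "b = q powi (int m + 1)"
    have k1: "ker (int n + 1) (int m + 1) v u w = (1 - a * b) * P v u w" for v u w
    proof -
      have "nat (int n + 1 + (int m + 1)) = Suc (n + m + 1)" by simp
      moreover have "a * b = q ^ Suc (n + m + 1)"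
        using power_int_of_nat[of q "Suc (n + m + 1)"]
        by (simp add: a_def b_def algebra_simps flip: powi_add)
      ultimately show ?thesis
        unfolding ker_def P_def by (simp only: poch_Suc mult_ac)
    qed
    have k2: "ker (int n + 1) (int m) (v - 1) u w
        = (1 - a * q powi v) * (1 - b / q powi u) * (1 - b / q powi w) * P v u w" for v u w
    proof -
      have i1: "ipoch (int n + 1 + (v - 1)) = (1 - a * q powi v) * ipoch (int n + 1 + v)"
        using ipoch_minus_1[of "int n + 1 + v"] powi_add[of "int n + 1" v] by (simp add: a_def algebra_simps)
      have i2: "ipoch (int m - u) = (1 - b / q powi u) * ipoch (int m + 1 - u)" for u
        using ipoch_minus_1[of "int m + 1 - u"] powi_diff[of "int m + 1" u] by (simp add: b_def algebra_simps)
      have i3: "ipoch (int m - (v - 1)) = ipoch (int m + 1 - v)" by (simp add: algebra_simps)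
      have i4: "nat (int n + 1 + int m) = n + m + 1" by simp
      show ?thesis
        unfolding ker_def P_def i1 i3 i4 i2[of u] i2[of w] by (simp only: mult_ac)
    qed
    define x y z where "x = q powi v" and "y = q powi u" and "z = q powi w"
    have nz: "x \<noteq> 0" "y \<noteq> 0" "z \<noteq> 0" by (simp_all add: x_def y_def z_def)
    have xyz: "x * y * z = 1"
      using h by (simp add: x_def y_def z_def flip: powi_add)
    have P_sym: "P u w v = P v u w" "P w v u = P v u w" "P u v w = P v u w" "P v w u = P v u w" "P w u v = P v u w"
      by (simp_all add: P_def mult_ac)
    have nweight_sym: "nweight \<tau> L u w = nweight \<tau> L v u" "nweight \<tau> L w v = nweight \<tau> L v u" "nweight \<tau> L u v = nweight \<tau> L v u"
      "nweight \<tau> L v w = nweight \<tau> L v u" "nweight \<tau> L w u = nweight \<tau> L v u"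
      using nweight_third[of v u w \<tau> L] nweight_third[of u v w \<tau> L] h nweight_commute[of \<tau> L] by auto
    have e: "q powi ((1 - v) + (1 + u)) = q\<^sup>2 * (q powi u / q powi v)"
      "q powi (int (0 + 1) * (1 - v) + (1 + u)) = q\<^sup>2 * (q powi u / q powi v)" for u v
      by (simp_all add: powi_add powi_diff power2_eq_square)
    \<comment> \<open>The relation x y z = 1, from the zero sum of the triple, clears all
      denominators.\<close>
    have *: "y / x * (1 - a * b) - y / x * ((1 - a * x) * (1 - b / y) * (1 - b / z))
       = y * y * z * (1 - a * b) - (1 - a * x) * y * (y - b) * (z - b)"
      if "x * y * z = 1" for x y z
    proof -
      have n: "x \<noteq> 0" "y \<noteq> 0" "z \<noteq> 0" using that by auto
      then have 1: "y / x = y * y * z" using that by (simp add: field_simps)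
      have "y * y * z * ((1 - a * x) * (1 - b / y) * (1 - b / z)) = (1 - a * x) * y * (y - b) * (z - b)"
        using n by (simp add: field_simps)
      then show ?thesis unfolding 1 by simp
    qed
    have h': "?h v u w = q\<^sup>2 * nweight \<tau> L v u * P v u w
        * (q powi u * q powi u * q powi w * (1 - a * b) - (1 - a * q powi v) * q powi u * (q powi u - b) * (q powi w - b))"
      if "q powi v * q powi u * q powi w = 1" for v u w
      unfolding k1 k2 e *[OF that, symmetric] by algebra
    have p: "y * z * x = 1" "z * x * y = 1" "y * x * z = 1" "x * z * y = 1" "z * y * x = 1"
      using xyz by (simp_all add: mult_ac)
    define c where "c = q\<^sup>2 * nweight \<tau> L v u * P v u w"
    have H: "?h v u w = c * (y * y * z * (1 - a * b) - (1 - a * x) * y * (y - b) * (z - b))"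
      "?h u w v = c * (z * z * x * (1 - a * b) - (1 - a * y) * z * (z - b) * (x - b))"
      "?h w v u = c * (x * x * y * (1 - a * b) - (1 - a * z) * x * (x - b) * (y - b))"
      "?h u v w = c * (x * x * z * (1 - a * b) - (1 - a * y) * x * (x - b) * (z - b))"
      "?h v w u = c * (z * z * y * (1 - a * b) - (1 - a * x) * z * (z - b) * (y - b))"
      "?h w u v = c * (y * y * x * (1 - a * b) - (1 - a * z) * y * (y - b) * (x - b))"
      using h'[of v u w] h'[of u w v] h'[of w v u] h'[of u v w] h'[of v w u] h'[of w u v] p xyz
      unfolding P_sym nweight_sym x_def[symmetric] y_def[symmetric] z_def[symmetric] c_def
      by (simp_all only: simp_thms)
    show "?h v u w + ?h u w v + ?h w v u - ?h u v w - ?h v w u - ?h w u v = 0"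
      unfolding H by algebra
  qed
  then show ?thesis
    unfolding char_sum_diff exp11_def exp10_def by simp
qed


section \<open>Expansion of the seed\<close>

text \<open>The elementary symmetric polynomial of degree \<open>s\<close> in 1, q, ..., q^(R -
  1).\<close>

primrec esym :: "nat \<Rightarrow> int \<Rightarrow> 'a" where
  "esym 0 s = (if s = 0 then 1 else 0)"
| "esym (Suc R) s = esym R s + q ^ R * esym R (s - 1)"

text \<open>The finite q-binomial theorem, coefficient by coefficient; degrees outside 0..R are
  covered by the zeros of \<open>ipoch\<close>.\<close>

lemma esym_eq: "esym R s = q powi (s * (s - 1) div 2) * poch R * ipoch s * ipoch (int R - s)"
proof (induction R arbitrary: s)
  case 0
  show ?case by (cases "s = 0"; cases "s < 0") (auto simp: ipoch_neg)
next
  case (Suc R)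
  define c where "c = q powi ((s - 1) * (s - 1 - 1) div 2) * poch R * ipoch s * ipoch (int R + 1 - s)"
  have e: "q powi (s * (s - 1) div 2) = q powi ((s - 1) * (s - 1 - 1) div 2) * q powi (s - 1)"
    by (subst choose2_int) (simp add: powi_add)
  have i1: "ipoch (int R - s) = (1 - q powi (int R + 1 - s)) * ipoch (int R + 1 - s)"
    using ipoch_minus_1[of "int R + 1 - s"] by (simp add: algebra_simps)
  have i2: "int R - (s - 1) = int R + 1 - s" "int (Suc R) - s = int R + 1 - s" by auto
  have p: "q powi (s - 1) * q powi (int R + 1 - s) = q ^ R"
    using powi_add[of "s - 1" "int R + 1 - s"] by simp
  have p': "q powi (s - 1) * q ^ Suc R = q ^ R * q powi s"
    using powi_add[of 1 "s - 1"] by simp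
  have "esym (Suc R) s = c * (q powi (s - 1) - q powi (s - 1) * q powi (int R + 1 - s) + q ^ R * (1 - q powi s))"
    unfolding esym.simps Suc.IH e i1 i2 ipoch_minus_1[of s] c_def by algebra
  also have "\<dots> = c * (q powi (s - 1) - q powi (s - 1) * q ^ Suc R)"
    unfolding p p' by (simp only: algebra_simps) simp
  also have "\<dots> = q powi (s * (s - 1) div 2) * poch (Suc R) * ipoch s * ipoch (int (Suc R) - s)"
    unfolding e i2 poch_Suc c_def by algebra
  finally show ?case .
qed

text \<open>The argument of \<open>chi3\<close> is \<open>y - x\<close> because the triples are
  negated when the coefficient is written as a \<open>char_sum\<close>. The value at (1, 0, -1) is
  1.\<close>

definition theta_coeff :: "int \<Rightarrow> int \<Rightarrow> int \<Rightarrow> int \<Rightarrow> 'a" where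
  "theta_coeff \<tau> x y z = (if x + y + z = 0 then of_int (chi3 (y - x)) * q powi (\<tau> * ((A2_norm x y - 1) div 3)) else 0)"

lemma theta_coeff_swap: "theta_coeff \<tau> y x z = - theta_coeff \<tau> x y z" "theta_coeff \<tau> x z y = - theta_coeff \<tau> x y z"
proof -
  show "theta_coeff \<tau> y x z = - theta_coeff \<tau> x y z"
    using chi3_minus[of "x - y"] by (auto simp: theta_coeff_def A2_norm_commute add_ac)
  show "theta_coeff \<tau> x z y = - theta_coeff \<tau> x y z"
  proof (cases "x + y + z = 0")
    case True
    then have z: "z = - x - y" by simp
    have "chi3 (z - x) = chi3 (- (y - x))" using z by (intro chi3_cong) presburger
    then show ?thesis
      using True A2_norm_third[OF True] chi3_minus[of "y - x"] by (simp add: theta_coeff_def add_ac)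
  qed (simp add: theta_coeff_def add_ac)
qed

text \<open>The vector (2, -1, -1) preserves differences modulo 3 and changes the norm by the
  multiple 3 (x + 1) of 3, so the rounding in \<open>div\<close> is not disturbed.\<close>

lemma theta_coeff_shift: "theta_coeff \<tau> (x + 2) (y - 1) (z - 1) = q powi (\<tau> * (x + 1)) * theta_coeff \<tau> x y z"
proof -
  have "chi3 (y - 1 - (x + 2)) = chi3 (y - x)" by (rule chi3_cong) presburger
  moreover have "A2_norm (x + 2) (y - 1) - 1 = (A2_norm x y - 1) + (x + 1) * 3"
    by (simp add: A2_norm_def power2_eq_square algebra_simps)
  moreover have "((A2_norm x y - 1) + (x + 1) * 3) div 3 = (x + 1) + (A2_norm x y - 1) div 3" by simp
  moreover have "x + 2 + (y - 1) + (z - 1) = x + y + z" by simp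
  ultimately show ?thesis
    unfolding theta_coeff_def by (simp only: distrib_left powi_add) simp
qed

text \<open>\<open>walk \<tau> R x y z\<close> is the coefficient of \<open>X^x Y^y Z^z\<close> in the product of the A2 theta function of nome
  \<open>q^\<tau>\<close> with all factors \<open>(1 + X q^j) (1 + Y q^j) (1 + Z q^j)\<close>, \<open>j < R\<close>. The shift lemmas below express
  its quasi-periodicity in \<open>X\<close>.\<close>

primrec walk :: "int \<Rightarrow> nat \<Rightarrow> int \<Rightarrow> int \<Rightarrow> int \<Rightarrow> 'a" where
  "walk \<tau> 0 x y z = theta_coeff \<tau> x y z"
| "walk \<tau> (Suc R) x y z = walk \<tau> R x y z
     + q ^ R * (walk \<tau> R (x - 1) y z + walk \<tau> R x (y - 1) z + walk \<tau> R x y (z - 1))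
     + (q ^ R)\<^sup>2 * (walk \<tau> R (x - 1) (y - 1) z + walk \<tau> R (x - 1) y (z - 1) + walk \<tau> R x (y - 1) (z - 1))
     + (q ^ R) ^ 3 * walk \<tau> R (x - 1) (y - 1) (z - 1)"

lemma walk_swap12: "walk \<tau> R y x z = - walk \<tau> R x y z"
proof (induction R arbitrary: x y z)
  case 0
  show ?case unfolding walk.simps by (rule theta_coeff_swap(1))
next
  case (Suc R)
  show ?case
    unfolding walk.simps Suc.IH[of y x] Suc.IH[of "y - 1" x] Suc.IH[of y "x - 1"] Suc.IH[of "y - 1" "x - 1"]
    by algebra
qed

lemma walk_swap23: "walk \<tau> R x z y = - walk \<tau> R x y z"
proof (induction R arbitrary: x y z)
  case 0
  show ?case unfolding walk.simps by (rule theta_coeff_swap(2))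
next
  case (Suc R)
  show ?case
    unfolding walk.simps Suc.IH[of _ z y] Suc.IH[of _ "z - 1" y] Suc.IH[of _ z "y - 1"] Suc.IH[of _ "z - 1" "y - 1"]
    by algebra
qed

lemma walk_cycle: "walk \<tau> R z x y = walk \<tau> R x y z"
proof -
  have "walk \<tau> R z x y = - walk \<tau> R x z y" by (rule walk_swap12)
  also have "walk \<tau> R x z y = - walk \<tau> R x y z" by (rule walk_swap23)
  finally show ?thesis by simp
qed

lemma walk_eq_0: "walk \<tau> R x x z = 0" "walk \<tau> R x z z = 0" "walk \<tau> R x z x = 0"
proof -
  show a: "walk \<tau> R x x z = 0" for x z using walk_swap12[of \<tau> R x x z] by (simp add: eq_neg_iff_add_eq_0)
  show "walk \<tau> R x z z = 0" using walk_swap23[of \<tau> R x z z] by (simp add: eq_neg_iff_add_eq_0)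
  show "walk \<tau> R x z x = 0" using walk_swap23[of \<tau> R x x z] a by simp
qed

text \<open>Let W(X) be the generating function described above. Under X -> q X the finite product
  gains (1 + q^R X)/(1 + X) and the theta function its multiplier, so q (1 + X) W(q X) = X^(-2) Y Z
  (1 + q^R X) W(X); this is its coefficient form.\<close>

lemma walk_shift_1:
  "q powi x * (q * walk 1 R x y z + walk 1 R (x - 1) y z)
    = walk 1 R (x + 2) (y - 1) (z - 1) + q ^ R * walk 1 R (x + 1) (y - 1) (z - 1)"
proof (induction R arbitrary: x y z)
  case 0
  have "theta_coeff 1 (x + 1) (y - 1) (z - 1) = q powi x * theta_coeff 1 (x - 1) y z"
    using theta_coeff_shift[of 1 "x - 1" y z] by (simp add: add.commute)
  then show ?case
    by (simp add: theta_coeff_shift powi_add algebra_simps)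
next
  case (Suc R)
  define p X where "p = q ^ R" and "X = q powi x"
  have a: "X * (q * walk 1 R x y z + walk 1 R (x - 1) y z)
    = walk 1 R (x + 2) (y - 1) (z - 1) + p * walk 1 R (x + 1) (y - 1) (z - 1)" for y z
    using Suc.IH[of x y z] by (simp add: p_def X_def)
  have b: "X * (q * walk 1 R (x - 1) y z + walk 1 R (x - 2) y z)
    = q * (walk 1 R (x + 1) (y - 1) (z - 1) + p * walk 1 R x (y - 1) (z - 1))" for y z
  proof -
    have X: "X = q * q powi (x - 1)" using powi_add[of 1 "x - 1"] by (simp add: X_def)
    have "q powi (x - 1) * (q * walk 1 R (x - 1) y z + walk 1 R (x - 2) y z)
      = walk 1 R (x + 1) (y - 1) (z - 1) + p * walk 1 R x (y - 1) (z - 1)"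
      using Suc.IH[of "x - 1" y z] by (simp add: p_def add.commute)
    then show ?thesis unfolding X by (simp only: mult.assoc)
  qed
  \<comment> \<open>The terms are grouped by which of y and z are lowered; within each group the
    factor 1 + q^R X pairs an instance of \<open>a\<close> with one of \<open>b\<close>.\<close>
  have "X * (q * walk 1 (Suc R) x y z + walk 1 (Suc R) (x - 1) y z)
    = X * (q * walk 1 R x y z + walk 1 R (x - 1) y z) + p * (X * (q * walk 1 R (x - 1) y z + walk 1 R (x - 2) y z))
    + p * (X * (q * walk 1 R x (y - 1) z + walk 1 R (x - 1) (y - 1) z) + p * (X * (q * walk 1 R (x - 1) (y - 1) z + walk 1 R (x - 2) (y - 1) z)))
    + p * (X * (q * walk 1 R x y (z - 1) + walk 1 R (x - 1) y (z - 1)) + p * (X * (q * walk 1 R (x - 1) y (z - 1) + walk 1 R (x - 2) y (z - 1))))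
    + p * p * (X * (q * walk 1 R x (y - 1) (z - 1) + walk 1 R (x - 1) (y - 1) (z - 1)) + p * (X * (q * walk 1 R (x - 1) (y - 1) (z - 1) + walk 1 R (x - 2) (y - 1) (z - 1))))"
    unfolding walk.simps p_def[symmetric] diff_diff_add one_add_one by algebra
  also have "\<dots> = walk 1 (Suc R) (x + 2) (y - 1) (z - 1) + (q * p) * walk 1 (Suc R) (x + 1) (y - 1) (z - 1)"
  proof -
    have s: "x + 2 - 1 = x + 1" "x + 1 - 1 = x" by simp_all
    show ?thesis
      unfolding a b walk.simps p_def[symmetric] s by algebra
  qed
  finally show ?case by (simp add: p_def X_def mult.commute)
qed

text \<open>The coefficient form of (1 + q^R X) W(X) = q^(-1) X^(-2) Y Z (1 + X) W(q X): the
  multiplier of the theta function is inverted, that of the product is not.\<close>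

lemma walk_shift_minus_1:
  "walk (- 1) R x y z + q ^ R * walk (- 1) R (x - 1) y z
    = q powi x * (q * walk (- 1) R (x + 2) (y - 1) (z - 1) + walk (- 1) R (x + 1) (y - 1) (z - 1))"
proof (induction R arbitrary: x y z)
  case 0
  have a: "theta_coeff (- 1) (x + 1) (y - 1) (z - 1) = q powi (- x) * theta_coeff (- 1) (x - 1) y z"
    using theta_coeff_shift[of "- 1" "x - 1" y z] by (simp add: add.commute)
  have b: "theta_coeff (- 1) (x + 2) (y - 1) (z - 1) = q powi (- x - 1) * theta_coeff (- 1) x y z"
    using theta_coeff_shift[of "- 1" x y z] by simp
  have c: "q powi x * q powi (- x) = 1" "q powi x * (q * q powi (- x - 1)) = 1"
    using powi_add[of x "- x"] powi_add[of 1 "- x - 1"] by simp_all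
  have "q powi x * (q * (q powi (- x - 1) * theta_coeff (- 1) x y z) + q powi (- x) * theta_coeff (- 1) (x - 1) y z)
     = q powi x * (q * q powi (- x - 1)) * theta_coeff (- 1) x y z + q powi x * q powi (- x) * theta_coeff (- 1) (x - 1) y z"
    by algebra
  then show ?case
    unfolding walk.simps a b c by simp
next
  case (Suc R)
  define p X where "p = q ^ R" and "X = q powi x"
  have a: "walk (- 1) R x y z + p * walk (- 1) R (x - 1) y z
    = X * (q * walk (- 1) R (x + 2) (y - 1) (z - 1) + walk (- 1) R (x + 1) (y - 1) (z - 1))" for y z
    using Suc.IH[of x y z] by (simp add: p_def X_def)
  have b: "q * (walk (- 1) R (x - 1) y z + p * walk (- 1) R (x - 2) y z)
    = X * (q * walk (- 1) R (x + 1) (y - 1) (z - 1) + walk (- 1) R x (y - 1) (z - 1))" for y z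
  proof -
    have X: "X = q * q powi (x - 1)" using powi_add[of 1 "x - 1"] by (simp add: X_def)
    have "walk (- 1) R (x - 1) y z + p * walk (- 1) R (x - 2) y z
      = q powi (x - 1) * (q * walk (- 1) R (x + 1) (y - 1) (z - 1) + walk (- 1) R x (y - 1) (z - 1))"
      using Suc.IH[of "x - 1" y z] by (simp add: p_def add.commute)
    then show ?thesis unfolding X by (simp only: mult.assoc)
  qed
  have "walk (- 1) (Suc R) x y z + (q * p) * walk (- 1) (Suc R) (x - 1) y z
    = (walk (- 1) R x y z + p * walk (- 1) R (x - 1) y z) + p * (q * (walk (- 1) R (x - 1) y z + p * walk (- 1) R (x - 2) y z))
    + p * ((walk (- 1) R x (y - 1) z + p * walk (- 1) R (x - 1) (y - 1) z) + p * (q * (walk (- 1) R (x - 1) (y - 1) z + p * walk (- 1) R (x - 2) (y - 1) z)))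
    + p * ((walk (- 1) R x y (z - 1) + p * walk (- 1) R (x - 1) y (z - 1)) + p * (q * (walk (- 1) R (x - 1) y (z - 1) + p * walk (- 1) R (x - 2) y (z - 1))))
    + p * p * ((walk (- 1) R x (y - 1) (z - 1) + p * walk (- 1) R (x - 1) (y - 1) (z - 1)) + p * (q * (walk (- 1) R (x - 1) (y - 1) (z - 1) + p * walk (- 1) R (x - 2) (y - 1) (z - 1))))"
    unfolding walk.simps p_def[symmetric] diff_diff_add one_add_one by algebra
  also have "\<dots> = X * (q * walk (- 1) (Suc R) (x + 2) (y - 1) (z - 1) + walk (- 1) (Suc R) (x + 1) (y - 1) (z - 1))"
  proof -
    have s: "x + 2 - 1 = x + 1" "x + 1 - 1 = x" by simp_all
    show ?thesis
      unfolding a b walk.simps p_def[symmetric] s by algebra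
  qed
  finally show ?case by (simp add: p_def X_def)
qed

text \<open>At nome 1 the theta series is unchanged by the factor X^(-2) Y Z, and multiplication by
  the finite product preserves this.\<close>

lemma walk_shift_0: "walk 0 R (x + 2) (y - 1) (z - 1) = walk 0 R x y z"
proof (induction R arbitrary: x y z)
  case 0
  show ?case using theta_coeff_shift[of 0 x y z] by simp
next
  case (Suc R)
  have s: "walk 0 R (x + 2 - 1) (y - 1) (z - 1) = walk 0 R (x - 1) y z" for y z
    using Suc.IH[of "x - 1" y z] by simp
  show ?case
    unfolding walk.simps s Suc.IH ..
qed

text \<open>Of the eight ways to lower entries of (n + 1, n, n - 1) only those lowering none, the
  last, the last two or all keep the entries distinct; the other four coefficients vanish by
  antisymmetry.\<close>

lemma walk_rho_Suc:
  "walk \<tau> (Suc R) (n + 1) n (n - 1) = walk \<tau> R (n + 1) n (n - 1) + q ^ R * walk \<tau> R (n + 1) n (n - 2)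
    + (q ^ R)\<^sup>2 * walk \<tau> R (n + 1) (n - 1) (n - 2) + (q ^ R) ^ 3 * walk \<tau> R (n - 1 + 1) (n - 1) (n - 1 - 1)"
  by (simp add: walk_eq_0)

lemma walk_rho_0: "walk \<tau> 0 (n + 1) n (n - 1) = (if n = 0 then 1 else 0)"
  by (simp add: theta_coeff_def chi3_def A2_norm_def)

text \<open>Quasi-periodicity expresses the two middle terms \<open>B\<close> and \<open>C\<close>
  of \<open>walk_rho_Suc\<close> by the outer ones, so the recursion closes on the coefficients at
  (n + 1, n, n - 1).\<close>

lemma walk_rho_1: "walk 1 R (n + 1) n (n - 1) = q powi (3 * (n * (n - 1) div 2)) * poch R * ipoch n * ipoch (int R - n)"
proof (induction R arbitrary: n)
  case 0
  show ?case unfolding walk_rho_0 by (cases "n = 0"; cases "n < 0") (auto simp: ipoch_neg)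
next
  case (Suc R)
  define N Z P p where "N = q powi n" and "Z = q powi (int R + 1 - n)" and "P = q powi (n - 1)" and "p = q ^ R"
  have nz: "P \<noteq> 0" by (simp add: P_def)
  have ZP: "Z * P = p"
    using powi_add[of "int R + 1 - n" "n - 1"] by (simp add: Z_def P_def p_def)
  have N: "N = q * P" using powi_add[of 1 "n - 1"] by (simp add: N_def P_def)
  define A A1 B C where "A = walk 1 R (n + 1) n (n - 1)" and "A1 = walk 1 R (n - 1 + 1) (n - 1) (n - 1 - 1)"
    and "B = walk 1 R (n + 1) n (n - 2)" and "C = walk 1 R (n + 1) (n - 1) (n - 2)"
  \<comment> \<open>The instance is chosen so that the remaining term has two equal entries and
    vanishes; the same device gives \<open>C\<close> from \<open>A1\<close> below.\<close>
  have "P * (q * A + B) = A"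
    using walk_shift_1[of "n - 1" R "n + 1" n] walk_cycle[of 1 R "n - 1" "n + 1" n] walk_cycle[of 1 R "n - 2" "n + 1" n]
    by (simp add: A_def B_def P_def walk_eq_0 add.commute)
  then have "P * B = A - P * (q * A)" by (simp only: distrib_left) (simp only: eq_diff_eq add.commute)
  then have B: "P * B = (1 - N) * A" unfolding N by (simp add: left_diff_distrib)
  have "P * A1 = C + p * A1"
    using walk_shift_1[of "n - 1" R n "n - 1"] walk_cycle[of 1 R "n - 2" n "n - 1"]
    by (simp add: A1_def C_def P_def p_def walk_eq_0 add.commute)
  then have C: "C = (P - p) * A1" by (simp only: left_diff_distrib eq_diff_eq)
  define c where "c = q powi (3 * ((n - 1) * (n - 1 - 1) div 2)) * poch R * ipoch n * ipoch (int R + 1 - n)"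
  have e: "q powi (3 * (n * (n - 1) div 2)) = q powi (3 * ((n - 1) * (n - 1 - 1) div 2)) * P ^ 3"
  proof -
    have "q powi (3 * (n * (n - 1) div 2)) = q powi (3 * ((n - 1) * (n - 1 - 1) div 2)) * q powi (3 * (n - 1))"
      by (subst choose2_int) (simp add: powi_add distrib_left)
    also have "q powi (3 * (n - 1)) = P ^ 3"
      using power_int_mult[of q "n - 1" 3] unfolding P_def mult.commute[of 3] by simp
    finally show ?thesis .
  qed
  have i1: "ipoch (int R - n) = (1 - Z) * ipoch (int R + 1 - n)"
    using ipoch_minus_1[of "int R + 1 - n"] by (simp add: Z_def algebra_simps)
  have i2: "int R - (n - 1) = int R + 1 - n" "int (Suc R) - n = int R + 1 - n" by auto
  have A: "A = c * P ^ 3 * (1 - Z)"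
    unfolding A_def Suc.IH e i1 c_def by algebra
  have A1: "A1 = c * (1 - N)"
    unfolding A1_def Suc.IH i2 ipoch_minus_1[of n] c_def N_def by algebra
  have "P * walk 1 (Suc R) (n + 1) n (n - 1) = P * A + p * (P * B) + P * p\<^sup>2 * C + P * p ^ 3 * A1"
    unfolding walk_rho_Suc A_def A1_def B_def C_def p_def by algebra
  also have "\<dots> = P * (c * P ^ 3 * (1 - Z * N))"
    unfolding B C A A1 ZP[symmetric] by algebra
  finally have walk: "walk 1 (Suc R) (n + 1) n (n - 1) = c * P ^ 3 * (1 - Z * N)"
    using nz by simp
  have ZN: "Z * N = q ^ Suc R"
    using ZP N by (simp add: p_def mult_ac)
  show ?case
    unfolding walk ZN e i2 poch_Suc c_def by (simp only: mult_ac)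
qed

text \<open>The same closure of the recursion by the inverted multiplier. With R = n + m the extra
  exponent 2 n (R - n) is the factor q^(2 n m) of g at \<tau> = -1.\<close>

lemma walk_rho_minus_1:
  "walk (- 1) R (n + 1) n (n - 1)
    = q powi (3 * (n * (n - 1) div 2) + 2 * n * (int R - n)) * poch R * ipoch n * ipoch (int R - n)"
proof (induction R arbitrary: n)
  case 0
  show ?case unfolding walk_rho_0 by (cases "n = 0"; cases "n < 0") (auto simp: ipoch_neg)
next
  case (Suc R)
  define N Z P p where "N = q powi n" and "Z = q powi (int R + 1 - n)" and "P = q powi (n - 1)" and "p = q ^ R"
  have nz: "P \<noteq> 0" "N \<noteq> 0" "p \<noteq> 0" by (simp_all add: P_def N_def p_def)
  have ZP: "Z * P = p"
    using powi_add[of "int R + 1 - n" "n - 1"] by (simp add: Z_def P_def p_def)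
  have N: "N = q * P" using powi_add[of 1 "n - 1"] by (simp add: N_def P_def)
  define A A1 B C where "A = walk (- 1) R (n + 1) n (n - 1)" and "A1 = walk (- 1) R (n - 1 + 1) (n - 1) (n - 1 - 1)"
    and "B = walk (- 1) R (n + 1) n (n - 2)" and "C = walk (- 1) R (n + 1) (n - 1) (n - 2)"
  have "A + p * B = P * (q * A)"
    using walk_shift_minus_1[of R "n - 1" "n + 1" n] walk_cycle[of "- 1" R "n - 1" "n + 1" n] walk_cycle[of "- 1" R "n - 2" "n + 1" n]
    by (simp add: A_def B_def P_def p_def walk_eq_0 add.commute)
  then have "p * B = P * (q * A) - A" by (simp only: eq_diff_eq add.commute)
  then have B: "p * B = (N - 1) * A" unfolding N by (simp add: left_diff_distrib)
  have "p * A1 = P * (q * C + A1)"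
    using walk_shift_minus_1[of R "n - 1" n "n - 1"] walk_cycle[of "- 1" R "n - 2" n "n - 1"]
    by (simp add: A1_def C_def P_def p_def walk_eq_0 add.commute)
  then have "P * (q * C) = p * A1 - P * A1" by (simp only: distrib_left eq_diff_eq)
  also have "\<dots> = (p - P) * A1" by (simp only: left_diff_distrib)
  finally have C: "N * C = (p - P) * A1" unfolding N by (simp only: mult_ac)
  define c where "c = q powi (3 * (n * (n - 1) div 2) + 2 * n * (int R - n)) * poch R * ipoch n * ipoch (int R + 1 - n)"
  have e: "q powi (3 * (n * (n - 1) div 2) + 2 * n * (int (Suc R) - n))
      = q powi (3 * (n * (n - 1) div 2) + 2 * n * (int R - n)) * N\<^sup>2"
  proof -
    have "N\<^sup>2 = q powi (2 * n)"
      using power_int_mult[of q n 2] unfolding N_def mult.commute[of 2] by simp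
    moreover have "3 * (n * (n - 1) div 2) + 2 * n * (int (Suc R) - n)
      = 3 * (n * (n - 1) div 2) + 2 * n * (int R - n) + 2 * n" by (simp add: algebra_simps)
    ultimately show ?thesis by (simp only: powi_add)
  qed
  have e1: "p\<^sup>2 * q powi (3 * ((n - 1) * (n - 1 - 1) div 2) + 2 * (n - 1) * (int R - (n - 1)))
      = q powi (3 * (n * (n - 1) div 2) + 2 * n * (int R - n)) * (q * N)"
  proof -
    have "p\<^sup>2 = q powi (2 * int R)"
      using power_int_mult[of q "int R" 2] unfolding p_def mult.commute[of 2] by simp
    moreover have "q * N = q powi (1 + n)" by (simp add: N_def powi_add)
    moreover have "2 * int R + (3 * ((n - 1) * (n - 1 - 1) div 2) + 2 * (n - 1) * (int R - (n - 1)))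
       = (3 * (n * (n - 1) div 2) + 2 * n * (int R - n)) + (1 + n)"
      unfolding choose2_int[of n] by (simp add: algebra_simps)
    ultimately show ?thesis by (simp only: powi_add[symmetric])
  qed
  have i1: "ipoch (int R - n) = (1 - Z) * ipoch (int R + 1 - n)"
    using ipoch_minus_1[of "int R + 1 - n"] by (simp add: Z_def algebra_simps)
  have i2: "ipoch (int R - (n - 1)) = ipoch (int R + 1 - n)" "ipoch (int (Suc R) - n) = ipoch (int R + 1 - n)" by (simp_all add: algebra_simps)
  have A: "A = c * (1 - Z)"
    unfolding A_def Suc.IH i1 c_def by algebra
  have A1: "p\<^sup>2 * A1 = c * q * N * (1 - N)"
  proof -
    have "p\<^sup>2 * A1 = p\<^sup>2 * q powi (3 * ((n - 1) * (n - 1 - 1) div 2) + 2 * (n - 1) * (int R - (n - 1)))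
        * poch R * ipoch (n - 1) * ipoch (int R - (n - 1))"
      unfolding A1_def Suc.IH by (simp only: mult_ac)
    then show ?thesis
      unfolding e1 i2 ipoch_minus_1[of n] c_def N_def by algebra
  qed
  have "N * walk (- 1) (Suc R) (n + 1) n (n - 1) = N * A + N * (p * B) + p\<^sup>2 * (N * C) + N * p * (p\<^sup>2 * A1)"
    unfolding walk_rho_Suc A_def A1_def B_def C_def p_def by algebra
  also have "\<dots> = N * A + N * ((N - 1) * A) + (p - P) * (p\<^sup>2 * A1) + N * p * (p\<^sup>2 * A1)"
    unfolding B C by algebra
  also have "\<dots> = N * (c * N\<^sup>2 * (1 - Z * N))"
    unfolding A A1 unfolding ZP[symmetric] N by algebra
  finally have walk: "walk (- 1) (Suc R) (n + 1) n (n - 1) = c * N\<^sup>2 * (1 - Z * N)"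
    using nz by simp
  have ZN: "Z * N = q ^ Suc R"
    using ZP N by (simp add: p_def mult_ac)
  show ?case
    unfolding walk ZN e i2 poch_Suc c_def by (simp only: mult_ac)
qed

text \<open>Periodicity moves both middle triples to triples with two equal entries. The surviving
  weight (q^R)^3 is the origin of the base p = q^3 for \<tau> = 0.\<close>

lemma walk_rho_0_Suc: "walk 0 (Suc R) (n + 1) n (n - 1)
  = walk 0 R (n + 1) n (n - 1) + (q ^ R) ^ 3 * walk 0 R (n - 1 + 1) (n - 1) (n - 1 - 1)"
proof -
  have "walk 0 R (n + 1) n (n - 2) = 0"
    using walk_cycle[of 0 R "n - 2" "n + 1" n] walk_shift_0[of R "n - 2" "n + 1" n] by (simp add: walk_eq_0)
  moreover have "walk 0 R (n + 1) (n - 1) (n - 2) = 0"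
    using walk_shift_0[of R "n - 1" n "n - 1"] by (simp add: walk_eq_0 add.commute)
  ultimately show ?thesis unfolding walk_rho_Suc by simp
qed

text \<open>A factor such as \<open>esym R (x - c1)\<close> vanishes unless \<open>c1\<close> lies
  between \<open>x - R\<close> and \<open>x\<close>; the bounds on \<open>M\<close> place all
  contributing triples in the box.\<close>

lemma walk_eq_sum:
  assumes "x \<le> M" "y \<le> M" "z \<le> M" "- M \<le> x - int R" "- M \<le> y - int R" "- M \<le> z - int R"
  shows "walk \<tau> R x y z = (\<Sum>(c1, c2, c3)\<in>tri_box M. theta_coeff \<tau> c1 c2 c3
     * (esym R (x - c1) * esym R (y - c2) * esym R (z - c3)))"
  using assms
proof (induction R arbitrary: x y z)
  case 0
  have "(\<Sum>(c1, c2, c3)\<in>tri_box M. theta_coeff \<tau> c1 c2 c3 * (esym 0 (x - c1) * esym 0 (y - c2) * esym 0 (z - c3)))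
    = (\<Sum>p\<in>tri_box M. if p = (x, y, z) then theta_coeff \<tau> x y z else 0)"
    by (intro sum.cong refl) (auto split: if_splits)
  also have "\<dots> = (if (x, y, z) \<in> tri_box M then theta_coeff \<tau> x y z else 0)"
    by (simp add: finite_tri_box)
  also have "\<dots> = theta_coeff \<tau> x y z"
    using "0.prems" by (auto simp: tri_box_def theta_coeff_def)
  finally show ?case by simp
next
  case (Suc R)
  let ?S = "\<lambda>x y z. \<Sum>(c1, c2, c3)\<in>tri_box M. theta_coeff \<tau> c1 c2 c3
     * (esym R (x - c1) * esym R (y - c2) * esym R (z - c3))"
  have IH: "walk \<tau> R (x - i) (y - j) (z - k) = ?S (x - i) (y - j) (z - k)"
    if "i \<in> {0, 1}" "j \<in> {0, 1}" "k \<in> {0, 1}" for i j k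
    using that Suc.prems by (intro Suc.IH) auto
  have "walk \<tau> (Suc R) x y z = ?S x y z
     + q ^ R * (?S (x - 1) y z + ?S x (y - 1) z + ?S x y (z - 1))
     + (q ^ R)\<^sup>2 * (?S (x - 1) (y - 1) z + ?S (x - 1) y (z - 1) + ?S x (y - 1) (z - 1))
     + (q ^ R) ^ 3 * ?S (x - 1) (y - 1) (z - 1)"
    unfolding walk.simps
    using IH[of 0 0 0] IH[of 1 0 0] IH[of 0 1 0] IH[of 0 0 1] IH[of 1 1 0] IH[of 1 0 1] IH[of 0 1 1] IH[of 1 1 1]
    by simp
  also have "\<dots> = (\<Sum>(c1, c2, c3)\<in>tri_box M. theta_coeff \<tau> c1 c2 c3
     * (esym (Suc R) (x - c1) * esym (Suc R) (y - c2) * esym (Suc R) (z - c3)))"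
    unfolding sum_distrib_left sum.distrib[symmetric]
  proof (intro sum.cong refl, goal_cases)
    case (1 p)
    obtain c1 c2 c3 where p: "p = (c1, c2, c3)" by (cases p)
    have s: "x - 1 - c = x - c - 1" for x c :: int by simp
    show ?case
      unfolding p prod.case esym.simps s by algebra
  qed
  finally show ?case .
qed

lemma walk_rho_eq_char_sum:
  assumes "int (n + m) + 1 \<le> M"
  shows "walk \<tau> (n + m) (int n + 1) (int n) (int n - 1) = char_sum M (\<lambda>v u w. q powi (\<tau> * ((A2_norm v u - 1) div 3))
    * (esym (n + m) (int n + 1 + v) * esym (n + m) (int n + u) * esym (n + m) (int n - 1 + w)))"
proof -
  have "walk \<tau> (n + m) (int n + 1) (int n) (int n - 1) = (\<Sum>(c1, c2, c3)\<in>tri_box M. theta_coeff \<tau> c1 c2 c3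
     * (esym (n + m) (int n + 1 - c1) * esym (n + m) (int n - c2) * esym (n + m) (int n - 1 - c3)))"
    using assms by (intro walk_eq_sum) auto
  also have "\<dots> = (\<Sum>(v, u, w)\<in>tri_box M. of_int (chi3 (v - u)) * (q powi (\<tau> * ((A2_norm v u - 1) div 3))
    * (esym (n + m) (int n + 1 + v) * esym (n + m) (int n + u) * esym (n + m) (int n - 1 + w))))"
    by (rule sum.reindex_bij_witness[of _ "\<lambda>(x, y, z). (- x, - y, - z)" "\<lambda>(x, y, z). (- x, - y, - z)"])
      (auto simp: tri_box_def theta_coeff_def A2_norm_def mult_ac)
  finally show ?thesis by (simp add: char_sum_def)
qed

end

lemma A2_norm_mod_3:
  assumes "chi3 (v - u) \<noteq> 0"
  shows "3 * ((A2_norm v u - 1) div 3) = A2_norm v u - 1"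
proof -
  have "A2_norm v u - 1 = (v - u - 1) * (v - u + 1) + 3 * (u * v)"
    by (simp add: A2_norm_def power2_eq_square algebra_simps)
  moreover have "3 dvd (v - u - 1) \<or> 3 dvd (v - u + 1)"
    using assms unfolding chi3_def by presburger
  then have "3 dvd (v - u - 1) * (v - u + 1)" by auto
  ultimately have "3 dvd A2_norm v u - 1" by simp
  then show ?thesis by simp
qed

context generic_q begin

text \<open>The same symmetric product of six \<open>ipoch\<close> values as in the kernel at (n +
  1, m + 1) is factored out, so that only polynomials remain to be compared.\<close>

lemma esym_product:
  fixes n m :: nat and v u w :: int
  assumes "v + u + w = 0"
  defines "z1 \<equiv> q powi v" and "z2 \<equiv> q powi u" and "z3 \<equiv> q powi w"
    and "a \<equiv> q ^ n" and "b \<equiv> q ^ m"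
  shows "esym (n + m) (int n + 1 + v) * esym (n + m) (int n + u) * esym (n + m) (int n - 1 + w)
    = q powi (3 * (int n * (int n - 1) div 2)) * q powi (A2_norm v u + 1) * (poch (n + m)) ^ 3
      * (z1 / z3 * ((1 - b * q / z1) * (1 - b / z1) * (1 - a * q * z2) * (1 - b * q / z2) * (1 - a * q * z3) * (1 - a * z3)))
      * (ipoch (int n + 1 + v) * ipoch (int n + 1 + u) * ipoch (int n + 1 + w) * (ipoch (int m + 1 - v) * ipoch (int m + 1 - u) * ipoch (int m + 1 - w)))"
proof -
  have T: "2 * (s * (s - 1) div 2) = s * (s - 1)" for s :: int by simp
  have w: "w = - v - u" using assms by simp
  \<comment> \<open>Exponents are doubled to get rid of \<open>div 2\<close>. The offsets 1, 0, -1
    contribute the 1 and the v - w.\<close>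
  have "2 * ((int n + 1 + v) * (int n + 1 + v - 1) div 2 + (int n + u) * (int n + u - 1) div 2
      + (int n - 1 + w) * (int n - 1 + w - 1) div 2)
    = 2 * (3 * (int n * (int n - 1) div 2) + (A2_norm v u + 1) + (v - w))"
    unfolding distrib_left T mult.left_commute[of 2 3] w by (simp add: A2_norm_def power2_eq_square algebra_simps)
  then have e: "(int n + 1 + v) * (int n + 1 + v - 1) div 2 + (int n + u) * (int n + u - 1) div 2
      + (int n - 1 + w) * (int n - 1 + w - 1) div 2
    = 3 * (int n * (int n - 1) div 2) + (A2_norm v u + 1) + (v - w)" by (simp only: mult_left_cancel[OF zero_neq_numeral[symmetric]])
  have pe: "q powi ((int n + 1 + v) * (int n + 1 + v - 1) div 2) * q powi ((int n + u) * (int n + u - 1) div 2)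
      * q powi ((int n - 1 + w) * (int n - 1 + w - 1) div 2)
    = q powi (3 * (int n * (int n - 1) div 2)) * q powi (A2_norm v u + 1) * (z1 / z3)"
    unfolding powi_add[symmetric] e unfolding powi_add powi_diff z1_def z3_def ..
  have A: "q powi (int n + 1 + k) = a * q * q powi k" "q powi (int n + k) = a * q powi k" for k
    by (simp_all add: a_def powi_add)
  have B: "q powi (int m + 1 - k) = b * q / q powi k" "q powi (int m - k) = b / q powi k" for k
    by (simp_all add: b_def powi_add powi_diff)
  have i1: "ipoch (int (n + m) - (int n + 1 + v)) = (1 - b / z1) * (1 - b * q / z1) * ipoch (int m + 1 - v)"
  proof -
    have s: "int m + 1 - v - 1 = int m - v" "int (n + m) - (int n + 1 + v) = int m - v - 1" by simp_all
    show ?thesis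
      using ipoch_minus_1[of "int m + 1 - v"] ipoch_minus_1[of "int m - v"] unfolding s B z1_def
      by (simp only: mult.assoc)
  qed
  have i2: "ipoch (int n + u) = (1 - a * q * z2) * ipoch (int n + 1 + u)"
    using ipoch_minus_1[of "int n + 1 + u"] A[of u] by (simp add: z2_def algebra_simps)
  have i3: "ipoch (int (n + m) - (int n + u)) = (1 - b * q / z2) * ipoch (int m + 1 - u)"
    using ipoch_minus_1[of "int m + 1 - u"] B[of u] by (simp add: z2_def algebra_simps)
  have i4: "ipoch (int n - 1 + w) = (1 - a * z3) * (1 - a * q * z3) * ipoch (int n + 1 + w)"
  proof -
    have s: "int n + 1 + w - 1 = int n + w" "int n - 1 + w = int n + w - 1" by simp_all
    show ?thesis
      using ipoch_minus_1[of "int n + 1 + w"] ipoch_minus_1[of "int n + w"] unfolding s A z3_def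
      by (simp only: mult.assoc)
  qed
  have i5: "ipoch (int (n + m) - (int n - 1 + w)) = ipoch (int m + 1 - w)"
    by (simp add: algebra_simps)
  have "esym (n + m) (int n + 1 + v) * esym (n + m) (int n + u) * esym (n + m) (int n - 1 + w)
    = (q powi ((int n + 1 + v) * (int n + 1 + v - 1) div 2) * q powi ((int n + u) * (int n + u - 1) div 2)
      * q powi ((int n - 1 + w) * (int n - 1 + w - 1) div 2)) * (poch (n + m)) ^ 3
      * (ipoch (int n + 1 + v) * ipoch (int (n + m) - (int n + 1 + v)) * (ipoch (int n + u) * ipoch (int (n + m) - (int n + u)))
        * (ipoch (int n - 1 + w) * ipoch (int (n + m) - (int n - 1 + w))))"
    unfolding esym_eq by algebra
  then show ?thesis
    unfolding pe i1 i2 i3 i4 i5 by (simp only: mult_ac)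
qed

text \<open>The second product is p1(x) p2(y) p3(z) with quadratics p_i. Its alternating sum is that
  of y^2 z times the determinant of the coefficients of the p_i in the basis 1, X^2, X, and this
  determinant is (1 - a b q)^2 (1 - a b q^2).\<close>

lemma alternant_identity:
  fixes a b x y z :: 'a
  defines "f \<equiv> \<lambda>x y z. (1 - a * b * q)\<^sup>2 * (1 - a * b * q\<^sup>2) * (y * y * z)
      - (x - b * q) * (x - b) * ((1 - a * q * y) * (y - b * q)) * ((1 - a * q * z) * (1 - a * z))"
  shows "f x y z + f y z x + f z x y - f y x z - f x z y - f z y x = 0"
  unfolding f_def by algebra

text \<open>Both sides are alternating sums over the same triples. On each orbit the summands share
  the symmetric factor \<open>D\<close>, and \<open>alternant_identity\<close> equates the
  rest.\<close>

lemma exp11_eq_walk: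
  assumes "int (n + m) + 1 \<le> M"
  shows "q powi (3 * (int n * (int n - 1) div 2)) * (poch (n + m) * poch (Suc (n + m))) * exp11 \<tau> M 0 n m
    = walk \<tau> (n + m) (int n + 1) (int n) (int n - 1)"
proof -
  define R c a b where "R = n + m" and "c = q powi (3 * (int n * (int n - 1) div 2))"
    and "a = q ^ n" and "b = q ^ m"
  define \<kappa> where "\<kappa> = c * (poch R * poch (Suc R))"
  let ?h = "\<lambda>v u w. \<kappa> * (nweight \<tau> 0 v u * q powi ((1 - v) + (1 + u)) * ker (int n + 1) (int m + 1) v u w)
     - q powi (\<tau> * ((A2_norm v u - 1) div 3)) * (esym R (int n + 1 + v) * esym R (int n + u) * esym R (int n - 1 + w))"
  have "char_sum M ?h = 0"
  proof (rule char_sum_eq_0_alt)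
    fix v u w :: int assume h: "v + u + w = 0" and chi3: "chi3 (v - u) \<noteq> 0"
    define P where "P = (\<lambda>v u w. ipoch (int n + 1 + v) * ipoch (int n + 1 + u) * ipoch (int n + 1 + w)
      * (ipoch (int m + 1 - v) * ipoch (int m + 1 - u) * ipoch (int m + 1 - w)))"
    have ker: "ker (int n + 1) (int m + 1) v u w = (1 - a * b * q\<^sup>2) * (1 - a * b * q) * poch R * P v u w" for v u w
    proof -
      have "nat (int n + 1 + (int m + 1)) = Suc (Suc R)" by (simp add: R_def)
      moreover have "poch (Suc (Suc R)) = (1 - a * b * q\<^sup>2) * (1 - a * b * q) * poch R"
        unfolding poch_Suc by (simp add: R_def a_def b_def power_add power2_eq_square mult_ac)
      ultimately show ?thesis
        unfolding ker_def P_def by (simp only: mult_ac)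
    qed
    have pS: "poch (Suc R) = (1 - a * b * q) * poch R"
      by (simp add: poch_Suc R_def a_def b_def power_add mult_ac)
    define f where "f = (\<lambda>x y z. (1 - a * b * q)\<^sup>2 * (1 - a * b * q\<^sup>2) * (y * y * z)
      - (x - b * q) * (x - b) * ((1 - a * q * y) * (y - b * q)) * ((1 - a * q * z) * (1 - a * z)))"
    have H: "?h v u w = c * q powi (\<tau> * ((A2_norm v u - 1) div 3)) * q powi (A2_norm v u + 1) * poch R ^ 3 * P v u w
       * f (q powi v) (q powi u) (q powi w)" if h: "v + u + w = 0" and chi3: "chi3 (v - u) \<noteq> 0" for v u w
    proof -
      define x y z where "x = q powi v" and "y = q powi u" and "z = q powi w"
      have nz: "x \<noteq> 0" "y \<noteq> 0" "z \<noteq> 0" by (simp_all add: x_def y_def z_def)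
      have xyz: "x * y * z = 1"
        using h by (simp add: x_def y_def z_def flip: powi_add)
      \<comment> \<open>The 3 in \<open>3 + \<tau>\<close> supplies the N - 1 of the q-binomial
        exponent N + 1; the two ones in (1 - v) + (1 + u) supply the remaining 2.\<close>
      have "(3 + \<tau>) * ((A2_norm v u - 1) div 3) + ((1 - v) + (1 + u))
         = \<tau> * ((A2_norm v u - 1) div 3) + (A2_norm v u + 1) + (u - v)"
        using A2_norm_mod_3[OF chi3] by (simp add: distrib_right)
      then have "q powi ((3 + \<tau>) * ((A2_norm v u - 1) div 3)) * q powi ((1 - v) + (1 + u))
         = q powi (\<tau> * ((A2_norm v u - 1) div 3)) * q powi (A2_norm v u + 1) * (y / x)"
        by (simp only: powi_add[symmetric] powi_diff[symmetric] x_def y_def)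
      then have e: "nweight \<tau> 0 v u * q powi ((1 - v) + (1 + u))
          = q powi (\<tau> * ((A2_norm v u - 1) div 3)) * q powi (A2_norm v u + 1) * (y / x)"
        unfolding nweight_def by simp
      have yx: "y / x = y * y * z"
        using xyz nz by (simp add: field_simps)
      have xz: "x / z * ((1 - b * q / x) * (1 - b / x) * (1 - a * q * y) * (1 - b * q / y) * (1 - a * q * z) * (1 - a * z))
         = (x - b * q) * (x - b) * ((1 - a * q * y) * (y - b * q)) * ((1 - a * q * z) * (1 - a * z))"
      proof -
        have "x / z = x * x * y" using xyz nz by (simp add: field_simps)
        moreover have "x * (1 - b * q / x) = x - b * q" "x * (1 - b / x) = x - b" "y * (1 - b * q / y) = y - b * q"
          using nz by (simp_all add: right_diff_distrib)
        ultimately show ?thesis by algebra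
      qed
      have E: "esym R (int n + 1 + v) * esym R (int n + u) * esym R (int n - 1 + w)
        = c * q powi (A2_norm v u + 1) * poch R ^ 3 * ((x - b * q) * (x - b) * ((1 - a * q * y) * (y - b * q)) * ((1 - a * q * z) * (1 - a * z)))
          * P v u w"
        using esym_product[OF h, of n m]
        unfolding x_def[symmetric] y_def[symmetric] z_def[symmetric] a_def[symmetric] b_def[symmetric]
          c_def[symmetric] R_def[symmetric] xz P_def .
      have "?h v u w = \<kappa> * (q powi (\<tau> * ((A2_norm v u - 1) div 3)) * q powi (A2_norm v u + 1) * (y * y * z)
          * ((1 - a * b * q\<^sup>2) * (1 - a * b * q) * poch R * P v u w))
        - q powi (\<tau> * ((A2_norm v u - 1) div 3)) * (c * q powi (A2_norm v u + 1) * poch R ^ 3 * ((x - b * q) * (x - b) * ((1 - a * q * y) * (y - b * q)) * ((1 - a * q * z) * (1 - a * z)))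
          * P v u w)"
        unfolding e E ker yx ..
      also have "\<dots> = c * q powi (\<tau> * ((A2_norm v u - 1) div 3)) * q powi (A2_norm v u + 1) * poch R ^ 3 * P v u w * f x y z"
        unfolding f_def \<kappa>_def pS by algebra
      finally show ?thesis by (simp add: x_def y_def z_def)
    qed
    have N: "A2_norm u w = A2_norm v u" "A2_norm w v = A2_norm v u" "A2_norm u v = A2_norm v u" "A2_norm v w = A2_norm v u" "A2_norm w u = A2_norm v u"
      using A2_norm_third[of v u w] A2_norm_third[of u v w] h A2_norm_commute by auto
    have P: "P u w v = P v u w" "P w v u = P v u w" "P u v w = P v u w" "P v w u = P v u w" "P w u v = P v u w"
      by (simp_all add: P_def mult_ac)
    have w: "w = - v - u" using h by simp
    have S: "u + w + v = 0" "w + v + u = 0" "u + v + w = 0" "v + w + u = 0" "w + u + v = 0"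
      using h by auto
    have "chi3 (u - w) = chi3 (v - u)" "chi3 (w - v) = chi3 (v - u)" "chi3 (u - v) = chi3 (- (v - u))"
      "chi3 (v - w) = chi3 (- (v - u))" "chi3 (w - u) = chi3 (- (v - u))"
      unfolding w by (rule chi3_cong, presburger)+
    then have Q: "chi3 (u - w) \<noteq> 0" "chi3 (w - v) \<noteq> 0" "chi3 (u - v) \<noteq> 0" "chi3 (v - w) \<noteq> 0" "chi3 (w - u) \<noteq> 0"
      using chi3 chi3_minus[of "v - u"] by auto
    define D where "D = c * q powi (\<tau> * ((A2_norm v u - 1) div 3)) * q powi (A2_norm v u + 1) * poch R ^ 3 * P v u w"
    have HH: "?h v u w = D * f (q powi v) (q powi u) (q powi w)"
      "?h u w v = D * f (q powi u) (q powi w) (q powi v)"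
      "?h w v u = D * f (q powi w) (q powi v) (q powi u)"
      "?h u v w = D * f (q powi u) (q powi v) (q powi w)"
      "?h v w u = D * f (q powi v) (q powi w) (q powi u)"
      "?h w u v = D * f (q powi w) (q powi u) (q powi v)"
      using H[OF h chi3] H[OF S(1) Q(1)] H[OF S(2) Q(2)] H[OF S(3) Q(3)] H[OF S(4) Q(4)] H[OF S(5) Q(5)]
      by (simp_all only: N P D_def)
    have "f (q powi v) (q powi u) (q powi w) + f (q powi u) (q powi w) (q powi v) + f (q powi w) (q powi v) (q powi u)
        - f (q powi u) (q powi v) (q powi w) - f (q powi v) (q powi w) (q powi u) - f (q powi w) (q powi u) (q powi v) = 0"
      unfolding f_def by (rule alternant_identity)
    then show "?h v u w + ?h u w v + ?h w v u - ?h u v w - ?h v w u - ?h w u v = 0"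
      unfolding HH by (simp only: distrib_left[symmetric] right_diff_distrib[symmetric] mult_zero_right)
  qed
  then have "\<kappa> * exp11 \<tau> M 0 n m = char_sum M (\<lambda>v u w. q powi (\<tau> * ((A2_norm v u - 1) div 3)) *
      (esym R (int n + 1 + v) * esym R (int n + u) * esym R (int n - 1 + w)))"
    unfolding char_sum_diff char_sum_cmult exp11_def by simp
  also have "\<dots> = walk \<tau> (n + m) (int n + 1) (int n) (int n - 1)"
    using walk_rho_eq_char_sum[OF assms] by (simp add: R_def)
  finally show ?thesis by (simp add: \<kappa>_def c_def R_def)
qed

lemma generic_q_power: "k > 0 \<Longrightarrow> generic_q (q ^ k)"
  by unfold_locales (auto simp: q_not_root_of_unity simp flip: power_mult)

lemma walk_rho_0_eq: "walk 0 R (n + 1) n (n - 1) = generic_q.esym (q ^ 3) R n"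
proof (induction R arbitrary: n)
  case 0
  interpret q3: generic_q "q ^ 3" by (rule generic_q_power) simp
  show ?case unfolding walk_rho_0 by simp
next
  case (Suc R)
  interpret q3: generic_q "q ^ 3" by (rule generic_q_power) simp
  show ?case
    unfolding walk_rho_0_Suc Suc.IH q3.esym.simps by (simp add: power_mult[symmetric] mult.commute)
qed

text \<open>\<open>tchain\<close> omits the numerator \<open>1 - q^(\<lambda>_a + \<mu>_b + 1)\<close>; lowering both \<open>a\<close> and \<open>b\<close> by one
  multiplies its summands by \<open>q^(\<lambda>_a + \<mu>_b)\<close>.\<close>

primrec tchain :: "(nat \<Rightarrow> nat \<Rightarrow> 'a) \<Rightarrow> nat \<Rightarrow> nat \<Rightarrow> nat \<Rightarrow> nat \<Rightarrow> nat \<Rightarrow> 'a" where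
  "tchain g 0 a b = g"
| "tchain g (Suc L) a b = bailey (if a = 0 then 1 else 0) (if b = 0 then 1 else 0) (tchain g L (a - 1) (b - 1))"

definition schain :: "(nat \<Rightarrow> nat \<Rightarrow> 'a) \<Rightarrow> nat \<Rightarrow> nat \<Rightarrow> nat \<Rightarrow> nat \<Rightarrow> nat \<Rightarrow> 'a" where
  "schain g L a b n m = tchain g L a b n m - (if a = 0 \<or> b = 0 then 0 else q * tchain g L (a - 1) (b - 1) n m)"

definition expansion :: "int \<Rightarrow> int \<Rightarrow> nat \<Rightarrow> nat \<Rightarrow> nat \<Rightarrow> nat \<Rightarrow> nat \<Rightarrow> 'a" where
  "expansion \<tau> M L a b = (if a = 0 \<and> b = 0 then exp11 \<tau> M L else if a = 0 then exp10 \<tau> M L b else exp00 \<tau> M L a b)"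

text \<open>The expansion of \<open>g\<close> is truncated to a box and so holds only for n + m < M.
  A Bailey step evaluates its argument at r \<le> n and s \<le> m, hence one \<open>M\<close> serves
  the whole chain.\<close>

context
  fixes g :: "nat \<Rightarrow> nat \<Rightarrow> 'a" and \<tau> M :: int and C :: 'a
  assumes g: "\<And>n m. int (n + m) + 1 \<le> M \<Longrightarrow> g n m = C * exp11 \<tau> M 0 n m"
begin

lemma tchain_00: "int (n + m) + 1 \<le> M \<Longrightarrow> tchain g L 0 0 n m = C * exp11 \<tau> M L n m"
proof (induction L arbitrary: n m)
  case 0
  then show ?case by (simp add: g)
next
  case (Suc L)
  have "tchain g (Suc L) 0 0 n m = bailey 1 1 (\<lambda>r s. C * exp11 \<tau> M L r s) n m"
    unfolding tchain.simps using Suc by (simp, intro bailey_cong) auto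
  then show ?case by (simp add: bailey_cmult bailey_exp11)
qed

text \<open>The innermost L - b steps carry both weights and are described by \<open>exp11\<close>.
  At index b the expansion is reread as \<open>exp10\<close>, for which the weight q^s is no longer
  needed.\<close>

lemma tchain_0: "b \<le> L \<Longrightarrow> int (n + m) + 1 \<le> M \<Longrightarrow> tchain g L 0 b n m = C * exp10 \<tau> M L b n m"
proof (induction L arbitrary: b n m)
  case 0
  then show ?case by (simp add: g exp11_eq_exp10)
next
  case (Suc L)
  show ?case
  proof (cases b)
    case 0
    then show ?thesis using tchain_00[OF Suc.prems(2)] by (simp add: exp11_eq_exp10 del: tchain.simps)
  next
    case (Suc b')
    have "tchain g (Suc L) 0 b n m = bailey 1 0 (\<lambda>r s. C * exp10 \<tau> M L b' r s) n m"
      unfolding tchain.simps using Suc Suc.IH[of b'] \<open>b \<le> Suc L\<close> Suc.prems by (simp, intro bailey_cong) auto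
    then show ?thesis by (simp add: bailey_cmult bailey_exp10 Suc)
  qed
qed

text \<open>The outer steps before index a are unweighted in both chains and commute with their
  difference. At index a the difference is evaluated by \<open>bailey_exp10_minus\<close>.\<close>

lemma schain_pos: "0 < a \<Longrightarrow> a \<le> b \<Longrightarrow> b \<le> L \<Longrightarrow> int (n + m) + 1 \<le> M \<Longrightarrow> schain g L a b n m = C * exp00 \<tau> M L a b n m"
proof (induction L arbitrary: a b n m)
  case 0
  then show ?case by simp
next
  case (Suc L)
  obtain a' b' where ab: "a = Suc a'" "b = Suc b'"
    using Suc.prems by (metis Suc_le_D gr0_implies_Suc)
  have S: "schain g (Suc L) a b n m = bailey 0 0 (tchain g L a' b') n m - q * tchain g (Suc L) a' b' n m"
    by (simp add: schain_def ab)
  show ?case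
  proof (cases "a' = 0")
    case True
    have "bailey 0 0 (tchain g L a' b') n m = bailey 0 0 (\<lambda>r s. C * exp10 \<tau> M L b' r s) n m"
      using True ab Suc.prems by (intro bailey_cong) (auto intro!: tchain_0)
    moreover have "tchain g (Suc L) a' b' n m = C * exp10 \<tau> M (Suc L) b' n m"
      using True ab Suc.prems by (auto intro!: tchain_0 simp del: tchain.simps)
    ultimately have "schain g (Suc L) a b n m = C * (bailey 0 0 (exp10 \<tau> M L b') n m - q * exp10 \<tau> M (Suc L) b' n m)"
      unfolding S by (simp add: bailey_cmult algebra_simps)
    then show ?thesis by (simp add: bailey_exp10_minus ab True)
  next
    case False
    then have b': "b' \<noteq> 0" using Suc.prems ab by auto
    have "schain g (Suc L) a b n m = bailey 0 0 (schain g L a' b') n m"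
    proof -
      have "schain g L a' b' = (\<lambda>n m. tchain g L a' b' n m - q * tchain g L (a' - 1) (b' - 1) n m)"
        using False b' by (simp add: schain_def[abs_def])
      then show ?thesis
        unfolding S using False b' by (simp add: bailey_diff bailey_cmult)
    qed
    also have "\<dots> = bailey 0 0 (\<lambda>r s. C * exp00 \<tau> M L a' b' r s) n m"
      using False ab Suc.prems by (intro bailey_cong) (auto intro!: Suc.IH)
    finally show ?thesis by (simp add: bailey_cmult bailey_exp00 ab)
  qed
qed

lemma schain_eq_expansion:
  assumes "a \<le> b" "b \<le> L" "int (n + m) + 1 \<le> M"
  shows "schain g L a b n m = C * expansion \<tau> M L a b n m"
proof (cases "a = 0")
  case True
  then show ?thesis
    using tchain_0[of b L n m] tchain_00[of n m L] assms by (auto simp: schain_def expansion_def)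
next
  case False
  then show ?thesis using schain_pos[of a b L n m] assms by (simp add: expansion_def)
qed

end

end

section \<open>Locally finite sums of formal power series\<close>

definition locally_finite :: "('i \<Rightarrow> 'a::zero fps) \<Rightarrow> 'i set \<Rightarrow> bool" where
  "locally_finite f A \<longleftrightarrow> (\<forall>n. finite {x \<in> A. \<exists>i\<le>n. fps_nth (f x) i \<noteq> 0})"

text \<open>Coefficientwise summation. Under \<open>locally_finite\<close> each coefficient is a
  genuine finite sum; an infinite support would give the default 0.\<close>

definition fsum :: "('i \<Rightarrow> 'a::comm_monoid_add fps) \<Rightarrow> 'i set \<Rightarrow> 'a fps" where
  "fsum f A = Abs_fps (\<lambda>n. \<Sum>x\<in>{x \<in> A. fps_nth (f x) n \<noteq> 0}. fps_nth (f x) n)"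

lemma fsum_nth:
  assumes "finite B" "{x \<in> A. fps_nth (f x) n \<noteq> 0} \<subseteq> B" "B \<subseteq> A"
  shows "fps_nth (fsum f A) n = (\<Sum>x\<in>B. fps_nth (f x) n)"
  unfolding fsum_def fps_nth_Abs_fps by (rule sum.mono_neutral_left) (use assms in auto)

lemma locally_finiteI:
  fixes e :: "'i \<Rightarrow> nat"
  assumes "\<And>x i. x \<in> A \<Longrightarrow> i < e x \<Longrightarrow> fps_nth (f x) i = 0" "\<And>n. finite {x \<in> A. e x \<le> n}"
  shows "locally_finite f A"
  unfolding locally_finite_def
proof
  fix n
  have "{x \<in> A. \<exists>i\<le>n. fps_nth (f x) i \<noteq> 0} \<subseteq> {x \<in> A. e x \<le> n}"
    using assms(1) by (auto simp: not_le) (meson le_trans not_le)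
  then show "finite {x \<in> A. \<exists>i\<le>n. fps_nth (f x) i \<noteq> 0}"
    using assms(2) finite_subset by blast
qed

text \<open>One finite index set serves all coefficients up to \<open>n\<close>, which is what
  products of sums need.\<close>

lemma fsum_obtain:
  assumes "locally_finite f A"
  obtains B where "finite B" "B \<subseteq> A" "\<And>x i. x \<in> A \<Longrightarrow> x \<notin> B \<Longrightarrow> i \<le> n \<Longrightarrow> fps_nth (f x) i = 0"
    "\<And>i. i \<le> n \<Longrightarrow> fps_nth (fsum f A) i = fps_nth (\<Sum>x\<in>B. f x) i"
proof (rule that[of "{x \<in> A. \<exists>i\<le>n. fps_nth (f x) i \<noteq> 0}"])
  show fin: "finite {x \<in> A. \<exists>i\<le>n. fps_nth (f x) i \<noteq> 0}"
    using assms by (auto simp: locally_finite_def)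
  fix i assume "i \<le> n"
  then show "fps_nth (fsum f A) i = fps_nth (\<Sum>x\<in>{x \<in> A. \<exists>i\<le>n. fps_nth (f x) i \<noteq> 0}. f x) i"
    unfolding fps_sum_nth by (intro fsum_nth fin) auto
qed auto

lemma fsum_has_sum:
  fixes f :: "'i \<Rightarrow> 'a::ab_group_add fps"
  assumes "locally_finite f A"
  shows "(f has_sum fsum f A) A"
  unfolding has_sum_def tendsto_fps_iff
proof
  fix n
  obtain B where B: "finite B" "B \<subseteq> A" "\<And>x i. x \<in> A \<Longrightarrow> x \<notin> B \<Longrightarrow> i \<le> n \<Longrightarrow> fps_nth (f x) i = 0"
    "\<And>i. i \<le> n \<Longrightarrow> fps_nth (fsum f A) i = fps_nth (\<Sum>x\<in>B. f x) i"
    using fsum_obtain[OF assms, of n] by blast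
  show "\<forall>\<^sub>F X in finite_subsets_at_top A. fps_nth (sum f X) n = fps_nth (fsum f A) n"
    unfolding eventually_finite_subsets_at_top
  proof (intro exI[of _ B] conjI allI impI B)
    fix Y assume Y: "finite Y \<and> B \<subseteq> Y \<and> Y \<subseteq> A"
    have "fps_nth (sum f Y) n = (\<Sum>x\<in>Y. fps_nth (f x) n)" by (simp add: fps_sum_nth)
    also have "\<dots> = (\<Sum>x\<in>B. fps_nth (f x) n)"
      by (rule sum.mono_neutral_right) (use Y B(3) in auto)
    finally show "fps_nth (sum f Y) n = fps_nth (fsum f A) n"
      using B(4)[of n] by (simp add: fps_sum_nth)
  qed
qed

lemma fsum_cong:
  assumes "\<And>x. x \<in> A \<Longrightarrow> f x = g x"
  shows "fsum f A = fsum g A"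
proof (rule fps_ext)
  fix n
  have "{x \<in> A. fps_nth (f x) n \<noteq> 0} = {x \<in> A. fps_nth (g x) n \<noteq> 0}" using assms by auto
  then show "fps_nth (fsum f A) n = fps_nth (fsum g A) n"
    using assms by (simp add: fsum_def)
qed

lemma fsum_finite: "finite A \<Longrightarrow> fsum f A = sum f A"
  by (rule fps_ext) (simp add: fps_sum_nth fsum_nth[of A])

lemma fsum_reindex:
  assumes "bij_betw g A B"
  shows "fsum (\<lambda>x. f (g x)) A = fsum f B"
proof (rule fps_ext)
  fix n
  have "bij_betw g {x \<in> A. fps_nth (f (g x)) n \<noteq> 0} {y \<in> B. fps_nth (f y) n \<noteq> 0}"
    unfolding bij_betw_def
  proof
    show "inj_on g {x \<in> A. fps_nth (f (g x)) n \<noteq> 0}"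
      using assms by (auto simp: bij_betw_def inj_on_def)
    show "g ` {x \<in> A. fps_nth (f (g x)) n \<noteq> 0} = {y \<in> B. fps_nth (f y) n \<noteq> 0}"
      using assms by (auto simp: bij_betw_def)
  qed
  then show "fps_nth (fsum (\<lambda>x. f (g x)) A) n = fps_nth (fsum f B) n"
    unfolding fsum_def fps_nth_Abs_fps by (rule sum.reindex_bij_betw)
qed

lemma locally_finite_reindex:
  assumes "bij_betw g A B" "locally_finite f B"
  shows "locally_finite (\<lambda>x. f (g x)) A"
  unfolding locally_finite_def
proof
  fix n
  have "bij_betw g {x \<in> A. \<exists>i\<le>n. fps_nth (f (g x)) i \<noteq> 0} {y \<in> B. \<exists>i\<le>n. fps_nth (f y) i \<noteq> 0}"
    unfolding bij_betw_def
  proof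
    show "inj_on g {x \<in> A. \<exists>i\<le>n. fps_nth (f (g x)) i \<noteq> 0}"
      using assms(1) by (auto simp: bij_betw_def inj_on_def)
    show "g ` {x \<in> A. \<exists>i\<le>n. fps_nth (f (g x)) i \<noteq> 0} = {y \<in> B. \<exists>i\<le>n. fps_nth (f y) i \<noteq> 0}"
      using assms(1) by (auto simp: bij_betw_def)
  qed
  then show "finite {x \<in> A. \<exists>i\<le>n. fps_nth (f (g x)) i \<noteq> 0}"
    using assms(2) bij_betw_finite unfolding locally_finite_def by blast
qed

lemma fps_mult_nth_cong:
  assumes "\<And>i. i \<le> n \<Longrightarrow> fps_nth a i = fps_nth a' i" "\<And>i. i \<le> n \<Longrightarrow> fps_nth b i = fps_nth b' i"
  shows "fps_nth (a * b) n = fps_nth (a' * b') n"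
  unfolding fps_mult_nth using assms by (intro sum.cong) auto

lemma fps_mult_nth_zero:
  fixes a :: "'a::comm_ring_1 fps"
  assumes "\<And>i. i \<le> n \<Longrightarrow> fps_nth a i = 0"
  shows "fps_nth (a * b) n = 0"
  unfolding fps_mult_nth using assms by (intro sum.neutral) auto

lemma fsum_mult:
  fixes f :: "'i \<Rightarrow> 'a::comm_ring_1 fps" and g :: "'j \<Rightarrow> 'a fps"
  assumes f: "locally_finite f A" and g: "locally_finite g B"
  shows "fsum f A * fsum g B = fsum (\<lambda>(x, y). f x * g y) (A \<times> B)"
    and "locally_finite (\<lambda>(x, y). f x * g y) (A \<times> B)"
proof -
  have *: "\<exists>C D. finite C \<and> finite D \<and> C \<subseteq> A \<and> D \<subseteq> B
      \<and> (\<forall>i\<le>n. \<forall>x\<in>A. \<forall>y\<in>B. (x, y) \<notin> C \<times> D \<longrightarrow> fps_nth (f x * g y) i = 0)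
      \<and> fps_nth (fsum f A * fsum g B) n = (\<Sum>(x, y)\<in>C \<times> D. fps_nth (f x * g y) n)" for n
  proof -
    obtain C where C: "finite C" "C \<subseteq> A" "\<And>x i. x \<in> A \<Longrightarrow> x \<notin> C \<Longrightarrow> i \<le> n \<Longrightarrow> fps_nth (f x) i = 0"
      "\<And>i. i \<le> n \<Longrightarrow> fps_nth (fsum f A) i = fps_nth (\<Sum>x\<in>C. f x) i"
      using fsum_obtain[OF f, of n] by blast
    obtain D where D: "finite D" "D \<subseteq> B" "\<And>x i. x \<in> B \<Longrightarrow> x \<notin> D \<Longrightarrow> i \<le> n \<Longrightarrow> fps_nth (g x) i = 0"
      "\<And>i. i \<le> n \<Longrightarrow> fps_nth (fsum g B) i = fps_nth (\<Sum>x\<in>D. g x) i"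
      using fsum_obtain[OF g, of n] by blast
    have 1: "fps_nth (fsum f A * fsum g B) n = fps_nth ((\<Sum>x\<in>C. f x) * (\<Sum>x\<in>D. g x)) n"
      using C(4) D(4) by (intro fps_mult_nth_cong) auto
    have 2: "fps_nth (f x * g y) i = 0" if "i \<le> n" "x \<in> A" "y \<in> B" "(x, y) \<notin> C \<times> D" for i x y
    proof (cases "x \<in> C")
      case False
      then show ?thesis using C(3) that by (intro fps_mult_nth_zero) auto
    next
      case True
      then have "fps_nth (g y * f x) i = 0" using D(3) that by (intro fps_mult_nth_zero) auto
      then show ?thesis by (simp add: mult.commute)
    qed
    show ?thesis
    proof (intro exI[of _ C] exI[of _ D] conjI allI impI ballI C D)
      show "fps_nth (fsum f A * fsum g B) n = (\<Sum>(x, y)\<in>C \<times> D. fps_nth (f x * g y) n)"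
        unfolding 1 sum_product sum.cartesian_product fps_sum_nth by (simp add: case_prod_beta)
    qed (use 2 in auto)
  qed
  show "fsum f A * fsum g B = fsum (\<lambda>(x, y). f x * g y) (A \<times> B)"
  proof (rule fps_ext)
    fix n
    obtain C D where CD: "finite C" "finite D" "C \<subseteq> A" "D \<subseteq> B"
      "\<And>i x y. i \<le> n \<Longrightarrow> x \<in> A \<Longrightarrow> y \<in> B \<Longrightarrow> (x, y) \<notin> C \<times> D \<Longrightarrow> fps_nth (f x * g y) i = 0"
      "fps_nth (fsum f A * fsum g B) n = (\<Sum>(x, y)\<in>C \<times> D. fps_nth (f x * g y) n)"
      using *[of n] by blast
    have "fps_nth (fsum (\<lambda>(x, y). f x * g y) (A \<times> B)) n = (\<Sum>p\<in>C \<times> D. fps_nth (case p of (x, y) \<Rightarrow> f x * g y) n)"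
    proof (rule fsum_nth)
      show "{p \<in> A \<times> B. fps_nth (case p of (x, y) \<Rightarrow> f x * g y) n \<noteq> 0} \<subseteq> C \<times> D"
        using CD(5)[of n] by auto
    qed (use CD in auto)
    then show "fps_nth (fsum f A * fsum g B) n = fps_nth (fsum (\<lambda>(x, y). f x * g y) (A \<times> B)) n"
      using CD(6) by (simp add: case_prod_beta)
  qed
  show "locally_finite (\<lambda>(x, y). f x * g y) (A \<times> B)"
    unfolding locally_finite_def
  proof
    fix n
    obtain C D where CD: "finite C" "finite D" "C \<subseteq> A" "D \<subseteq> B"
      "\<And>i x y. i \<le> n \<Longrightarrow> x \<in> A \<Longrightarrow> y \<in> B \<Longrightarrow> (x, y) \<notin> C \<times> D \<Longrightarrow> fps_nth (f x * g y) i = 0"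
      using *[of n] by blast
    have "{p \<in> A \<times> B. \<exists>i\<le>n. fps_nth (case p of (x, y) \<Rightarrow> f x * g y) i \<noteq> 0} \<subseteq> C \<times> D"
      using CD(5) by auto
    then show "finite {p \<in> A \<times> B. \<exists>i\<le>n. fps_nth (case p of (x, y) \<Rightarrow> f x * g y) i \<noteq> 0}"
      using CD(1,2) finite_subset by blast
  qed
qed

lemma fsum_cmult:
  fixes c :: "'a::comm_ring_1 fps"
  assumes "locally_finite f A"
  shows "fsum (\<lambda>x. c * f x) A = c * fsum f A" and "locally_finite (\<lambda>x. c * f x) A"
proof -
  \<comment> \<open>The constant is treated as a sum over a one-point index set, so that
    \<open>fsum_mult\<close> applies.\<close>
  have l: "locally_finite (\<lambda>_::unit. c) UNIV" by (simp add: locally_finite_def)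
  have b: "bij_betw (\<lambda>x. ((), x)) A (UNIV \<times> A)"
    by (auto simp: bij_betw_def inj_on_def)
  have "c = fsum (\<lambda>_::unit. c) UNIV" by (simp add: fsum_finite)
  then have "c * fsum f A = fsum (\<lambda>(x, y). c * f y) ((UNIV :: unit set) \<times> A)"
    using fsum_mult(1)[OF l assms] by simp
  also have "\<dots> = fsum (\<lambda>x. c * f x) A"
    using fsum_reindex[OF b, of "\<lambda>(x, y). c * f y"] by simp
  finally show "fsum (\<lambda>x. c * f x) A = c * fsum f A" by simp
  show "locally_finite (\<lambda>x. c * f x) A"
    using locally_finite_reindex[OF b fsum_mult(2)[OF l assms]] by simp
qed

lemma fsum_fsum:
  fixes f :: "'i \<Rightarrow> 'j \<Rightarrow> 'a::comm_ring_1 fps"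
  assumes f: "locally_finite (\<lambda>(x, y). f x y) (A \<times> B)"
  shows "fsum (\<lambda>x. fsum (f x) B) A = fsum (\<lambda>(x, y). f x y) (A \<times> B)"
proof (rule fps_ext)
  fix n
  obtain P where P: "finite P" "P \<subseteq> A \<times> B"
    "\<And>p i. p \<in> A \<times> B \<Longrightarrow> p \<notin> P \<Longrightarrow> i \<le> n \<Longrightarrow> fps_nth (case p of (x, y) \<Rightarrow> f x y) i = 0"
    "\<And>i. i \<le> n \<Longrightarrow> fps_nth (fsum (\<lambda>(x, y). f x y) (A \<times> B)) i = fps_nth (\<Sum>p\<in>P. case p of (x, y) \<Rightarrow> f x y) i"
    using fsum_obtain[OF f, of n] by blast
  define C D where "C = fst ` P" and "D = snd ` P"
  have CD: "finite C" "finite D" "C \<subseteq> A" "D \<subseteq> B" "P \<subseteq> C \<times> D"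
  proof -
    show "finite C" "finite D" using P(1) by (auto simp: C_def D_def)
    show "C \<subseteq> A" "D \<subseteq> B" using P(2) by (auto simp: C_def D_def)
    show "P \<subseteq> C \<times> D" by (force simp: C_def D_def)
  qed
  have z: "fps_nth (f x y) n = 0" if "x \<in> A" "y \<in> B" "(x, y) \<notin> C \<times> D" for x y
    using P(3)[of "(x, y)" n] that CD(5) by auto
  have inner: "fps_nth (fsum (f x) B) n = (\<Sum>y\<in>D. fps_nth (f x y) n)" if "x \<in> A" for x
  proof (rule fsum_nth)
    show "{y \<in> B. fps_nth (f x y) n \<noteq> 0} \<subseteq> D" using z[OF that] by blast
  qed (use CD in auto)
  have "fps_nth (fsum (\<lambda>x. fsum (f x) B) A) n = (\<Sum>x\<in>C. fps_nth (fsum (f x) B) n)"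
  proof (rule fsum_nth)
    show "{x \<in> A. fps_nth (fsum (f x) B) n \<noteq> 0} \<subseteq> C"
    proof
      fix x assume x: "x \<in> {x \<in> A. fps_nth (fsum (f x) B) n \<noteq> 0}"
      then have "(\<Sum>y\<in>D. fps_nth (f x y) n) \<noteq> 0" using inner by auto
      then obtain y where "y \<in> D" "fps_nth (f x y) n \<noteq> 0" by (meson sum.neutral)
      then show "x \<in> C" using z[of x y] x CD(4) by auto
    qed
  qed (use CD in auto)
  also have "\<dots> = (\<Sum>x\<in>C. \<Sum>y\<in>D. fps_nth (f x y) n)"
    using CD(3) inner by (intro sum.cong) auto
  also have "\<dots> = (\<Sum>p\<in>C \<times> D. fps_nth (case p of (x, y) \<Rightarrow> f x y) n)"
    by (simp add: sum.cartesian_product case_prod_beta)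
  also have "\<dots> = fps_nth (fsum (\<lambda>(x, y). f x y) (A \<times> B)) n"
  proof (rule fsum_nth[symmetric])
    show "{p \<in> A \<times> B. fps_nth (case p of (x, y) \<Rightarrow> f x y) n \<noteq> 0} \<subseteq> C \<times> D"
      using z by auto
  qed (use CD in auto)
  finally show "fps_nth (fsum (\<lambda>x. fsum (f x) B) A) n = fps_nth (fsum (\<lambda>(x, y). f x y) (A \<times> B)) n" .
qed

lemma LIMSEQ_fps_mult:
  fixes a b :: "nat \<Rightarrow> 'a::comm_ring_1 fps"
  assumes "a \<longlonglongrightarrow> s" "b \<longlonglongrightarrow> t"
  shows "(\<lambda>N. a N * b N) \<longlonglongrightarrow> s * t"
  unfolding tendsto_fps_iff
proof
  fix n
  have "\<forall>\<^sub>F N in sequentially. \<forall>i\<in>{..n}. fps_nth (a N) i = fps_nth s i"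
    using assms(1) by (intro eventually_ball_finite) (auto simp: tendsto_fps_iff)
  moreover have "\<forall>\<^sub>F N in sequentially. \<forall>i\<in>{..n}. fps_nth (b N) i = fps_nth t i"
    using assms(2) by (intro eventually_ball_finite) (auto simp: tendsto_fps_iff)
  ultimately show "\<forall>\<^sub>F N in sequentially. fps_nth (a N * b N) n = fps_nth (s * t) n"
    by eventually_elim (auto intro!: fps_mult_nth_cong)
qed

lemma LIMSEQ_fps_inverse:
  fixes a :: "nat \<Rightarrow> 'a::field fps"
  assumes a: "a \<longlonglongrightarrow> s" and "fps_nth s 0 \<noteq> 0"
  shows "(\<lambda>N. inverse (a N)) \<longlonglongrightarrow> inverse s"
  unfolding tendsto_fps_iff
proof
  fix n
  have "\<forall>\<^sub>F N in sequentially. \<forall>i\<in>{..n}. fps_nth (a N) i = fps_nth s i"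
    using a by (intro eventually_ball_finite) (auto simp: tendsto_fps_iff)
  then show "\<forall>\<^sub>F N in sequentially. fps_nth (inverse (a N)) n = fps_nth (inverse s) n"
  proof eventually_elim
    case (elim N)
    then have nz: "fps_nth (a N) 0 \<noteq> 0" using assms(2) by auto
    have i: "inverse (a N) * a N = 1" "inverse s * s = 1"
      using nz assms(2) by (simp_all add: inverse_mult_eq_1)
    have "inverse (a N) - inverse s = (s - a N) * (inverse (a N) * inverse s)"
      using i by algebra
    moreover have "fps_nth ((s - a N) * (inverse (a N) * inverse s)) n = 0"
      using elim by (intro fps_mult_nth_zero) auto
    ultimately have "fps_nth (inverse (a N) - inverse s) n = 0" by simp
    then show ?case by simp
  qed
qed

text \<open>The X-adic counterpart of dominated convergence: outside a finite set the factors
  \<open>f x\<close> have no coefficients up to n, whatever the \<open>c N x\<close> are.\<close>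

lemma LIMSEQ_fsum:
  fixes f :: "'i \<Rightarrow> 'a::comm_ring_1 fps"
  assumes f: "locally_finite f A" and c: "\<And>x. x \<in> A \<Longrightarrow> (\<lambda>N. c N x) \<longlonglongrightarrow> d"
  shows "(\<lambda>N. fsum (\<lambda>x. f x * c N x) A) \<longlonglongrightarrow> fsum f A * d"
  unfolding tendsto_fps_iff
proof
  fix n
  obtain B where B: "finite B" "B \<subseteq> A" "\<And>x i. x \<in> A \<Longrightarrow> x \<notin> B \<Longrightarrow> i \<le> n \<Longrightarrow> fps_nth (f x) i = 0"
    "\<And>i. i \<le> n \<Longrightarrow> fps_nth (fsum f A) i = fps_nth (\<Sum>x\<in>B. f x) i"
    using fsum_obtain[OF f, of n] by blast
  have 1: "fps_nth (fsum (\<lambda>x. f x * c N x) A) n = (\<Sum>x\<in>B. fps_nth (f x * c N x) n)" for N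
  proof (rule fsum_nth)
    show "{x \<in> A. fps_nth (f x * c N x) n \<noteq> 0} \<subseteq> B"
      using B(3) fps_mult_nth_zero by blast
  qed (use B in auto)
  have "fps_nth (fsum f A * d) n = fps_nth ((\<Sum>x\<in>B. f x) * d) n"
    using B(4) by (intro fps_mult_nth_cong) auto
  then have 2: "fps_nth (fsum f A * d) n = (\<Sum>x\<in>B. fps_nth (f x * d) n)"
    by (simp add: sum_distrib_right fps_sum_nth)
  have "\<forall>\<^sub>F N in sequentially. \<forall>x\<in>B. fps_nth (f x * c N x) n = fps_nth (f x * d) n"
  proof (intro eventually_ball_finite B ballI)
    fix x assume "x \<in> B"
    then have "(\<lambda>N. f x * c N x) \<longlonglongrightarrow> f x * d"
      using c B(2) by (intro LIMSEQ_fps_mult tendsto_const) auto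
    then show "\<forall>\<^sub>F N in sequentially. fps_nth (f x * c N x) n = fps_nth (f x * d) n"
      by (simp add: tendsto_fps_iff)
  qed
  then show "\<forall>\<^sub>F N in sequentially. fps_nth (fsum (\<lambda>x. f x * c N x) A) n = fps_nth (fsum f A * d) n"
    by eventually_elim (simp add: 1 2)
qed

section \<open>Convergence of the q-Pochhammer products\<close>

lemma qpoch_Suc: "qpoch c d (Suc N) = qpoch c d N * (1 - fps_X ^ (c + d * N))"
  by (simp add: qpoch_def)

lemma qpoch_nth_0: "c > 0 \<Longrightarrow> fps_nth (qpoch c d N) 0 = 1"
  by (induction N) (auto simp: qpoch_def fps_mult_nth)

text \<open>The factor with index N is 1 up to degree c + d N > n as soon as N > n, so the n-th
  coefficient is constant from then on. This also shows that the \<open>lim\<close> in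
  \<open>qpoch_inf\<close> exists.\<close>

lemma qpoch_LIMSEQ:
  assumes "d > 0"
  shows "qpoch c d \<longlonglongrightarrow> qpoch_inf c d"
proof -
  define s where "s = Abs_fps (\<lambda>n. fps_nth (qpoch c d (Suc n)) n)"
  have st: "fps_nth (qpoch c d (Suc n + k)) n = fps_nth s n" for n k
  proof (induction k)
    case 0
    show ?case by (simp add: s_def)
  next
    case (Suc k)
    have "c + d * (Suc n + k) > n" using assms by (cases d) auto
    then have "fps_nth (qpoch c d (Suc n + k) * (1 - fps_X ^ (c + d * (Suc n + k)))) n
        = fps_nth (qpoch c d (Suc n + k) * 1) n"
      by (intro fps_mult_nth_cong) auto
    then show ?case using Suc by (simp add: qpoch_Suc)
  qed
  have "qpoch c d \<longlonglongrightarrow> s"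
    unfolding tendsto_fps_iff
  proof
    fix n
    show "\<forall>\<^sub>F N in sequentially. fps_nth (qpoch c d N) n = fps_nth s n"
      unfolding eventually_sequentially
    proof (intro exI[of _ "Suc n"] allI impI)
      fix N assume "Suc n \<le> N"
      then obtain k where "N = Suc n + k" using le_Suc_ex by blast
      then show "fps_nth (qpoch c d N) n = fps_nth s n" using st by simp
    qed
  qed
  then show ?thesis
    unfolding qpoch_inf_def by (simp add: limI)
qed

lemma qpoch_inf_nth_0:
  assumes "c > 0" "d > 0"
  shows "fps_nth (qpoch_inf c d) 0 = 1"
proof -
  have "\<forall>\<^sub>F N in sequentially. fps_nth (qpoch c d N) 0 = fps_nth (qpoch_inf c d) 0"
    using qpoch_LIMSEQ[OF assms(2)] by (simp add: tendsto_fps_iff)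
  then obtain N where "fps_nth (qpoch c d N) 0 = fps_nth (qpoch_inf c d) 0"
    using eventually_happens'[OF sequentially_bot] by blast
  then show ?thesis using qpoch_nth_0[OF assms(1)] by simp
qed

section \<open>The Jacobi triple product and the A2 Macdonald identity\<close>

definition psign :: "int \<Rightarrow> int" where
  "psign i = (if even i then 1 else - 1)"

lemma psign_add: "psign (i + j) = psign i * psign j"
  by (simp add: psign_def)

context generic_q begin

text \<open>The finite triple product, whose coefficients are central q-binomials. The two factors
  gained with N shift i by at most one, so the induction step is a three-term relation between
  coefficients.\<close>

lemma jacobi_finite:
  fixes z :: 'a
  assumes z: "z \<noteq> 0" and "int N < h"
  shows "poch (2 * N) * (\<Sum>i\<in>{-h..h}. of_int (psign i) * z powi i * q powi (i * (i - 1) div 2)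
      * (ipoch (int N + i) * ipoch (int N - i))) = (\<Prod>j<N. (1 - z * q ^ j) * (1 - q ^ Suc j / z))"
  using assms(2)
proof (induction N)
  case 0
  have "(\<Sum>i\<in>{-h..h}. of_int (psign i) * z powi i * q powi (i * (i - 1) div 2) * (ipoch (0 + i) * ipoch (0 - i)))
    = (\<Sum>i\<in>{-h..h}. if i = 0 then 1 else 0)"
  proof (rule sum.cong[OF refl])
    fix i
    show "of_int (psign i) * z powi i * q powi (i * (i - 1) div 2) * (ipoch (0 + i) * ipoch (0 - i)) = (if i = 0 then 1 else 0)"
      by (cases "i < 0"; cases "i = 0") (auto simp: ipoch_neg psign_def)
  qed
  then show ?case using 0 by simp
next
  case (Suc N)
  define F where "F = (\<lambda>i. of_int (psign i) * z powi i * q powi (i * (i - 1) div 2) * (ipoch (int N + i) * ipoch (int N - i)))"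
  define G where "G = (\<lambda>i. of_int (psign i) * z powi i * q powi (i * (i - 1) div 2) * (ipoch (int (Suc N) + i) * ipoch (int (Suc N) - i)))"
  have S1: "(\<Sum>i\<in>{-h..h}. F (i - 1)) = (\<Sum>i\<in>{-h..h}. F i)"
    using sum_int_shift[of F "- h" h] Suc.prems by (simp add: F_def ipoch_neg)
  have S2: "(\<Sum>i\<in>{-h..h}. F (i + 1) / z) = (\<Sum>i\<in>{-h..h}. F i) / z"
    using sum_int_shift[of "\<lambda>i. F (i + 1)" "- h" h] Suc.prems unfolding sum_divide_distrib[symmetric]
    by (simp add: F_def ipoch_neg)
  \<comment> \<open>The right side collects the terms in z^i of the old sum times (1 - z q^N) (1 -
    q^(N + 1) / z).\<close>
  have key: "(1 - q ^ Suc (2 * N)) * (1 - q ^ Suc (Suc (2 * N))) * G i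
     = (1 + q ^ Suc (2 * N)) * F i - q ^ N * (z * F (i - 1)) - q ^ Suc N * (F (i + 1) / z)" for i
  proof -
    define A B where "A = q powi (int N + 1 + i)" and "B = q powi (int N + 1 - i)"
    define g where "g = of_int (psign i) * z powi i * q powi (i * (i - 1) div 2) * (ipoch (int N + 1 + i) * ipoch (int N + 1 - i))"
    have G: "G i = g" by (simp add: G_def g_def algebra_simps)
    have AB: "A * B = q * q ^ Suc (2 * N)"
      using powi_add[of "int N + 1 + i" "int N + 1 - i"] power_int_of_nat[of q "2 * N + 2"]
      by (simp add: A_def B_def add.commute)
    have F0: "F i = (1 - A) * (1 - B) * g"
    proof -
      have "ipoch (int N + i) = (1 - A) * ipoch (int N + 1 + i)" "ipoch (int N - i) = (1 - B) * ipoch (int N + 1 - i)"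
        using ipoch_minus_1[of "int N + 1 + i"] ipoch_minus_1[of "int N + 1 - i"]
        by (simp_all add: A_def B_def algebra_simps)
      then show ?thesis unfolding F_def g_def by algebra
    qed
    have F1: "q ^ N * (z * F (i - 1)) = - (B * (1 - A / q) * (1 - A) * g)"
    proof -
      have c: "q powi (i * (i - 1) div 2) = q powi ((i - 1) * (i - 1 - 1) div 2) * q powi (i - 1)"
        by (subst choose2_int) (simp add: powi_add)
      have b: "B * q powi (i - 1) = q ^ N"
        using powi_add[of "int N + 1 - i" "i - 1"] by (simp add: B_def)
      have zz: "z * z powi (i - 1) = z powi i"
        using z power_int_add[of z 1 "i - 1"] by simp
      have s: "psign (i - 1) = - psign i" by (simp add: psign_def)
      have aq: "q powi (int N + i) = A / q"
        using powi_diff[of "int N + 1 + i" 1] by (simp add: A_def)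
      have i1: "ipoch (int N + (i - 1)) = (1 - A / q) * (1 - A) * ipoch (int N + 1 + i)"
      proof -
        have s: "int N + 1 + i - 1 = int N + i" "int N + (i - 1) = int N + i - 1" by simp_all
        show ?thesis using ipoch_minus_1[of "int N + 1 + i"] ipoch_minus_1[of "int N + i"]
          unfolding s aq A_def[symmetric] by (simp only: mult.assoc)
      qed
      have i2: "ipoch (int N - (i - 1)) = ipoch (int N + 1 - i)" by (simp add: algebra_simps)
      have "q ^ N * (z * F (i - 1)) = - (of_int (psign i) * (z * z powi (i - 1)) * (B * q powi (i - 1)) * q powi ((i - 1) * (i - 1 - 1) div 2)
         * ((1 - A / q) * (1 - A) * ipoch (int N + 1 + i) * ipoch (int N + 1 - i)))"
        unfolding F_def s i1 i2 b by (simp add: mult_ac)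
      then show ?thesis unfolding g_def c zz by (simp only: mult_ac)
    qed
    have F2: "q ^ Suc N * (F (i + 1) / z) = - (A * (1 - B) * (1 - B / q) * g)"
    proof -
      have c: "q powi ((i + 1) * (i + 1 - 1) div 2) = q powi (i * (i - 1) div 2) * q powi i"
        by (subst choose2_int) (simp add: powi_add)
      have a: "q ^ Suc N * q powi i = A"
        by (simp add: A_def powi_add)
      have zz: "z powi (i + 1) / z = z powi i"
        using z by (simp add: power_int_add)
      have s: "psign (i + 1) = - psign i" by (simp add: psign_def)
      have bq: "q powi (int N - i) = B / q"
        using powi_diff[of "int N + 1 - i" 1] by (simp add: B_def)
      have i1: "ipoch (int N - (i + 1)) = (1 - B / q) * (1 - B) * ipoch (int N + 1 - i)"
      proof -
        have s: "int N + 1 - i - 1 = int N - i" "int N - (i + 1) = int N - i - 1" by simp_all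
        show ?thesis using ipoch_minus_1[of "int N + 1 - i"] ipoch_minus_1[of "int N - i"]
          unfolding s bq B_def[symmetric] by (simp only: mult.assoc)
      qed
      have i2: "ipoch (int N + (i + 1)) = ipoch (int N + 1 + i)" by (simp add: algebra_simps)
      have "q ^ Suc N * (F (i + 1) / z) = - (of_int (psign i) * (z powi (i + 1) / z) * (q ^ Suc N * q powi i) * q powi (i * (i - 1) div 2)
         * ((1 - B / q) * (1 - B) * ipoch (int N + 1 + i) * ipoch (int N + 1 - i)))"
        unfolding F_def s i1 i2 c by (simp add: mult_ac)
      then show ?thesis unfolding g_def zz a by (simp only: mult_ac)
    qed
    define p where "p = q ^ Suc (2 * N)"
    have p: "q ^ Suc (Suc (2 * N)) = A * B" "p = A * B / q"
      using AB by (simp_all add: p_def)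
    have "(1 - A * B / q) * (1 - A * B) * g = (1 + A * B / q) * ((1 - A) * (1 - B) * g)
        + B * (1 - A / q) * (1 - A) * g + A * (1 - B) * (1 - B / q) * g"
      by (simp add: field_simps)
    then show ?thesis
      unfolding G F0 F1 F2 p_def[symmetric] p by simp
  qed
  have "poch (2 * Suc N) * (\<Sum>i\<in>{-h..h}. G i)
     = poch (2 * N) * (\<Sum>i\<in>{-h..h}. (1 - q ^ Suc (2 * N)) * (1 - q ^ Suc (Suc (2 * N))) * G i)"
  proof -
    have e: "2 * Suc N = Suc (Suc (2 * N))" by simp
    show ?thesis
      unfolding e poch_Suc sum_distrib_left[symmetric] by (simp only: mult_ac)
  qed
  also have "\<dots> = poch (2 * N) * ((1 + q ^ Suc (2 * N)) * (\<Sum>i\<in>{-h..h}. F i)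
      - q ^ N * (z * (\<Sum>i\<in>{-h..h}. F i)) - q ^ Suc N * ((\<Sum>i\<in>{-h..h}. F i) / z))"
    unfolding key sum_subtractf sum_distrib_left[symmetric] S1 S2 ..
  also have "\<dots> = ((1 - z * q ^ N) * (1 - q ^ Suc N / z)) * (poch (2 * N) * (\<Sum>i\<in>{-h..h}. F i))"
  proof -
    define p where "p = q ^ N"
    have p: "q ^ Suc (2 * N) = q * p * p" "q ^ Suc N = q * p"
      by (simp_all add: p_def power_add[symmetric] mult_2)
    show ?thesis unfolding p p_def[symmetric] using z by (simp add: field_simps)
  qed
  also have "poch (2 * N) * (\<Sum>i\<in>{-h..h}. F i) = (\<Prod>j<N. (1 - z * q ^ j) * (1 - q ^ Suc j / z))"
    using Suc unfolding F_def by simp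
  finally show ?case by (simp add: G_def mult.commute)
qed

end

section \<open>Transfer between formal power series and Laurent series\<close>

lemma generic_q_fls_X: "generic_q (fls_X :: real fls)"
proof
  fix n :: nat assume "n > 0"
  show "fls_X ^ n \<noteq> (1 :: real fls)"
  proof
    assume "fls_X ^ n = (1 :: real fls)"
    then have "fls_subdegree ((fls_X :: real fls) ^ n) = fls_subdegree (1 :: real fls)" by simp
    then show False using \<open>n > 0\<close> by (simp add: fls_subdegree_pow)
  qed
qed simp

lemma fps_to_fls_times: "fps_to_fls (f * g) = fps_to_fls f * fps_to_fls (g :: real fps)"
  by (simp add: fls_times_fps_to_fls)

lemma fps_to_fls_prod: "fps_to_fls (\<Prod>x\<in>A. f x) = (\<Prod>x\<in>A. fps_to_fls (f x :: real fps))"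
  by (induction A rule: infinite_finite_induct) (auto simp: fps_to_fls_times)

lemma fps_to_fls_sum: "fps_to_fls (\<Sum>x\<in>A. f x) = (\<Sum>x\<in>A. fps_to_fls (f x :: real fps))"
  by (induction A rule: infinite_finite_induct) auto

lemma fps_to_fls_inverse: "fps_nth f 0 \<noteq> 0 \<Longrightarrow> fps_to_fls (inverse f) = inverse (fps_to_fls (f :: real fps))"
  by (simp add: fls_inverse_fps_to_fls)

lemma fps_to_fls_X_power: "fps_to_fls (fps_X ^ n :: real fps) = fls_X powi int n"
  by (simp add: fps_to_fls_power)

definition inv_qpoch :: "nat \<Rightarrow> int \<Rightarrow> real fps" where
  "inv_qpoch K n = (if n < 0 then 0 else inverse (qpoch K K (nat n)))"

lemma fps_to_fls_qpoch:
  assumes "K > 0"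
  shows "fps_to_fls (qpoch K K n) = generic_q.poch (fls_X ^ K) n"
proof -
  interpret q: generic_q "fls_X ^ K :: real fls"
    using generic_q.generic_q_power[OF generic_q_fls_X assms] .
  show ?thesis
    unfolding qpoch_def q.poch_def fps_to_fls_prod
    by (intro prod.cong refl) (simp add: fps_to_fls_power power_add power_mult fps_to_fls_times)
qed

lemma fps_to_fls_inv_qpoch:
  assumes "K > 0"
  shows "fps_to_fls (inv_qpoch K n) = generic_q.ipoch (fls_X ^ K) n"
proof -
  interpret q: generic_q "fls_X ^ K :: real fls"
    using generic_q.generic_q_power[OF generic_q_fls_X assms] .
  show ?thesis
    using assms by (simp add: inv_qpoch_def q.ipoch_def fps_to_fls_inverse qpoch_nth_0 fps_to_fls_qpoch)
qed

lemma LIMSEQ_int_shift: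
  fixes f :: "nat \<Rightarrow> 'a::topological_space"
  assumes "f \<longlonglongrightarrow> s"
  shows "(\<lambda>N. f (nat (int N + c))) \<longlonglongrightarrow> s"
proof (rule filterlim_compose[OF assms])
  show "filterlim (\<lambda>N. nat (int N + c)) sequentially sequentially"
    unfolding filterlim_at_top eventually_sequentially
  proof
    fix Z
    show "\<exists>N. \<forall>n\<ge>N. Z \<le> nat (int n + c)"
      by (rule exI[of _ "Z + nat \<bar>c\<bar>"]) auto
  qed
qed

lemma inv_qpoch_LIMSEQ:
  assumes "K > 0"
  shows "(\<lambda>N. inv_qpoch K (int N + c)) \<longlonglongrightarrow> inverse (qpoch_inf K K)"
proof -
  have "(\<lambda>N. inverse (qpoch K K (nat (int N + c)))) \<longlonglongrightarrow> inverse (qpoch_inf K K)"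
    using LIMSEQ_int_shift[OF qpoch_LIMSEQ[OF assms]] assms
    by (intro LIMSEQ_fps_inverse) (auto simp: qpoch_inf_nth_0)
  moreover have "\<forall>\<^sub>F N in sequentially. inverse (qpoch K K (nat (int N + c))) = inv_qpoch K (int N + c)"
    unfolding eventually_sequentially by (rule exI[of _ "nat \<bar>c\<bar>"]) (auto simp: inv_qpoch_def)
  ultimately show ?thesis by (rule Lim_transform_eventually)
qed

definition jac_exp :: "nat \<Rightarrow> nat \<Rightarrow> int \<Rightarrow> int" where
  "jac_exp K c i = int K * (i * (i - 1) div 2) + int c * i"

lemma two_jac_exp: "2 * jac_exp K c i = int K * (i * (i - 1)) + 2 * int c * i"
proof -
  have "2 * (i * (i - 1) div 2) = i * (i - 1)" by simp
  moreover have "2 * jac_exp K c i = int K * (2 * (i * (i - 1) div 2)) + 2 * int c * i"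
    unfolding jac_exp_def by (simp only: distrib_left mult_ac)
  ultimately show ?thesis by simp
qed

text \<open>Twice the exponent is c i (i + 1) + (K - c) i (i - 1), with nonnegative products and
  both coefficients at least 1. This makes \<open>nat\<close> exact in \<open>jac_term\<close> and
  the series locally finite.\<close>

lemma jac_exp_ge:
  assumes "0 < c" "c < K"
  shows "jac_exp K c i \<ge> \<bar>i\<bar>"
proof -
  have p: "i * (i + 1) \<ge> 0" "i * (i - 1) \<ge> 0"
    by (cases "i \<ge> 0"; auto simp: zero_le_mult_iff)+
  have "2 * jac_exp K c i = int c * (i * (i + 1)) + int (K - c) * (i * (i - 1))"
    using assms unfolding two_jac_exp by (simp add: of_nat_diff algebra_simps)
  also have "\<dots> \<ge> 1 * (i * (i + 1)) + 1 * (i * (i - 1))"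
    using assms p by (intro add_mono mult_right_mono) auto
  finally have "jac_exp K c i \<ge> i * i" by (simp add: algebra_simps)
  moreover have "i * i \<ge> \<bar>i\<bar>"
    using mult_left_mono[of 1 "\<bar>i\<bar>" "\<bar>i\<bar>"] by (cases "i = 0") auto
  ultimately show ?thesis by linarith
qed

definition jac_term :: "nat \<Rightarrow> nat \<Rightarrow> int \<Rightarrow> real fps" where
  "jac_term K c i = of_int (psign i) * fps_X ^ nat (jac_exp K c i)"

lemma fps_X_power_mult_nth_zero: "i < e \<Longrightarrow> fps_nth (of_int c * fps_X ^ e :: real fps) i = 0"
  by (simp add: fps_X_power_mult_right_nth)

lemma locally_finite_jac_term:
  assumes "0 < c" "c < K"
  shows "locally_finite (jac_term K c) UNIV"
proof (rule locally_finiteI[where e = "\<lambda>i. nat (jac_exp K c i)"])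
  fix n
  have "{x \<in> UNIV. nat (jac_exp K c x) \<le> n} \<subseteq> {- int n..int n}"
  proof
    fix i assume "i \<in> {x \<in> UNIV. nat (jac_exp K c x) \<le> n}"
    then show "i \<in> {- int n..int n}" using jac_exp_ge[OF assms, of i] by (auto simp: nat_le_iff)
  qed
  then show "finite {x \<in> UNIV. nat (jac_exp K c x) \<le> n}" using finite_subset by blast
qed (simp add: jac_term_def fps_X_power_mult_nth_zero)

text \<open>\<open>jacobi_finite\<close> at base q^K and z = q^c, as N tends to infinity: each
  central coefficient \<open>C N i\<close> tends to the reciprocal of
  \<open>qpoch_inf K K\<close>.\<close>

theorem jacobi_triple_product:
  assumes "0 < c" "c < K"
  shows "fsum (jac_term K c) UNIV = qpoch_inf K K * qtheta c K"
proof -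
  have K: "K > 0" using assms by simp
  interpret q: generic_q "fls_X ^ K :: real fls"
    using generic_q.generic_q_power[OF generic_q_fls_X K] .
  interpret x: generic_q "fls_X :: real fls" by (rule generic_q_fls_X)
  define C where "C = (\<lambda>N i. qpoch K K (2 * N) * (inv_qpoch K (int N + i) * inv_qpoch K (int N - i)))"
  have fin: "fsum (\<lambda>i. jac_term K c i * C N i) UNIV = qpoch c K N * qpoch (K - c) K N" for N
  proof -
    define h where "h = int N + 1"
    have z: "C N i = 0" if "i \<notin> {-h..h}" for i
      using that by (auto simp: C_def inv_qpoch_def h_def)
    have "fsum (\<lambda>i. jac_term K c i * C N i) UNIV = (\<Sum>i\<in>{-h..h}. jac_term K c i * C N i)"
    proof (rule fps_ext)
      fix n
      show "fps_nth (fsum (\<lambda>i. jac_term K c i * C N i) UNIV) n = fps_nth (\<Sum>i\<in>{-h..h}. jac_term K c i * C N i) n"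
        unfolding fps_sum_nth
      proof (rule fsum_nth)
        show "{x \<in> UNIV. fps_nth (jac_term K c x * C N x) n \<noteq> 0} \<subseteq> {-h..h}"
        proof
          fix i assume i: "i \<in> {x \<in> UNIV. fps_nth (jac_term K c x * C N x) n \<noteq> 0}"
          show "i \<in> {-h..h}"
          proof (rule ccontr)
            assume "i \<notin> {-h..h}"
            then show False using z[of i] i by simp
          qed
        qed
      qed auto
    qed
    also have "\<dots> = qpoch c K N * qpoch (K - c) K N"
    proof -
      have t: "fps_to_fls (jac_term K c i) = of_int (psign i) * (fls_X ^ c) powi i * (fls_X ^ K) powi (i * (i - 1) div 2)" for i
      proof -
        have "jac_exp K c i \<ge> 0" using jac_exp_ge[OF assms, of i] by linarith
        then have "fps_to_fls (jac_term K c i) = of_int (psign i) * fls_X powi (jac_exp K c i)"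
          by (simp add: jac_term_def fps_to_fls_times fps_to_fls_X_power del: power_int_of_nat)
        also have "fls_X powi (jac_exp K c i) = (fls_X ^ K :: real fls) powi (i * (i - 1) div 2) * (fls_X ^ c) powi i"
          unfolding jac_exp_def x.powi_add power_int_mult by simp
        finally show ?thesis by (simp add: mult_ac)
      qed
      have "fps_to_fls (\<Sum>i\<in>{-h..h}. jac_term K c i * C N i) = q.poch (2 * N) * (\<Sum>i\<in>{-h..h}. of_int (psign i) * (fls_X ^ c) powi i
          * (fls_X ^ K) powi (i * (i - 1) div 2) * (q.ipoch (int N + i) * q.ipoch (int N - i)))"
        unfolding fps_to_fls_sum fps_to_fls_times t C_def fps_to_fls_inv_qpoch[OF K] fps_to_fls_qpoch[OF K] sum_distrib_left
        by (simp only: mult_ac)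
      also have "\<dots> = (\<Prod>j<N. (1 - fls_X ^ c * (fls_X ^ K) ^ j) * (1 - (fls_X ^ K) ^ Suc j / fls_X ^ c))"
        by (rule q.jacobi_finite) (auto simp: h_def)
      also have "\<dots> = fps_to_fls (qpoch c K N * qpoch (K - c) K N)"
        unfolding qpoch_def prod.distrib[symmetric] fps_to_fls_prod
      proof (intro prod.cong refl)
        fix j
        have "(fls_X ^ K) ^ Suc j / fls_X ^ c = (fls_X :: real fls) ^ (K - c + K * j)"
        proof -
          have "K * Suc j = (K - c + K * j) + c" using assms by simp
          then have "(fls_X ^ K) ^ Suc j = (fls_X :: real fls) ^ (K - c + K * j) * fls_X ^ c"
            by (simp only: power_add[symmetric] power_mult[symmetric])
          moreover have nz: "(fls_X :: real fls) ^ c \<noteq> 0" by simp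
          ultimately show ?thesis by (simp only: nonzero_divide_eq_eq[OF nz])
        qed
        then show "(1 - fls_X ^ c * (fls_X ^ K) ^ j) * (1 - (fls_X ^ K) ^ Suc j / fls_X ^ c)
          = fps_to_fls ((1 - fps_X ^ (c + K * j)) * (1 - fps_X ^ (K - c + K * j)) :: real fps)"
          by (simp add: fps_to_fls_times fps_to_fls_power power_add power_mult)
      qed
      finally show ?thesis by simp
    qed
    finally show ?thesis .
  qed
  have "(\<lambda>N. C N i) \<longlonglongrightarrow> qpoch_inf K K * (inverse (qpoch_inf K K) * inverse (qpoch_inf K K))" for i
    unfolding C_def
  proof (intro LIMSEQ_fps_mult)
    show "(\<lambda>N. qpoch K K (2 * N)) \<longlonglongrightarrow> qpoch_inf K K"
      using filterlim_compose[OF qpoch_LIMSEQ[OF K] mult_nat_left_at_top[of 2]] by simp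
    show "(\<lambda>N. inv_qpoch K (int N + i)) \<longlonglongrightarrow> inverse (qpoch_inf K K)" by (rule inv_qpoch_LIMSEQ[OF K])
    show "(\<lambda>N. inv_qpoch K (int N - i)) \<longlonglongrightarrow> inverse (qpoch_inf K K)" using inv_qpoch_LIMSEQ[OF K, of "- i"] by simp
  qed
  then have "(\<lambda>N. fsum (\<lambda>i. jac_term K c i * C N i) UNIV)
     \<longlonglongrightarrow> fsum (jac_term K c) UNIV * (qpoch_inf K K * (inverse (qpoch_inf K K) * inverse (qpoch_inf K K)))"
    by (intro LIMSEQ_fsum locally_finite_jac_term assms)
  moreover have "(\<lambda>N. qpoch c K N * qpoch (K - c) K N) \<longlonglongrightarrow> qtheta c K"
    unfolding qtheta_def by (intro LIMSEQ_fps_mult qpoch_LIMSEQ K)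
  ultimately have lim: "fsum (jac_term K c) UNIV * (qpoch_inf K K * (inverse (qpoch_inf K K) * inverse (qpoch_inf K K))) = qtheta c K"
    unfolding fin using LIMSEQ_unique by blast
  have i: "inverse (qpoch_inf K K) * qpoch_inf K K = 1"
    using K by (intro inverse_mult_eq_1) (simp add: qpoch_inf_nth_0)
  show ?thesis
    unfolding lim[symmetric] using i by algebra
qed

lemma qpoch_inf_dissect:
  assumes "K > 0"
  shows "qpoch_inf K K = qpoch_inf (3 * K) (3 * K) * (qpoch_inf K (3 * K) * qpoch_inf (2 * K) (3 * K))"
proof -
  have "qpoch K K (3 * N) = qpoch (3 * K) (3 * K) N * (qpoch K (3 * K) N * qpoch (2 * K) (3 * K) N)" for N
  proof (induction N)
    case 0
    show ?case by (simp add: qpoch_def)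
  next
    case (Suc N)
    have e: "3 * Suc N = Suc (Suc (Suc (3 * N)))" by simp
    have x: "K + K * (3 * N) = K + 3 * K * N" "K + K * Suc (3 * N) = 2 * K + 3 * K * N"
      "K + K * Suc (Suc (3 * N)) = 3 * K + 3 * K * N" by (simp_all add: algebra_simps)
    show ?case unfolding e qpoch_Suc x Suc by (simp only: mult_ac)
  qed
  moreover have "(\<lambda>N. qpoch K K (3 * N)) \<longlonglongrightarrow> qpoch_inf K K"
    using filterlim_compose[OF qpoch_LIMSEQ[OF assms] mult_nat_left_at_top[of 3]] by simp
  moreover have "(\<lambda>N. qpoch (3 * K) (3 * K) N * (qpoch K (3 * K) N * qpoch (2 * K) (3 * K) N))
    \<longlonglongrightarrow> qpoch_inf (3 * K) (3 * K) * (qpoch_inf K (3 * K) * qpoch_inf (2 * K) (3 * K))"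
    using assms by (intro LIMSEQ_fps_mult qpoch_LIMSEQ) auto
  ultimately show ?thesis using LIMSEQ_unique by simp
qed

text \<open>The triple product at period 3 K, where the three residue classes of
  \<open>qpoch_inf_dissect\<close> recombine: Euler's pentagonal number theorem in q^K.\<close>

lemma pentagonal:
  assumes "K > 0"
  shows "fsum (jac_term (3 * K) K) UNIV = qpoch_inf K K" "fsum (jac_term (3 * K) (2 * K)) UNIV = qpoch_inf K K"
proof -
  have d: "3 * K - K = 2 * K" "3 * K - 2 * K = K" by simp_all
  show "fsum (jac_term (3 * K) K) UNIV = qpoch_inf K K"
    using jacobi_triple_product[of K "3 * K"] assms qpoch_inf_dissect[OF assms] by (simp add: qtheta_def d)
  show "fsum (jac_term (3 * K) (2 * K)) UNIV = qpoch_inf K K"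
    using jacobi_triple_product[of "2 * K" "3 * K"] assms qpoch_inf_dissect[OF assms] by (simp add: qtheta_def d mult_ac)
qed

section \<open>The A2 lattice sum as a product of three theta functions\<close>

definition mac_exp :: "nat \<Rightarrow> nat \<Rightarrow> nat \<Rightarrow> int \<Rightarrow> int \<Rightarrow> int" where
  "mac_exp K A B v u = int K * ((A2_norm v u - 1) div 3) + int B * (1 - v) + int A * (1 + u)"

definition mac_term :: "nat \<Rightarrow> nat \<Rightarrow> nat \<Rightarrow> int \<Rightarrow> int \<Rightarrow> real fps" where
  "mac_term K A B v u = of_int (chi3 (v - u)) * fps_X ^ nat (mac_exp K A B v u)"

text \<open>With i = x - k and j = y - k one has A i + B j + (A + B) k = A x + B y, so the
  parameters separate from k, and the sum over k involves only q^K.\<close>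

lemma jac_exp_triple:
  "jac_exp K A (x - k) + jac_exp K B (y - k) + jac_exp K (A + B) k
    = int K * (x * (x - 1) div 2 + y * (y - 1) div 2 + 3 * (k * (k - 1) div 2) + (2 - (x + y)) * k)
      + int A * x + int B * y"
proof -
  have T: "2 * (s * (s - 1) div 2) = s * (s - 1)" for s :: int by simp
  have "2 * (jac_exp K A (x - k) + jac_exp K B (y - k) + jac_exp K (A + B) k)
    = int K * (2 * (x * (x - 1) div 2) + 2 * (y * (y - 1) div 2) + 3 * (2 * (k * (k - 1) div 2)) + 2 * ((2 - (x + y)) * k))
      + 2 * (int A * x + int B * y)"
    unfolding distrib_left two_jac_exp T by (simp add: algebra_simps)
  also have "\<dots> = 2 * (int K * (x * (x - 1) div 2 + y * (y - 1) div 2 + 3 * (k * (k - 1) div 2) + (2 - (x + y)) * k)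
      + int A * x + int B * y)"
    by (simp only: distrib_left add.assoc mult.left_commute mult.commute)
  finally show ?thesis by simp
qed

text \<open>For fixed x and y the exponent is quadratic in k with vertex at distance 1/6 from j. Its
  minimum over the integers is thus at k = j, and there it equals the Macdonald exponent.\<close>

lemma mac_exp_eq_jac_exp:
  assumes "x + y = 3 * j + e" "e = 0 \<or> e = 1"
  shows "mac_exp K A B (1 - y) (x - 1) = jac_exp K A (x - j) + jac_exp K B (y - j) + jac_exp K (A + B) j"
proof -
  have T: "2 * (s * (s - 1) div 2) = s * (s - 1)" for s :: int by simp
  have y: "y = 3 * j + e - x" using assms by simp
  define S where "S = x * (x - 1) div 2 + y * (y - 1) div 2 + 3 * (j * (j - 1) div 2) + (2 - (x + y)) * j"
  have S: "2 * S = x * (x - 1) + y * (y - 1) + 3 * (j * (j - 1)) + 2 * ((2 - (x + y)) * j)"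
    unfolding S_def distrib_left T mult.left_commute[of 2 3] by simp
  have "2 * (A2_norm (1 - y) (x - 1) - 1) = 2 * (3 * S)"
    unfolding mult.left_commute[of 2 3] S using assms(2) unfolding y
    by (auto simp: A2_norm_def power2_eq_square algebra_simps)
  then have "A2_norm (1 - y) (x - 1) - 1 = 3 * S" by simp
  then have "(A2_norm (1 - y) (x - 1) - 1) div 3 = S" by simp
  then show ?thesis
    unfolding mac_exp_def jac_exp_triple S_def by simp
qed

text \<open>As v - u = 2 - (x + y), a nonzero \<open>chi3\<close> means that x + y is not 2 modulo
  3. The decomposition transfers the bounds of \<open>jac_exp_ge\<close> to the lattice
  exponent.\<close>

lemma mac_exp_decomp:
  assumes "chi3 (v - u) \<noteq> 0"
  obtains i j k where "u + 1 = i + k" "1 - v = j + k" "mac_exp K A B v u = jac_exp K A i + jac_exp K B j + jac_exp K (A + B) k"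
proof -
  define x y where "x = u + 1" and "y = 1 - v"
  have "(v - u) mod 3 \<noteq> 0" using assms by (auto simp: chi3_def)
  then have "\<exists>j e. x + y = 3 * j + e \<and> (e = 0 \<or> e = 1)"
    unfolding x_def y_def by presburger
  then obtain j e where je: "x + y = 3 * j + e" "e = 0 \<or> e = 1" by blast
  have "mac_exp K A B (1 - y) (x - 1) = jac_exp K A (x - j) + jac_exp K B (y - j) + jac_exp K (A + B) j"
    by (rule mac_exp_eq_jac_exp[OF je])
  then show ?thesis
    using that[of "x - j" j "y - j"] by (simp add: x_def y_def)
qed

lemma mac_exp_ge:
  assumes "chi3 (v - u) \<noteq> 0" "0 < A" "0 < B" "A + B < K"
  shows "\<bar>v\<bar> \<le> mac_exp K A B v u + 1" "\<bar>u\<bar> \<le> mac_exp K A B v u + 1"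
proof -
  obtain i j k where h: "u + 1 = i + k" "1 - v = j + k" "mac_exp K A B v u = jac_exp K A i + jac_exp K B j + jac_exp K (A + B) k"
    using mac_exp_decomp[OF assms(1)] .
  have "jac_exp K A i \<ge> \<bar>i\<bar>" "jac_exp K B j \<ge> \<bar>j\<bar>" "jac_exp K (A + B) k \<ge> \<bar>k\<bar>"
    using assms by (auto intro!: jac_exp_ge)
  then show "\<bar>v\<bar> \<le> mac_exp K A B v u + 1" "\<bar>u\<bar> \<le> mac_exp K A B v u + 1" using h by linarith+
qed

lemma mac_exp_nonneg:
  assumes "chi3 (v - u) \<noteq> 0" "0 < A" "0 < B" "A + B < K"
  shows "mac_exp K A B v u \<ge> 0"
proof -
  obtain i j k where h: "u + 1 = i + k" "1 - v = j + k" "mac_exp K A B v u = jac_exp K A i + jac_exp K B j + jac_exp K (A + B) k"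
    using mac_exp_decomp[OF assms(1)] .
  have "jac_exp K A i \<ge> \<bar>i\<bar>" "jac_exp K B j \<ge> \<bar>j\<bar>" "jac_exp K (A + B) k \<ge> \<bar>k\<bar>"
    using assms by (auto intro!: jac_exp_ge)
  then show ?thesis using h by linarith
qed

lemma locally_finite_mac_term:
  assumes "0 < A" "0 < B" "A + B < K"
  shows "locally_finite (\<lambda>(v, u). mac_term K A B v u) UNIV"
  unfolding locally_finite_def
proof
  fix n
  have "{p \<in> UNIV. \<exists>i\<le>n. fps_nth (case p of (v, u) \<Rightarrow> mac_term K A B v u) i \<noteq> 0}
    \<subseteq> {- int n - 1..int n + 1} \<times> {- int n - 1..int n + 1}"
  proof
    fix p assume "p \<in> {p \<in> UNIV. \<exists>i\<le>n. fps_nth (case p of (v, u) \<Rightarrow> mac_term K A B v u) i \<noteq> 0}"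
    moreover obtain v u where "p = (v, u)" by (cases p)
    ultimately obtain i where p: "p = (v, u)" "i \<le> n" "fps_nth (mac_term K A B v u) i \<noteq> 0" by auto
    then have chi3: "chi3 (v - u) \<noteq> 0" by (auto simp: mac_term_def)
    have "\<not> i < nat (mac_exp K A B v u)"
      using p(3) fps_X_power_mult_nth_zero unfolding mac_term_def by blast
    then have "mac_exp K A B v u \<le> int n" using p(2) by linarith
    then show "p \<in> {- int n - 1..int n + 1} \<times> {- int n - 1..int n + 1}"
      using mac_exp_ge[OF chi3 assms] p(1) by auto
  qed
  then show "finite {p \<in> UNIV. \<exists>i\<le>n. fps_nth (case p of (v, u) \<Rightarrow> mac_term K A B v u) i \<noteq> 0}"
    using finite_subset by blast
qed

lemma jac_term_triple:
  assumes "0 < A" "0 < B" "A + B < K"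
  shows "jac_term K A i * jac_term K B j * jac_term K (A + B) k
    = of_int (psign (i + j + k)) * fps_X ^ nat (jac_exp K A i + jac_exp K B j + jac_exp K (A + B) k)"
proof -
  have p: "jac_exp K A i \<ge> 0" "jac_exp K B j \<ge> 0" "jac_exp K (A + B) k \<ge> 0"
    using jac_exp_ge[of A K i] jac_exp_ge[of B K j] jac_exp_ge[of "A + B" K k] assms by linarith+
  then have "nat (jac_exp K A i + jac_exp K B j + jac_exp K (A + B) k) = nat (jac_exp K A i) + nat (jac_exp K B j) + nat (jac_exp K (A + B) k)"
    by (simp add: nat_add_distrib)
  then show ?thesis
    unfolding jac_term_def psign_add by (simp only: power_add of_int_mult mult_ac)
qed

text \<open>The sum over k depends on x + y modulo 3: for residues 0 and 1 it is a pentagonal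
  series, for residue 2 it cancels in pairs, exactly where \<open>chi3\<close> is 0.\<close>

lemma inner_theta_sum:
  assumes AB: "0 < A" "0 < B" "A + B < K"
  shows "fsum (\<lambda>k. jac_term K A (x - k) * jac_term K B (y - k) * jac_term K (A + B) k) UNIV
    = qpoch_inf K K * mac_term K A B (1 - y) (x - 1)"
proof -
  have K: "K > 0" using AB by simp
  let ?e = "\<lambda>k. jac_exp K A (x - k) + jac_exp K B (y - k) + jac_exp K (A + B) k"
  let ?f = "\<lambda>k. jac_term K A (x - k) * jac_term K B (y - k) * jac_term K (A + B) k"
  have f: "?f k = of_int (psign (x + y + k)) * fps_X ^ nat (?e k)" for k
  proof -
    have "psign (x - k + (y - k) + k) = psign (x + y + k)" by (simp add: psign_def)
    then show ?thesis unfolding jac_term_triple[OF AB] by simp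
  qed
  have T: "2 * (s * (s - 1) div 2) = s * (s - 1)" for s :: int by simp
  have "\<exists>j e. x + y = 3 * j + e \<and> (e = 0 \<or> e = 1 \<or> e = 2)" by presburger
  then obtain j e where je: "x + y = 3 * j + e" "e = 0 \<or> e = 1 \<or> e = 2" by blast
  show ?thesis
  proof (cases "e = 2")
    case True
    \<comment> \<open>For x + y = 3 j + 2 the k-dependent exponent is (3/2) k (k - 1 - 2 j),
      symmetric under this reflection, while the parity of k changes.\<close>
    have inv: "?f (2 * j + 1 - k) = - ?f k" for k
    proof -
      define k' where "k' = 2 * j + 1 - k"
      have "2 * (3 * (k' * (k' - 1) div 2) + (2 - (x + y)) * k') = 2 * (3 * (k * (k - 1) div 2) + (2 - (x + y)) * k)"
        unfolding distrib_left mult.left_commute[of 2 3] T je(1) True k'_def by (simp add: algebra_simps)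
      then have "3 * (k' * (k' - 1) div 2) + (2 - (x + y)) * k' = 3 * (k * (k - 1) div 2) + (2 - (x + y)) * k" by simp
      then have "?e k' = ?e k"
        unfolding jac_exp_triple by (simp only: add.assoc)
      moreover have "psign (x + y + k') = - psign (x + y + k)"
        by (simp add: psign_def k'_def)
      ultimately show ?thesis unfolding f k'_def[symmetric] by simp
    qed
    have bij: "bij_betw (\<lambda>k. 2 * j + 1 - k) UNIV (UNIV :: int set)"
      by (rule bij_betw_byWitness[of _ "\<lambda>k. 2 * j + 1 - k"]) auto
    have nth: "fps_nth (fsum (\<lambda>k. - ?f k) UNIV) n = - fps_nth (fsum ?f UNIV) n" for n
      by (simp add: fsum_def sum_negf)
    have "fsum ?f UNIV = fsum (\<lambda>k. ?f (2 * j + 1 - k)) UNIV"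
      using fsum_reindex[OF bij, of ?f] by simp
    also have "\<dots> = fsum (\<lambda>k. - ?f k) UNIV" unfolding inv ..
    finally have eq: "fsum ?f UNIV = fsum (\<lambda>k. - ?f k) UNIV" .
    have "fsum ?f UNIV = 0"
    proof (rule fps_ext)
      fix n
      show "fps_nth (fsum ?f UNIV) n = fps_nth 0 n" using nth[of n] arg_cong[OF eq, of "\<lambda>s. fps_nth s n"] by simp
    qed
    moreover have "chi3 (1 - y - (x - 1)) = 0"
    proof -
      have "1 - y - (x - 1) = 3 * (- j)" using je(1) True by simp
      then show ?thesis by (simp add: chi3_def)
    qed
    ultimately show ?thesis by (simp add: mac_term_def)
  next
    case False
    then have e: "e = 0 \<or> e = 1" using je by simp
    \<comment> \<open>Relative to k = j the exponent is K (3 k (k - 1) / 2 + (2 - e) k), so c = (2 -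
      e) K.\<close>
    define c where "c = (if e = 0 then 2 * K else K)"
    have c: "0 < c" "c < 3 * K" using K by (auto simp: c_def)
    have chi3: "chi3 (1 - y - (x - 1)) = psign (x + y + j)"
    proof -
      have d: "1 - y - (x - 1) = 2 - e + 3 * (- j)" "x + y + j = 4 * j + e" using je(1) by simp_all
      have "chi3 (2 - e + 3 * (- j)) = chi3 (2 - e)" by (rule chi3_cong) simp
      also have "\<dots> = psign (4 * j + e)" using e by (auto simp: chi3_def psign_def)
      finally show ?thesis unfolding d .
    qed
    have chi3_nz: "chi3 (1 - y - (x - 1)) \<noteq> 0" unfolding chi3 by (simp add: psign_def)
    have E: "mac_exp K A B (1 - y) (x - 1) = ?e j"
      by (rule mac_exp_eq_jac_exp[OF je(1) e])
    have shift: "?f (k + j) = mac_term K A B (1 - y) (x - 1) * jac_term (3 * K) c k" for k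
    proof -
      have "2 * (3 * ((k + j) * (k + j - 1) div 2) + (2 - (x + y)) * (k + j))
        = 2 * (3 * (j * (j - 1) div 2) + (2 - (x + y)) * j + (3 * (k * (k - 1) div 2) + (2 - e) * k))"
        unfolding distrib_left mult.left_commute[of 2 3] T je(1) using e by (auto simp: algebra_simps)
      then have e1: "3 * ((k + j) * (k + j - 1) div 2) + (2 - (x + y)) * (k + j)
        = 3 * (j * (j - 1) div 2) + (2 - (x + y)) * j + (3 * (k * (k - 1) div 2) + (2 - e) * k)" by simp
      have jt: "?e k = int K * (x * (x - 1) div 2 + y * (y - 1) div 2 + (3 * (k * (k - 1) div 2) + (2 - (x + y)) * k))
          + int A * x + int B * y" for k
        unfolding jac_exp_triple by (simp only: add.assoc)
      have "?e (k + j) = ?e j + int K * (3 * (k * (k - 1) div 2) + (2 - e) * k)"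
        unfolding jt e1 by (simp only: distrib_left add_ac)
      also have "int K * (3 * (k * (k - 1) div 2) + (2 - e) * k) = jac_exp (3 * K) c k"
        using e by (auto simp: jac_exp_def c_def algebra_simps)
      finally have ee: "?e (k + j) = ?e j + jac_exp (3 * K) c k" .
      have pos: "?e j \<ge> 0" "jac_exp (3 * K) c k \<ge> 0"
        using mac_exp_nonneg[OF chi3_nz AB] E jac_exp_ge[OF c, of k] by linarith+
      have "psign (x + y + (k + j)) = psign (x + y + j) * psign k"
        by (simp add: psign_def)
      then show ?thesis
        unfolding f[of "k + j"] unfolding ee mac_term_def chi3 E jac_term_def nat_add_distrib[OF pos] by (simp add: power_add mult_ac)
    qed
    have bij: "bij_betw (\<lambda>k. k + j) UNIV (UNIV :: int set)"
      by (rule bij_betw_byWitness[of _ "\<lambda>k. k - j"]) auto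
    have "fsum ?f UNIV = fsum (\<lambda>k. ?f (k + j)) UNIV"
      using fsum_reindex[OF bij, of ?f] by simp
    also have "\<dots> = mac_term K A B (1 - y) (x - 1) * fsum (jac_term (3 * K) c) UNIV"
      unfolding shift by (rule fsum_cmult(1)[OF locally_finite_jac_term[OF c]])
    also have "fsum (jac_term (3 * K) c) UNIV = qpoch_inf K K"
      using pentagonal[OF K] by (simp add: c_def)
    finally show ?thesis by (simp add: mult.commute)
  qed
qed

text \<open>The product of the three theta series is summed along x = i + k and y = j + k. Each
  inner sum contributes one factor \<open>qpoch_inf K K\<close>; cancelling it against the three
  coming from the triple products leaves the square.\<close>

theorem macdonald_A2:
  assumes AB: "0 < A" "0 < B" "A + B < K"
  shows "fsum (\<lambda>(v, u). mac_term K A B v u) UNIV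
    = qpoch_inf K K ^ 2 * (qtheta A K * qtheta B K * qtheta (A + B) K)"
proof -
  have K: "K > 0" using AB by simp
  have l: "locally_finite (jac_term K A) UNIV" "locally_finite (jac_term K B) UNIV" "locally_finite (jac_term K (A + B)) UNIV"
    using AB by (auto intro!: locally_finite_jac_term)
  let ?F = "\<lambda>(p :: int \<times> int, k). (case p of (i, j) \<Rightarrow> jac_term K A i * jac_term K B j) * jac_term K (A + B) k"
  let ?g = "\<lambda>(p :: int \<times> int, k). (case p of (x, y) \<Rightarrow> ((x - k, y - k), k))"
  have F: "fsum (jac_term K A) UNIV * fsum (jac_term K B) UNIV * fsum (jac_term K (A + B)) UNIV = fsum ?F UNIV"
    and lF: "locally_finite ?F UNIV"
    using fsum_mult[OF fsum_mult(2)[OF l(1,2)] l(3)] fsum_mult(1)[OF l(1,2)] by simp_all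
  have bij: "bij_betw ?g UNIV UNIV"
    by (rule bij_betw_byWitness[of _ "\<lambda>(p, k). (case p of (x, y) \<Rightarrow> ((x + k, y + k), k))"]) auto
  let ?G = "\<lambda>(p :: int \<times> int) k. case p of (x, y) \<Rightarrow> jac_term K A (x - k) * jac_term K B (y - k) * jac_term K (A + B) k"
  have Fg: "?F (?g z) = (case z of (p, k) \<Rightarrow> ?G p k)" for z
    by (auto split: prod.splits)
  have "fsum ?F UNIV = fsum (\<lambda>(p, k). ?G p k) (UNIV \<times> UNIV)"
    using fsum_reindex[OF bij, of ?F] unfolding Fg by simp
  also have "\<dots> = fsum (\<lambda>p. fsum (?G p) UNIV) UNIV"
    using locally_finite_reindex[OF bij lF] unfolding Fg by (intro fsum_fsum[symmetric]) simp
  also have "\<dots> = fsum (\<lambda>p. qpoch_inf K K * (case (case p of (x, y) \<Rightarrow> (1 - y, x - 1)) of (v, u) \<Rightarrow> mac_term K A B v u)) UNIV"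
    by (rule fsum_cong) (auto simp: inner_theta_sum[OF AB])
  also have "\<dots> = fsum (\<lambda>p. qpoch_inf K K * (case p of (v, u) \<Rightarrow> mac_term K A B v u)) UNIV"
  proof -
    have "bij_betw (\<lambda>(x, y). (1 - y, x - 1)) UNIV (UNIV :: (int \<times> int) set)"
      by (rule bij_betw_byWitness[of _ "\<lambda>(v, u). (u + 1, 1 - v)"]) auto
    from fsum_reindex[OF this, of "\<lambda>p. qpoch_inf K K * (case p of (v, u) \<Rightarrow> mac_term K A B v u)"]
    show ?thesis by simp
  qed
  also have "\<dots> = qpoch_inf K K * fsum (\<lambda>(v, u). mac_term K A B v u) UNIV"
    by (rule fsum_cmult(1)[OF locally_finite_mac_term[OF AB]])
  finally have "qpoch_inf K K * fsum (\<lambda>(v, u). mac_term K A B v u) UNIV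
     = fsum (jac_term K A) UNIV * fsum (jac_term K B) UNIV * fsum (jac_term K (A + B)) UNIV"
    unfolding F by (rule sym)
  also have "\<dots> = (qpoch_inf K K * qtheta A K) * (qpoch_inf K K * qtheta B K) * (qpoch_inf K K * qtheta (A + B) K)"
    using jacobi_triple_product[of A K] jacobi_triple_product[of B K] jacobi_triple_product[of "A + B" K] AB
    by simp
  also have "\<dots> = qpoch_inf K K * (qpoch_inf K K ^ 2 * (qtheta A K * qtheta B K * qtheta (A + B) K))"
    by (simp add: power2_eq_square mult_ac)
  finally have "qpoch_inf K K * fsum (\<lambda>(v, u). mac_term K A B v u) UNIV
     = qpoch_inf K K * (qpoch_inf K K ^ 2 * (qtheta A K * qtheta B K * qtheta (A + B) K))" .
  moreover have "qpoch_inf K K \<noteq> 0"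
    using qpoch_inf_nth_0[OF K K] by auto
  ultimately show ?thesis by simp
qed

section \<open>The multiple sum and its limit\<close>

interpretation X: generic_q "fls_X :: real fls"
  by (rule generic_q_fls_X)

section \<open>The nested sum as a sum over pairs of partitions\<close>

definition qform :: "nat \<Rightarrow> nat \<Rightarrow> nat" where
  "qform r s = nat ((int r)\<^sup>2 - int r * int s + (int s)\<^sup>2)"

lemma qform_ge: "3 * (int r)\<^sup>2 \<le> 4 * ((int r)\<^sup>2 - int r * int s + (int s)\<^sup>2)"
proof -
  have "4 * ((int r)\<^sup>2 - int r * int s + (int s)\<^sup>2) = (2 * int s - int r)\<^sup>2 + 3 * (int r)\<^sup>2"
    by (simp add: power2_eq_square algebra_simps)
  then show ?thesis by simp
qed

lemma int_qform: "int (qform r s) = (int r)\<^sup>2 - int r * int s + (int s)\<^sup>2"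
proof -
  have "0 \<le> 3 * (int r)\<^sup>2" by simp
  then have "0 \<le> 4 * ((int r)\<^sup>2 - int r * int s + (int s)\<^sup>2)" by (rule order_trans[OF _ qform_ge])
  then show ?thesis unfolding qform_def by (intro nat_0_le) simp
qed

lemma qform_commute: "qform r s = qform s r"
  by (simp add: qform_def algebra_simps)

lemma le_qform: "r \<le> 2 * qform r s"
proof -
  have "int r \<le> (int r)\<^sup>2" by (cases r) (auto simp: power2_eq_square)
  moreover have "3 * (int r)\<^sup>2 \<le> 4 * int (qform r s)" using qform_ge unfolding int_qform .
  ultimately show ?thesis by linarith
qed

text \<open>Removes the largest part. Index 0 is reset to 0, as membership in \<open>parts\<close>
  demands.\<close>

definition shift :: "(nat \<Rightarrow> nat) \<Rightarrow> nat \<Rightarrow> nat" where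
  "shift l i = (if i = 0 then 0 else l (Suc i))"

definition unshift :: "nat \<Rightarrow> (nat \<Rightarrow> nat) \<Rightarrow> nat \<Rightarrow> nat" where
  "unshift r l i = (if i = 0 then 0 else if i = 1 then r else l (i - 1))"

definition bounded_parts :: "nat \<Rightarrow> nat \<Rightarrow> (nat \<Rightarrow> nat) set" where
  "bounded_parts L n = {l \<in> parts L. L \<ge> 1 \<longrightarrow> l 1 \<le> n}"

lemma bounded_parts_0: "bounded_parts 0 n = {\<lambda>_. 0}"
  by (auto simp: bounded_parts_def parts_def)

lemma shift_unshift: "l \<in> parts L \<Longrightarrow> shift (unshift r l) = l"
  by (auto simp: fun_eq_iff shift_def unshift_def parts_def)

lemma unshift_shift: "l \<in> parts L \<Longrightarrow> unshift (l 1) (shift l) = l"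
  by (auto simp: fun_eq_iff shift_def unshift_def parts_def)

lemma shift_in_parts: "l \<in> parts (Suc L) \<Longrightarrow> shift l \<in> bounded_parts L (l 1)"
  by (auto simp: bounded_parts_def parts_def shift_def)

lemma unshift_in_parts: "l \<in> bounded_parts L r \<Longrightarrow> unshift r l \<in> parts (Suc L)"
proof -
  assume l: "l \<in> bounded_parts L r"
  have "unshift r l (i + 1) \<le> unshift r l i" if "i \<in> {1..<Suc L}" for i
  proof (cases "i = 1")
    case True
    then show ?thesis using l that by (auto simp: unshift_def bounded_parts_def)
  next
    case False
    then have "i - 1 \<in> {1..<L}" using that by auto
    then have "l (i - 1 + 1) \<le> l (i - 1)" using l unfolding bounded_parts_def parts_def by blast
    then show ?thesis using False that by (auto simp: unshift_def)
  qed
  moreover have "unshift r l i = 0" if "i \<notin> {1..Suc L}" for i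
  proof (cases "i = 0")
    case False
    then have "i \<noteq> 1" "i - 1 \<notin> {1..L}" using that by auto
    then have "l (i - 1) = 0" using l unfolding bounded_parts_def parts_def by blast
    then show ?thesis using False \<open>i \<noteq> 1\<close> by (simp add: unshift_def)
  qed (simp add: unshift_def)
  ultimately show ?thesis unfolding parts_def by blast
qed

lemma bounded_parts_Suc:
  "bij_betw (\<lambda>(r, l). unshift r l) (SIGMA r:{..n}. bounded_parts L r) (bounded_parts (Suc L) n)"
proof (rule bij_betw_byWitness[of _ "\<lambda>l. (l 1, shift l)"])
  show "\<forall>a\<in>SIGMA r:{..n}. bounded_parts L r. (\<lambda>l. (l 1, shift l)) ((\<lambda>(r, l). unshift r l) a) = a"
    using shift_unshift by (auto simp: bounded_parts_def) (auto simp: unshift_def)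
  show "\<forall>a'\<in>bounded_parts (Suc L) n. (\<lambda>(r, l). unshift r l) (a' 1, shift a') = a'"
    using unshift_shift by (auto simp: bounded_parts_def)
  show "(\<lambda>(r, l). unshift r l) ` (SIGMA r:{..n}. bounded_parts L r) \<subseteq> bounded_parts (Suc L) n"
    using unshift_in_parts by (auto simp: bounded_parts_def) (auto simp: unshift_def)
  show "(\<lambda>l. (l 1, shift l)) ` bounded_parts (Suc L) n \<subseteq> (SIGMA r:{..n}. bounded_parts L r)"
    using shift_in_parts by (auto simp: bounded_parts_def)
qed

lemma finite_bounded_parts: "finite (bounded_parts L n)"
proof (induction L arbitrary: n)
  case 0
  show ?case by (simp add: bounded_parts_0)
next
  case (Suc L)
  have "finite (SIGMA r:{..n}. bounded_parts L r)" using Suc by auto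
  then show ?case using bij_betw_finite[OF bounded_parts_Suc] by blast
qed

lemma sum_bounded_parts_Suc:
  "(\<Sum>l\<in>bounded_parts (Suc L) n. f l) = (\<Sum>r\<le>n. \<Sum>l\<in>bounded_parts L r. f (unshift r l))"
  unfolding sum.reindex_bij_betw[OF bounded_parts_Suc, symmetric]
  by (subst sum.Sigma) (auto simp: finite_bounded_parts case_prod_beta)

text \<open>The contribution of one pair of partitions to \<open>tchain\<close>; here
  \<open>k\<close> is the second partition, and \<open>n\<close>, \<open>m\<close> act as parts of
  index 0.\<close>

primrec chain :: "int \<Rightarrow> nat \<Rightarrow> nat \<Rightarrow> nat \<Rightarrow> nat \<Rightarrow> nat \<Rightarrow> (nat \<Rightarrow> nat) \<Rightarrow> (nat \<Rightarrow> nat) \<Rightarrow> real fps" where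
  "chain \<tau> 0 a b n m l k = gfun n m \<tau>"
| "chain \<tau> (Suc L) a b n m l k = fps_X ^ (qform (l 1) (k 1) + (if a = 0 then l 1 else 0) + (if b = 0 then k 1 else 0))
     * (inv_qpoch 1 (int n - int (l 1)) * inv_qpoch 1 (int m - int (k 1)))
     * chain \<tau> L (a - 1) (b - 1) (l 1) (k 1) (shift l) (shift k)"

lemma tchain_eq_chain:
  "X.tchain (\<lambda>n m. fps_to_fls (gfun n m \<tau>)) L a b n m
    = fps_to_fls (\<Sum>l\<in>bounded_parts L n. \<Sum>k\<in>bounded_parts L m. chain \<tau> L a b n m l k)"
proof (induction L arbitrary: a b n m)
  case 0
  show ?case by (simp add: bounded_parts_0)
next
  case (Suc L)
  define w where "w = (\<lambda>r s. fps_X ^ (qform r s + (if a = 0 then r else 0) + (if b = 0 then s else 0))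
     * (inv_qpoch 1 (int n - int r) * inv_qpoch 1 (int m - int s)))"
  have w: "fps_to_fls (w r s) = fls_X powi ((int r)\<^sup>2 - int r * int s + (int s)\<^sup>2 + (if a = 0 then 1 else 0) * int r
      + (if b = 0 then 1 else 0) * int s) * X.ipoch (int n - int r) * X.ipoch (int m - int s)" for r s
    unfolding w_def fps_to_fls_times fps_to_fls_X_power
    using fps_to_fls_inv_qpoch[of 1] int_qform[of r s] by (simp add: mult.assoc)
  have c: "chain \<tau> (Suc L) a b n m (unshift r l) (unshift s k) = w r s * chain \<tau> L (a - 1) (b - 1) r s l k"
    if "l \<in> bounded_parts L r" "k \<in> bounded_parts L s" for r s l k
  proof -
    have "unshift r l 1 = r" "unshift s k 1 = s" by (simp_all add: unshift_def)
    moreover have "shift (unshift r l) = l" "shift (unshift s k) = k"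
      using that by (auto simp: bounded_parts_def intro: shift_unshift)
    ultimately show ?thesis by (simp only: chain.simps w_def)
  qed
  have "(\<Sum>l\<in>bounded_parts (Suc L) n. \<Sum>k\<in>bounded_parts (Suc L) m. chain \<tau> (Suc L) a b n m l k)
    = (\<Sum>r\<le>n. \<Sum>l\<in>bounded_parts L r. \<Sum>s\<le>m. \<Sum>k\<in>bounded_parts L s. w r s * chain \<tau> L (a - 1) (b - 1) r s l k)"
    unfolding sum_bounded_parts_Suc by (intro sum.cong refl) (auto simp: c simp del: chain.simps)
  also have "\<dots> = (\<Sum>r\<le>n. \<Sum>s\<le>m. \<Sum>l\<in>bounded_parts L r. \<Sum>k\<in>bounded_parts L s. w r s * chain \<tau> L (a - 1) (b - 1) r s l k)"
    by (intro sum.cong refl sum.swap)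
  also have "\<dots> = (\<Sum>r\<le>n. \<Sum>s\<le>m. w r s * (\<Sum>l\<in>bounded_parts L r. \<Sum>k\<in>bounded_parts L s. chain \<tau> L (a - 1) (b - 1) r s l k))"
    by (simp add: sum_distrib_left)
  finally show ?case
    unfolding X.tchain.simps X.bailey_def Suc.IH by (simp only: fps_to_fls_sum fps_to_fls_times w)
qed

lemma chain_eq:
  "chain \<tau> L a b n m l k = fps_X ^ ((\<Sum>i=1..L. qform (l i) (k i)) + (\<Sum>i=a+1..L. l i) + (\<Sum>i=b+1..L. k i))
    * (\<Prod>i<L. inv_qpoch 1 (int (if i = 0 then n else l i) - int (l (Suc i))) * inv_qpoch 1 (int (if i = 0 then m else k i) - int (k (Suc i))))
    * gfun (if L = 0 then n else l L) (if L = 0 then m else k L) \<tau>"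
proof (induction L arbitrary: a b n m l k)
  case 0
  show ?case by simp
next
  case (Suc L)
  have s: "(\<Sum>i=a+1..Suc L. f i) = (if a = 0 then f 1 else 0) + (\<Sum>i=a-1+1..L. shift f i)" for a and f :: "nat \<Rightarrow> nat"
  proof (cases a)
    case 0
    have "(\<Sum>i=1..Suc L. f i) = f 1 + (\<Sum>i=Suc 1..Suc L. f i)"
      by (simp add: sum.atLeast_Suc_atMost)
    also have "(\<Sum>i=Suc 1..Suc L. f i) = (\<Sum>i=1..L. shift f i)"
      unfolding sum.shift_bounds_cl_Suc_ivl by (intro sum.cong) (auto simp: shift_def)
    finally show ?thesis using 0 by simp
  next
    case (Suc a')
    have "(\<Sum>i=Suc a'+1..Suc L. f i) = (\<Sum>i=a'+1..L. shift f i)"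
      unfolding add_Suc sum.shift_bounds_cl_Suc_ivl by (intro sum.cong) (auto simp: shift_def)
    then show ?thesis using Suc by simp
  qed
  have q: "(\<Sum>i=1..Suc L. qform (l i) (k i)) = qform (l 1) (k 1) + (\<Sum>i=1..L. qform (shift l i) (shift k i))"
  proof -
    have "(\<Sum>i=1..Suc L. qform (l i) (k i)) = qform (l 1) (k 1) + (\<Sum>i=Suc 1..Suc L. qform (l i) (k i))"
      by (simp add: sum.atLeast_Suc_atMost)
    also have "(\<Sum>i=Suc 1..Suc L. qform (l i) (k i)) = (\<Sum>i=1..L. qform (shift l i) (shift k i))"
      unfolding sum.shift_bounds_cl_Suc_ivl by (intro sum.cong) (auto simp: shift_def)
    finally show ?thesis .
  qed
  have p: "(\<Prod>i<Suc L. inv_qpoch 1 (int (if i = 0 then n else l i) - int (l (Suc i))) * inv_qpoch 1 (int (if i = 0 then m else k i) - int (k (Suc i))))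
    = inv_qpoch 1 (int n - int (l 1)) * inv_qpoch 1 (int m - int (k 1))
    * (\<Prod>i<L. inv_qpoch 1 (int (if i = 0 then l 1 else shift l i) - int (shift l (Suc i))) * inv_qpoch 1 (int (if i = 0 then k 1 else shift k i) - int (shift k (Suc i))))"
    unfolding prod.lessThan_Suc_shift by (simp add: shift_def) (intro disjI2 prod.cong; auto simp: shift_def)
  have g: "gfun (if L = 0 then l 1 else shift l L) (if L = 0 then k 1 else shift k L) \<tau>
      = gfun (if Suc L = 0 then n else l (Suc L)) (if Suc L = 0 then m else k (Suc L)) \<tau>"
    by (simp add: shift_def)
  have aux: "x ^ (a + b + c) * i * (x ^ (d + e + f) * p * g) = x ^ ((a + d) + (b + e) + (c + f)) * (i * p) * g"
    for x i p g :: "real fps" and a b c d e f :: nat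
    by (simp only: power_add mult_ac)
  show ?case
    unfolding chain.simps Suc.IH s q p g by (rule aux)
qed

lemma fps_divide_eq_mult_inverse: "fps_nth g 0 \<noteq> 0 \<Longrightarrow> f / g = f * inverse (g :: real fps)"
  by (rule fps_divide_unit)

lemma fps_inverse_prod: "inverse (\<Prod>x\<in>A. f x) = (\<Prod>x\<in>A. inverse (f x :: real fps))"
  by (induction A rule: infinite_finite_induct) (auto simp: fps_inverse_mult)

lemma fps_prod_nth_0: "fps_nth (\<Prod>x\<in>A. f x) 0 = (\<Prod>x\<in>A. fps_nth (f x :: real fps) 0)"
  by (induction A rule: infinite_finite_induct) auto

lemma summand_eq:
  assumes k: "k \<ge> 1" and l: "l \<in> parts k" and m: "m \<in> parts k"
  shows "summand k \<tau> a b l m = (if a = 0 \<or> b = 0 then 1 else 1 - fps_X ^ (l a + m b + 1)) * inverse (1 - fps_X)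
     * fps_X ^ ((\<Sum>i=1..k. qform (l i) (m i)) + (\<Sum>i=a+1..k. l i) + (\<Sum>i=b+1..k. m i))
     * (\<Prod>i=1..k-1. inv_qpoch 1 (int (l i) - int (l (Suc i))) * inv_qpoch 1 (int (m i) - int (m (Suc i))))
     * gfun (l k) (m k) \<tau>"
proof -
  have e: "nat (\<Sum>i=1..k. int (l i)^2 - int (l i) * int (m i) + int (m i)^2) = (\<Sum>i=1..k. qform (l i) (m i))"
  proof -
    have "(\<Sum>i=1..k. int (l i)^2 - int (l i) * int (m i) + int (m i)^2) = int (\<Sum>i=1..k. qform (l i) (m i))"
      by (simp add: int_qform)
    then show ?thesis by (simp only: nat_int)
  qed
  have d: "inverse (\<Prod>i=1..k-1. qpoch 1 1 (l i - l (i + 1)) * qpoch 1 1 (m i - m (i + 1)))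
    = (\<Prod>i=1..k-1. inv_qpoch 1 (int (l i) - int (l (Suc i))) * inv_qpoch 1 (int (m i) - int (m (Suc i))))"
    unfolding fps_inverse_prod
  proof (intro prod.cong refl)
    fix i assume i: "i \<in> {1..k-1}"
    then have "i \<in> {1..<k}" using k by auto
    then have le: "l (Suc i) \<le> l i" "m (Suc i) \<le> m i" using l m by (auto simp: parts_def)
    show "inverse (qpoch 1 1 (l i - l (i + 1)) * qpoch 1 1 (m i - m (i + 1)))
        = inv_qpoch 1 (int (l i) - int (l (Suc i))) * inv_qpoch 1 (int (m i) - int (m (Suc i)))"
      unfolding of_nat_diff[OF le(1), symmetric] of_nat_diff[OF le(2), symmetric]
      by (simp add: inv_qpoch_def fps_inverse_mult)
  qed
  have n1: "fps_nth (\<Prod>i=1..k-1. qpoch 1 1 (l i - l (i + 1)) * qpoch 1 1 (m i - m (i + 1))) 0 \<noteq> 0"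
    by (simp add: fps_prod_nth_0 qpoch_nth_0)
  have n2: "fps_nth (1 - fps_X :: real fps) 0 \<noteq> 0" by simp
  show ?thesis
    unfolding summand_def e fps_divide_eq_mult_inverse[OF n1] fps_divide_eq_mult_inverse[OF n2] d ..
qed

text \<open>The added \<open>inv_qpoch\<close> factors cap the largest parts at n and n' and become
  constants in the limit. Multiplying by 1 - q removes the denominator that a two-term difference of
  chains cannot produce.\<close>

lemma summand_chain:
  assumes k: "k \<ge> 1" and ab: "a \<le> k" "b \<le> k" and l: "l \<in> parts k" and m: "m \<in> parts k"
  shows "(1 - fps_X) * (summand k \<tau> a b l m * (inv_qpoch 1 (int n - int (l 1)) * inv_qpoch 1 (int n' - int (m 1))))
    = chain \<tau> k a b n n' l m - (if a = 0 \<or> b = 0 then 0 else fps_X * chain \<tau> k (a - 1) (b - 1) n n' l m)"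
proof -
  obtain k' where k': "k = Suc k'" using k by (cases k) auto
  define P where "P = (\<Prod>i<k. inv_qpoch 1 (int (if i = 0 then n else l i) - int (l (Suc i)))
    * inv_qpoch 1 (int (if i = 0 then n' else m i) - int (m (Suc i))))"
  define E where "E = (\<Sum>i=1..k. qform (l i) (m i)) + (\<Sum>i=a+1..k. l i) + (\<Sum>i=b+1..k. m i)"
  have P: "P = (inv_qpoch 1 (int n - int (l 1)) * inv_qpoch 1 (int n' - int (m 1)))
     * (\<Prod>i=1..k-1. inv_qpoch 1 (int (l i) - int (l (Suc i))) * inv_qpoch 1 (int (m i) - int (m (Suc i))))"
  proof -
    define f where "f = (\<lambda>i. inv_qpoch 1 (int (l i) - int (l (Suc i))) * inv_qpoch 1 (int (m i) - int (m (Suc i))))"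
    have "(\<Prod>i=1..k-1. f i) = (\<Prod>i<k'. f (Suc i))"
      using prod.atLeast1_atMost_eq[of f k'] k' by simp
    moreover have "P = (inv_qpoch 1 (int n - int (l 1)) * inv_qpoch 1 (int n' - int (m 1))) * (\<Prod>i<k'. f (Suc i))"
      unfolding P_def k' prod.lessThan_Suc_shift by (simp add: f_def)
    ultimately show ?thesis by (simp only: f_def)
  qed
  have c1: "chain \<tau> k a b n n' l m = fps_X ^ E * P * gfun (l k) (m k) \<tau>"
    using k by (simp add: chain_eq E_def P_def)
  have c2: "fps_X * chain \<tau> k (a - 1) (b - 1) n n' l m = fps_X ^ (l a + m b + 1) * (fps_X ^ E * P * gfun (l k) (m k) \<tau>)"
    if "\<not> (a = 0 \<or> b = 0)"
  proof -
    have "(\<Sum>i=a-1+1..k. l i) = l a + (\<Sum>i=a+1..k. l i)" "(\<Sum>i=b-1+1..k. m i) = m b + (\<Sum>i=b+1..k. m i)"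
      using that ab by (simp_all add: sum.atLeast_Suc_atMost)
    then have "(\<Sum>i=1..k. qform (l i) (m i)) + (\<Sum>i=a-1+1..k. l i) + (\<Sum>i=b-1+1..k. m i) = E + (l a + m b)"
      by (simp add: E_def)
    then have "chain \<tau> k (a - 1) (b - 1) n n' l m = fps_X ^ (E + (l a + m b)) * P * gfun (l k) (m k) \<tau>"
      using k unfolding chain_eq P_def by simp
    then show ?thesis by (simp add: power_add mult_ac)
  qed
  have inv: "(1 - fps_X) * inverse (1 - fps_X :: real fps) = 1"
    by (rule inverse_mult_eq_1') simp
  have "(1 - fps_X) * (summand k \<tau> a b l m * (inv_qpoch 1 (int n - int (l 1)) * inv_qpoch 1 (int n' - int (m 1))))
    = ((1 - fps_X) * inverse (1 - fps_X)) * (if a = 0 \<or> b = 0 then 1 else 1 - fps_X ^ (l a + m b + 1)) * (fps_X ^ E * P * gfun (l k) (m k) \<tau>)"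
    unfolding summand_eq[OF k l m] E_def[symmetric] P by (simp only: mult_ac)
  also have "\<dots> = (if a = 0 \<or> b = 0 then 1 else 1 - fps_X ^ (l a + m b + 1)) * (fps_X ^ E * P * gfun (l k) (m k) \<tau>)"
    unfolding inv by simp
  finally show ?thesis
    using c1 c2 by (auto simp: left_diff_distrib)
qed

text \<open>Every summand is divisible by q to the power \<open>qform (l 1) (m 1)\<close>, and by
  \<open>le_qform\<close> this form bounds both largest parts, which dominate all others.\<close>

lemma locally_finite_summand:
  assumes k: "k \<ge> 1"
  shows "locally_finite (\<lambda>(l, m). summand k \<tau> a b l m) (parts k \<times> parts k)"
proof (rule locally_finiteI[where e = "\<lambda>(l, m). qform (l 1) (m 1)"])
  fix p i assume p: "p \<in> parts k \<times> parts k" and i: "i < (case p of (l, m) \<Rightarrow> qform (l 1) (m 1))"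
  obtain l m where lm: "p = (l, m)" by (cases p)
  define E where "E = (\<Sum>i=1..k. qform (l i) (m i)) + (\<Sum>i=a+1..k. l i) + (\<Sum>i=b+1..k. m i)"
  have "qform (l 1) (m 1) \<le> (\<Sum>i=1..k. qform (l i) (m i))"
    using k by (intro member_le_sum) auto
  then have "i < E" using i lm by (simp add: E_def)
  have "\<exists>r. summand k \<tau> a b l m = fps_X ^ E * r"
    using p lm k unfolding E_def by (subst summand_eq) (auto simp: mult_ac)
  then obtain r where "summand k \<tau> a b l m = fps_X ^ E * r" by blast
  then show "fps_nth (case p of (l, m) \<Rightarrow> summand k \<tau> a b l m) i = 0"
    using \<open>i < E\<close> lm by (simp add: fps_X_power_mult_nth)
next
  fix n
  have "{p \<in> parts k \<times> parts k. (case p of (l, m) \<Rightarrow> qform (l 1) (m 1)) \<le> n} \<subseteq> bounded_parts k (2 * n) \<times> bounded_parts k (2 * n)"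
  proof
    fix p assume p: "p \<in> {p \<in> parts k \<times> parts k. (case p of (l, m) \<Rightarrow> qform (l 1) (m 1)) \<le> n}"
    obtain l m where lm: "p = (l, m)" by (cases p)
    have "l 1 \<le> 2 * n" "m 1 \<le> 2 * n"
      using p lm le_qform[of "l 1" "m 1"] le_qform[of "m 1" "l 1"] qform_commute[of "m 1" "l 1"] by auto
    then show "p \<in> bounded_parts k (2 * n) \<times> bounded_parts k (2 * n)" using p lm by (auto simp: bounded_parts_def)
  qed
  then show "finite {p \<in> parts k \<times> parts k. (case p of (l, m) \<Rightarrow> qform (l 1) (m 1)) \<le> n}"
    using finite_subset finite_bounded_parts by blast
qed

lemma fps_to_fls_qbinom:
  assumes "s > 0"
  shows "fps_to_fls (qbinom s (n + m) n) = generic_q.poch (fls_X ^ s) (n + m)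
    * generic_q.ipoch (fls_X ^ s) (int n) * generic_q.ipoch (fls_X ^ s) (int m)"
proof -
  interpret q: generic_q "fls_X ^ s :: real fls"
    using generic_q.generic_q_power[OF generic_q_fls_X assms] .
  have "fps_nth (qpoch s s n * qpoch s s m) 0 \<noteq> 0" using assms by (simp add: qpoch_nth_0)
  then have "qbinom s (n + m) n = qpoch s s (n + m) * inverse (qpoch s s n * qpoch s s m)"
    by (simp add: qbinom_def fps_divide_eq_mult_inverse)
  also have "\<dots> = qpoch s s (n + m) * (inverse (qpoch s s n) * inverse (qpoch s s m))"
    by (simp add: fps_inverse_mult)
  finally show ?thesis
    using assms by (simp add: fps_to_fls_times fps_to_fls_inverse qpoch_nth_0 fps_to_fls_qpoch q.ipoch_of_nat)
qed

lemma walk_rho_qbinom: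
  assumes "\<tau> \<in> {-1, 0, 1}"
  shows "X.walk \<tau> (n + m) (int n + 1) (int n) (int n - 1) = fls_X powi (3 * (int n * (int n - 1) div 2))
    * fps_to_fls (fps_X ^ (nat (\<tau> * (\<tau> - 1)) * n * m) * qbinom (if \<tau>\<^sup>2 = 1 then 1 else 3) (n + m) n)"
proof -
  have d: "int (n + m) - int n = int m" by simp
  consider "\<tau> = 1" | "\<tau> = - 1" | "\<tau> = 0" using assms by auto
  then show ?thesis
  proof cases
    case 1
    then show ?thesis
      unfolding 1 X.walk_rho_1 d using fps_to_fls_qbinom[of 1 n m] by (simp add: mult_ac)
  next
    case 2
    have "nat (- 1 * (- 1 - 1)) * n * m = 2 * n * m" by simp
    moreover have "(fls_X :: real fls) powi (3 * (int n * (int n - 1) div 2) + 2 * int n * int m)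
      = fls_X powi (3 * (int n * (int n - 1) div 2)) * fps_to_fls (fps_X ^ (2 * n * m))"
      unfolding X.powi_add fps_to_fls_X_power by simp
    ultimately show ?thesis
      unfolding 2 X.walk_rho_minus_1 d using fps_to_fls_qbinom[of 1 n m]
      by (simp add: fps_to_fls_times mult_ac del: power_int_of_nat)
  next
    case 3
    interpret q3: generic_q "fls_X ^ 3 :: real fls"
      using generic_q.generic_q_power[OF generic_q_fls_X, of 3] by simp
    have "(fls_X ^ 3 :: real fls) powi (int n * (int n - 1) div 2) = fls_X powi (3 * (int n * (int n - 1) div 2))"
      by (simp only: power_int_mult power_int_numeral)
    then show ?thesis
      unfolding 3 X.walk_rho_0_eq q3.esym_eq d using fps_to_fls_qbinom[of 3 n m] by (simp add: mult_ac)
  qed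
qed

text \<open>The scalar 1 - q comes from (1 - q) (q^2;q)_R = (q;q)_(R+1), R = n + m: g has (q^2;q)_R
  in its denominator, \<open>exp11_eq_walk\<close> has (q;q)_(R+1).\<close>

lemma gfun_eq_exp11:
  assumes \<tau>: "\<tau> \<in> {-1, 0, 1}" and M: "int (n + m) + 1 \<le> M"
  shows "fps_to_fls (gfun n m \<tau>) = (1 - fls_X) * X.exp11 \<tau> M 0 n m"
proof -
  define R where "R = n + m"
  define G where "G = fps_X ^ (nat (\<tau> * (\<tau> - 1)) * n * m) * qbinom (if \<tau>\<^sup>2 = 1 then 1 else 3) (n + m) n"
  define c where "c = (fls_X :: real fls) powi (3 * (int n * (int n - 1) div 2))"
  have c: "c \<noteq> 0" by (simp add: c_def)
  have "fps_nth (qpoch 1 1 R * qpoch 2 1 R) 0 \<noteq> 0" by (simp add: qpoch_nth_0)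
  then have "gfun n m \<tau> = G * inverse (qpoch 1 1 R * qpoch 2 1 R)"
    unfolding gfun_def G_def R_def by (simp add: fps_divide_eq_mult_inverse mult_ac)
  then have g: "fps_to_fls (gfun n m \<tau>) = fps_to_fls G * (inverse (X.poch R) * inverse (fps_to_fls (qpoch 2 1 R)))"
    using fps_to_fls_qpoch[of 1 R]
    by (simp add: fps_inverse_mult fps_to_fls_times fps_to_fls_inverse qpoch_nth_0)
  have "(1 - fps_X) * qpoch 2 1 R = qpoch 1 1 (Suc R)"
    unfolding qpoch_def prod.lessThan_Suc_shift by simp
  from arg_cong[OF this, of fps_to_fls] have p: "(1 - fls_X) * fps_to_fls (qpoch 2 1 R) = X.poch (Suc R)"
    using fps_to_fls_qpoch[of 1 "Suc R"] by (simp add: fps_to_fls_times)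
  have nz: "fps_to_fls (qpoch 2 1 R) \<noteq> 0" "1 - fls_X \<noteq> (0 :: real fls)"
    using p X.poch_nonzero[of "Suc R"] X.q_not_root_of_unity[of 1] by auto
  have "c * (X.poch R * X.poch (Suc R)) * X.exp11 \<tau> M 0 n m = c * fps_to_fls G"
    using X.exp11_eq_walk[OF M, of \<tau>] walk_rho_qbinom[OF \<tau>, of n m] by (simp only: c_def R_def G_def)
  then have "X.poch R * X.poch (Suc R) * X.exp11 \<tau> M 0 n m = fps_to_fls G"
    by (simp only: mult.assoc mult_left_cancel[OF c])
  then show ?thesis
    unfolding g p[symmetric] using nz X.poch_nonzero[of R] by (simp add: field_simps)
qed

section \<open>Kernels as power series, the finite identity and its limit\<close>

definition ker_fps :: "int \<Rightarrow> int \<Rightarrow> int \<Rightarrow> int \<Rightarrow> int \<Rightarrow> real fps" where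
  "ker_fps A B c1 c2 c3 = qpoch 1 1 (nat (A + B))
     * (inv_qpoch 1 (A + c1) * inv_qpoch 1 (A + c2) * inv_qpoch 1 (A + c3) * (inv_qpoch 1 (B - c1) * inv_qpoch 1 (B - c2) * inv_qpoch 1 (B - c3)))"

lemma fps_to_fls_ker_fps: "fps_to_fls (ker_fps A B c1 c2 c3) = X.ker A B c1 c2 c3"
  using fps_to_fls_qpoch[of 1] fps_to_fls_inv_qpoch[of 1]
  by (simp add: ker_fps_def X.ker_def fps_to_fls_times)

lemma ker_fps_eq_0:
  assumes "A + c1 < 0 \<or> A + c2 < 0 \<or> A + c3 < 0 \<or> B < c1 \<or> B < c2 \<or> B < c3"
  shows "ker_fps A B c1 c2 c3 = 0"
  using assms by (auto simp: ker_fps_def inv_qpoch_def)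

lemma ker_fps_LIMSEQ:
  fixes i j c1 c2 c3 :: int
  defines "P \<equiv> qpoch_inf 1 1"
  shows "(\<lambda>N. ker_fps (int N + i) (int N + j) c1 c2 c3)
    \<longlonglongrightarrow> P * (inverse P * inverse P * inverse P * (inverse P * inverse P * inverse P))"
proof -
  have f: "filterlim (\<lambda>N. 2 * N :: nat) sequentially sequentially"
    by (rule mult_nat_left_at_top) simp
  have "(\<lambda>N. qpoch 1 1 (nat (int (2 * N) + (i + j)))) \<longlonglongrightarrow> P"
    unfolding P_def by (rule filterlim_compose[OF LIMSEQ_int_shift[OF qpoch_LIMSEQ[OF zero_less_one]] f])
  moreover have "nat (int N + i + (int N + j)) = nat (int (2 * N) + (i + j))" for N by simp
  ultimately have q: "(\<lambda>N. qpoch 1 1 (nat (int N + i + (int N + j)))) \<longlonglongrightarrow> P" by (simp only:)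
  have a: "(\<lambda>N. inv_qpoch 1 (int N + i + c)) \<longlonglongrightarrow> inverse P" for c i
    using inv_qpoch_LIMSEQ[of 1 "i + c"] unfolding P_def by (simp add: add.assoc)
  have b: "(\<lambda>N. inv_qpoch 1 (int N + j - c)) \<longlonglongrightarrow> inverse P" for c j
    using a[of j "- c"] by simp
  show ?thesis unfolding ker_fps_def by (intro LIMSEQ_fps_mult q a b)
qed

definition top_ker :: "nat \<Rightarrow> nat \<Rightarrow> nat \<Rightarrow> int \<Rightarrow> int \<Rightarrow> real fps" where
  "top_ker a b N v u = (if a = 0 \<and> b = 0 then ker_fps (int N + 1) (int N + 1) v u (- v - u)
     else if a = 0 then ker_fps (int N + 1) (int N) (v - 1) u (- v - u)
     else ker_fps (int N) (int N) (v - 1) (u + 1) (- v - u))"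

lemma top_ker_LIMSEQ:
  fixes a b :: nat and v u :: int
  defines "P \<equiv> qpoch_inf 1 1"
  shows "(\<lambda>N. top_ker a b N v u) \<longlonglongrightarrow> P * (inverse P * inverse P * inverse P * (inverse P * inverse P * inverse P))"
  using ker_fps_LIMSEQ[of 1 1 v u "- v - u"] ker_fps_LIMSEQ[of 1 0 "v - 1" u "- v - u"]
    ker_fps_LIMSEQ[of 0 0 "v - 1" "u + 1" "- v - u"]
  unfolding top_ker_def P_def by (cases "a = 0"; cases "b = 0") simp_all

lemma top_ker_eq_0:
  assumes "\<bar>v\<bar> > int N + 1 \<or> \<bar>u\<bar> > int N + 1 \<or> \<bar>v + u\<bar> > int N + 1"
  shows "top_ker a b N v u = 0"
  using assms unfolding top_ker_def by (auto intro!: ker_fps_eq_0)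

text \<open>The bound 2 N + 1 is the least one admissible at n = m = N. The kernels vanish once an
  entry exceeds N + 1, so the box already contains every nonzero term of the full lattice
  sum.\<close>

lemma expansion_eq_fsum:
  fixes k a b N K :: nat and \<tau> :: int
  assumes K: "int K = 3 * int k + \<tau> + 3" and AB: "a + 1 + (b + 1) < K"
  shows "X.expansion \<tau> (2 * int N + 1) k a b N N
    = fps_to_fls (fsum (\<lambda>(v, u). mac_term K (a + 1) (b + 1) v u * top_ker a b N v u) UNIV)"
proof -
  define M where "M = 2 * int N + 1"
  have "X.expansion \<tau> M k a b N N = char_sum M (\<lambda>v u w. X.nweight \<tau> k v u
     * fls_X powi (int (b + 1) * (1 - v) + int (a + 1) * (1 + u)) * fps_to_fls (top_ker a b N v u))"
  proof -
    have w: "w = - v - u" if "v + u + w = 0" for v u w :: int using that by simp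
    consider "a = 0" "b = 0" | "a = 0" "b > 0" | "a > 0" by blast
    then show ?thesis
    proof cases
      case 1
      then show ?thesis
        unfolding X.expansion_def X.exp11_def by (simp, intro char_sum_cong) (drule w, simp add: top_ker_def fps_to_fls_ker_fps)
    next
      case 2
      then show ?thesis
        unfolding X.expansion_def X.exp10_def by (simp, intro char_sum_cong) (drule w, simp add: top_ker_def fps_to_fls_ker_fps)
    next
      case 3
      then show ?thesis
        unfolding X.expansion_def X.exp00_def by (simp, intro char_sum_cong) (drule w, simp add: top_ker_def fps_to_fls_ker_fps)
    qed
  qed
  also have "\<dots> = (\<Sum>(v, u, w)\<in>tri_box M. fps_to_fls (mac_term K (a + 1) (b + 1) v u * top_ker a b N v u))"
    unfolding char_sum_def
  proof (intro sum.cong refl, clarify)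
    fix v u w
    show "of_int (chi3 (v - u)) * (X.nweight \<tau> k v u * fls_X powi (int (b + 1) * (1 - v) + int (a + 1) * (1 + u))
        * fps_to_fls (top_ker a b N v u)) = fps_to_fls (mac_term K (a + 1) (b + 1) v u * top_ker a b N v u)"
    proof (cases "chi3 (v - u) = 0")
      case True
      then show ?thesis by (simp add: mac_term_def)
    next
      case False
      define t where "t = (A2_norm v u - 1) div 3"
      have t: "A2_norm v u - 1 = 3 * t" using A2_norm_mod_3[OF False] by (simp add: t_def)
      \<comment> \<open>With norm 1 + 3 t the first two terms are (3 k + 3 + \<tau>) t = K
        t.\<close>
      have "int k * (A2_norm v u - 1) + (3 + \<tau>) * t + (int (b + 1) * (1 - v) + int (a + 1) * (1 + u))
          = mac_exp K (a + 1) (b + 1) v u"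
        unfolding mac_exp_def t_def[symmetric] K t by (simp add: algebra_simps)
      then have "X.nweight \<tau> k v u * fls_X powi (int (b + 1) * (1 - v) + int (a + 1) * (1 + u)) = fls_X powi mac_exp K (a + 1) (b + 1) v u"
        unfolding X.nweight_def t_def X.powi_add[symmetric] by simp
      moreover have "mac_exp K (a + 1) (b + 1) v u \<ge> 0"
        using mac_exp_nonneg[OF False, of "a + 1" "b + 1" K] AB by simp
      ultimately show ?thesis
        unfolding mac_term_def fps_to_fls_times fps_to_fls_X_power by (simp add: mult.assoc del: power_int_of_nat)
    qed
  qed
  also have "\<dots> = fps_to_fls (fsum (\<lambda>(v, u). mac_term K (a + 1) (b + 1) v u * top_ker a b N v u) UNIV)"
  proof -
    define B where "B = (\<lambda>(v, u, w). (v, u)) ` tri_box M"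
    have inj: "inj_on (\<lambda>(v, u, w). (v, u)) (tri_box M)"
      by (auto simp: inj_on_def tri_box_def)
    have out: "top_ker a b N v u = 0" if "(v, u) \<notin> B" for v u
    proof (rule top_ker_eq_0, rule ccontr)
      assume "\<not> (\<bar>v\<bar> > int N + 1 \<or> \<bar>u\<bar> > int N + 1 \<or> \<bar>v + u\<bar> > int N + 1)"
      then have "(v, u, - v - u) \<in> tri_box M" by (auto simp: tri_box_def M_def)
      then have "(v, u) \<in> B" unfolding B_def by force
      then show False using that by simp
    qed
    have "fsum (\<lambda>(v, u). mac_term K (a + 1) (b + 1) v u * top_ker a b N v u) UNIV
      = (\<Sum>(v, u)\<in>B. mac_term K (a + 1) (b + 1) v u * top_ker a b N v u)"
    proof (rule fps_ext)
      fix n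
      show "fps_nth (fsum (\<lambda>(v, u). mac_term K (a + 1) (b + 1) v u * top_ker a b N v u) UNIV) n
        = fps_nth (\<Sum>(v, u)\<in>B. mac_term K (a + 1) (b + 1) v u * top_ker a b N v u) n"
        unfolding fps_sum_nth
      proof (rule fsum_nth)
        show "finite B" unfolding B_def using finite_tri_box by simp
        show "{p \<in> UNIV. fps_nth (case p of (v, u) \<Rightarrow> mac_term K (a + 1) (b + 1) v u * top_ker a b N v u) n \<noteq> 0} \<subseteq> B"
        proof
          fix p assume p: "p \<in> {p \<in> UNIV. fps_nth (case p of (v, u) \<Rightarrow> mac_term K (a + 1) (b + 1) v u * top_ker a b N v u) n \<noteq> 0}"
          obtain v u where vu: "p = (v, u)" by (cases p)
          show "p \<in> B"
          proof (rule ccontr)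
            assume "p \<notin> B"
            then show False using out[of v u] p vu by simp
          qed
        qed
      qed simp
    qed
    also have "\<dots> = (\<Sum>(v, u, w)\<in>tri_box M. mac_term K (a + 1) (b + 1) v u * top_ker a b N v u)"
      unfolding B_def sum.reindex[OF inj] by (intro sum.cong) auto
    finally show ?thesis by (simp add: fps_to_fls_sum case_prod_beta)
  qed
  finally show ?thesis unfolding M_def .
qed

text \<open>Times 1 - q, both sides are the chain \<open>schain\<close> with k steps: the left by
  resolving it into partitions, the right by its expansion in kernels. The factor cancels in the
  field of Laurent series.\<close>

lemma finite_identity:
  fixes k a b N K :: nat and \<tau> :: int
  assumes k: "k \<ge> 1" and \<tau>: "\<tau> \<in> {-1, 0, 1}" and ab: "a \<le> b" "b \<le> k"
    and K: "int K = 3 * int k + \<tau> + 3" and AB: "a + 1 + (b + 1) < K"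
  shows "fsum (\<lambda>p. (case p of (l, m) \<Rightarrow> summand k \<tau> a b l m)
      * (case p of (l, m) \<Rightarrow> inv_qpoch 1 (int N - int (l 1)) * inv_qpoch 1 (int N - int (m 1)))) (parts k \<times> parts k)
    = fsum (\<lambda>(v, u). mac_term K (a + 1) (b + 1) v u * top_ker a b N v u) UNIV" (is "?L = ?R")
proof -
  define g where "g = (\<lambda>n m. fps_to_fls (gfun n m \<tau>))"
  define T where "T = (\<lambda>l m. summand k \<tau> a b l m * (inv_qpoch 1 (int N - int (l 1)) * inv_qpoch 1 (int N - int (m 1))))"
  have L: "?L = (\<Sum>l\<in>bounded_parts k N. \<Sum>m\<in>bounded_parts k N. T l m)"
  proof (rule fps_ext)
    fix n
    have "fps_nth ?L n = (\<Sum>p\<in>bounded_parts k N \<times> bounded_parts k N. fps_nth ((case p of (l, m) \<Rightarrow> summand k \<tau> a b l m)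
      * (case p of (l, m) \<Rightarrow> inv_qpoch 1 (int N - int (l 1)) * inv_qpoch 1 (int N - int (m 1)))) n)"
    proof (rule fsum_nth)
      show "{p \<in> parts k \<times> parts k. fps_nth ((case p of (l, m) \<Rightarrow> summand k \<tau> a b l m)
        * (case p of (l, m) \<Rightarrow> inv_qpoch 1 (int N - int (l 1)) * inv_qpoch 1 (int N - int (m 1)))) n \<noteq> 0} \<subseteq> bounded_parts k N \<times> bounded_parts k N"
        by (auto simp: bounded_parts_def inv_qpoch_def split: if_splits)
    qed (auto simp: finite_bounded_parts, auto simp: bounded_parts_def)
    then show "fps_nth ?L n = fps_nth (\<Sum>l\<in>bounded_parts k N. \<Sum>m\<in>bounded_parts k N. T l m) n"
      by (simp add: sum.cartesian_product fps_sum_nth case_prod_beta T_def)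
  qed
  have "(1 - fls_X) * fps_to_fls ?L = fps_to_fls (\<Sum>l\<in>bounded_parts k N. \<Sum>m\<in>bounded_parts k N. (1 - fps_X) * T l m)"
    unfolding L by (simp add: fps_to_fls_sum fps_to_fls_times sum_distrib_left)
  also have "(\<Sum>l\<in>bounded_parts k N. \<Sum>m\<in>bounded_parts k N. (1 - fps_X) * T l m)
    = (\<Sum>l\<in>bounded_parts k N. \<Sum>m\<in>bounded_parts k N. chain \<tau> k a b N N l m
        - (if a = 0 \<or> b = 0 then 0 else fps_X * chain \<tau> k (a - 1) (b - 1) N N l m))"
  proof (intro sum.cong refl)
    fix l m assume "l \<in> bounded_parts k N" "m \<in> bounded_parts k N"
    then have "l \<in> parts k" "m \<in> parts k" by (auto simp: bounded_parts_def)
    then show "(1 - fps_X) * T l m = chain \<tau> k a b N N l m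
        - (if a = 0 \<or> b = 0 then 0 else fps_X * chain \<tau> k (a - 1) (b - 1) N N l m)"
      unfolding T_def using summand_chain[OF k _ _] ab by simp
  qed
  also have "fps_to_fls \<dots> = X.schain g k a b N N"
  proof (cases "a = 0 \<or> b = 0")
    case True
    then show ?thesis by (simp add: X.schain_def g_def tchain_eq_chain)
  next
    case False
    then show ?thesis
      by (simp add: X.schain_def g_def tchain_eq_chain sum_subtractf sum_distrib_left[symmetric] fps_to_fls_times)
  qed
  also have "\<dots> = (1 - fls_X) * X.expansion \<tau> (2 * int N + 1) k a b N N"
    using ab gfun_eq_exp11[OF \<tau>] by (intro X.schain_eq_expansion) (auto simp: g_def)
  also have "\<dots> = (1 - fls_X) * fps_to_fls ?R"
    unfolding expansion_eq_fsum[OF K AB] ..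
  finally have "(1 - fls_X) * fps_to_fls ?L = (1 - fls_X) * fps_to_fls ?R" .
  moreover have nz: "1 - fls_X \<noteq> (0 :: real fls)"
    using X.q_not_root_of_unity[of 1] by auto
  ultimately show ?thesis by (simp only: mult_left_cancel[OF nz] fps_to_fls_eq_iff)
qed

lemma fsum_summand:
  fixes k a b K :: nat and \<tau> :: int
  assumes k: "k \<ge> 1" and \<tau>: "\<tau> \<in> {-1, 0, 1}" and ab: "a \<le> b" "b \<le> k"
    and K: "int K = 3 * int k + \<tau> + 3"
  shows "fsum (\<lambda>(l, m). summand k \<tau> a b l m) (parts k \<times> parts k)
    = qpoch_inf K K ^ 2 / qpoch_inf 1 1 ^ 3 * (qtheta (a + 1) K * qtheta (b + 1) K * qtheta (a + b + 2) K)"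
proof -
  \<comment> \<open>From a + b + 2 \<le> 2 k + 2 and K \<ge> 3 k + 2 with k \<ge> 1. This puts all
    three theta arguments strictly between 0 and K.\<close>
  have AB: "a + 1 + (b + 1) < K" using assms by auto
  define P where "P = qpoch_inf 1 1"
  define S where "S = fsum (\<lambda>(l, m). summand k \<tau> a b l m) (parts k \<times> parts k)"
  define T where "T = fsum (\<lambda>(v, u). mac_term K (a + 1) (b + 1) v u) UNIV"
  have P0: "fps_nth P 0 \<noteq> 0" by (simp add: P_def qpoch_inf_nth_0)
  have "(\<lambda>N. fsum (\<lambda>p. (case p of (l, m) \<Rightarrow> summand k \<tau> a b l m)
      * (case p of (l, m) \<Rightarrow> inv_qpoch 1 (int N - int (l 1)) * inv_qpoch 1 (int N - int (m 1)))) (parts k \<times> parts k))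
    \<longlonglongrightarrow> S * (inverse P * inverse P)"
    unfolding S_def
  proof (rule LIMSEQ_fsum[OF locally_finite_summand[OF k]])
    fix p :: "(nat \<Rightarrow> nat) \<times> (nat \<Rightarrow> nat)"
    obtain l m where p: "p = (l, m)" by (cases p)
    have "(\<lambda>N. inv_qpoch 1 (int N - int c)) \<longlonglongrightarrow> inverse P" for c
      using inv_qpoch_LIMSEQ[of 1 "- int c"] by (simp add: P_def)
    then show "(\<lambda>N. case p of (l, m) \<Rightarrow> inv_qpoch 1 (int N - int (l 1)) * inv_qpoch 1 (int N - int (m 1))) \<longlonglongrightarrow> inverse P * inverse P"
      unfolding p prod.case by (intro LIMSEQ_fps_mult)
  qed
  then have 1: "(\<lambda>N. fsum (\<lambda>(v, u). mac_term K (a + 1) (b + 1) v u * top_ker a b N v u) UNIV) \<longlonglongrightarrow> S * (inverse P * inverse P)"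
    unfolding finite_identity[OF k \<tau> ab K AB] .
  have 2: "(\<lambda>N. fsum (\<lambda>p. (case p of (v, u) \<Rightarrow> mac_term K (a + 1) (b + 1) v u) * (case p of (v, u) \<Rightarrow> top_ker a b N v u)) UNIV)
    \<longlonglongrightarrow> T * (P * (inverse P * inverse P * inverse P * (inverse P * inverse P * inverse P)))"
    unfolding T_def
  proof (rule LIMSEQ_fsum)
    show "locally_finite (\<lambda>(v, u). mac_term K (a + 1) (b + 1) v u) UNIV"
      using AB by (intro locally_finite_mac_term) auto
    fix p :: "int \<times> int"
    show "(\<lambda>N. case p of (v, u) \<Rightarrow> top_ker a b N v u)
      \<longlonglongrightarrow> P * (inverse P * inverse P * inverse P * (inverse P * inverse P * inverse P))"
      using top_ker_LIMSEQ unfolding P_def by (cases p) auto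
  qed
  have f: "(\<lambda>(v, u). mac_term K (a + 1) (b + 1) v u * top_ker a b N v u)
    = (\<lambda>p. (case p of (v, u) \<Rightarrow> mac_term K (a + 1) (b + 1) v u) * (case p of (v, u) \<Rightarrow> top_ker a b N v u))" for N
    by auto
  \<comment> \<open>The two capping factors give P^(-2) on the left, the kernel gives P^(-5) on the
    right; the quotient is the (q;q)^3 in the denominator.\<close>
  have eq: "S * (inverse P * inverse P) = T * (P * (inverse P * inverse P * inverse P * (inverse P * inverse P * inverse P)))"
    by (rule LIMSEQ_unique[OF 1[unfolded f] 2])
  have i: "inverse P * P = 1" using P0 by (rule inverse_mult_eq_1)
  have "S = S * (inverse P * inverse P) * P * P"
    using i by algebra
  also have "\<dots> = T * inverse P ^ 3"
    unfolding eq using i by algebra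
  also have "T = qpoch_inf K K ^ 2 * (qtheta (a + 1) K * qtheta (b + 1) K * qtheta (a + b + 2) K)"
    unfolding T_def using macdonald_A2[of "a + 1" "b + 1" K] AB by simp
  also have "\<dots> * inverse P ^ 3 = qpoch_inf K K ^ 2 / P ^ 3 * (qtheta (a + 1) K * qtheta (b + 1) K * qtheta (a + b + 2) K)"
  proof -
    have "fps_nth (P ^ 3) 0 \<noteq> 0" using P0 by simp
    then have "qpoch_inf K K ^ 2 / P ^ 3 = qpoch_inf K K ^ 2 * inverse P ^ 3"
      by (simp add: fps_divide_eq_mult_inverse fps_inverse_power)
    then show ?thesis by (simp add: mult_ac)
  qed
  finally show ?thesis unfolding S_def P_def .
qed

section \<open>Symmetry under exchange of the two partitions\<close>

lemma gfun_commute: "gfun n m \<tau> = gfun m n \<tau>"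
proof -
  have "qbinom s (n + m) n = qbinom s (m + n) m" for s
    by (simp add: qbinom_def add.commute mult.commute)
  then show ?thesis by (simp add: gfun_def add.commute mult_ac)
qed

lemma summand_commute: "summand k \<tau> a b l m = summand k \<tau> b a m l"
proof -
  have e1: "(\<Sum>i=1..k. int (l i)^2 - int (l i) * int (m i) + int (m i)^2)
      = (\<Sum>i=1..k. int (m i)^2 - int (m i) * int (l i) + int (l i)^2)"
    by (intro sum.cong) (auto simp: algebra_simps)
  have e2: "(\<Prod>i=1..k-1. qpoch 1 1 (l i - l (i + 1)) * qpoch 1 1 (m i - m (i + 1)))
      = (\<Prod>i=1..k-1. qpoch 1 1 (m i - m (i + 1)) * qpoch 1 1 (l i - l (i + 1)))"
    by (simp only: mult.commute)
  have e3: "l a + m b = m b + l a" "x + (\<Sum>i=a+1..k. l i) + (\<Sum>i=b+1..k. m i)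
      = x + (\<Sum>i=b+1..k. m i) + (\<Sum>i=a+1..k. l i)" for x by simp_all
  show ?thesis
    unfolding summand_def gfun_commute[of "l k"] e1 e2 e3 disj_commute[of "a = 0"] ..
qed

theorem theorem1p2:
  fixes k a b :: nat and \<tau> :: int
  assumes "k \<ge> 1" and "\<tau> \<in> {-1, 0, 1}" and "a \<le> k" and "b \<le> k"
  defines "K \<equiv> nat (3 * int k + \<tau> + 3)"
  shows "((\<lambda>(l, m). summand k \<tau> a b l m) has_sum
           (qpoch_inf K K ^ 2 / qpoch_inf 1 1 ^ 3
            * (qtheta (a + 1) K * qtheta (b + 1) K * qtheta (a + b + 2) K)))
         (parts k \<times> parts k)"
proof -
  have K: "int K = 3 * int k + \<tau> + 3" using assms(1,2) by (auto simp: K_def)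
  have "fsum (\<lambda>(l, m). summand k \<tau> a b l m) (parts k \<times> parts k)
    = qpoch_inf K K ^ 2 / qpoch_inf 1 1 ^ 3 * (qtheta (a + 1) K * qtheta (b + 1) K * qtheta (a + b + 2) K)"
  \<comment> \<open>The chain removes the weight q^s before q^r, which forces
    \<open>a \<le> b\<close>; exchanging the partitions covers the other case.\<close>
  proof (cases "a \<le> b")
    case True
    then show ?thesis using fsum_summand[OF assms(1,2) _ assms(4) K] by blast
  next
    case False
    have bij: "bij_betw prod.swap (parts k \<times> parts k) (parts k \<times> parts k)"
      by (rule bij_betw_byWitness[of _ prod.swap]) auto
    have "fsum (\<lambda>(l, m). summand k \<tau> a b l m) (parts k \<times> parts k)
      = fsum (\<lambda>p. (case prod.swap p of (l, m) \<Rightarrow> summand k \<tau> b a l m)) (parts k \<times> parts k)"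
      by (intro fsum_cong) (auto intro: summand_commute)
    also have "\<dots> = fsum (\<lambda>(l, m). summand k \<tau> b a l m) (parts k \<times> parts k)"
      by (rule fsum_reindex[OF bij])
    finally show ?thesis
      using fsum_summand[OF assms(1,2) _ assms(3) K, of b] False by (simp add: mult_ac add.commute)
  qed
  then show ?thesis
    using fsum_has_sum[OF locally_finite_summand[OF assms(1)]] by metis
qed

end
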